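(* Let $k$ be a $\Sigma\Delta\Pi$-field and let $C=k^{\Sigma\Delta}$ be $\Pi$-differentially closed. Let $R$ be a $\Sigma\Delta\Pi$-PV extension of $k$ (for a $\Sigma\Delta$-linear system of size $n$) with total ring of quotients $K$. Then $\mathrm{Aut}_{\Sigma\Delta\Pi}(K/k)$ may be identified with the group $G(C)$ of $C$-points of a linear $\Pi$-differential algebraic group $G\subset\mathrm{GL}_n$ defined over $C$.
   Context: All fields have characteristic $0$. A $\Sigma\Delta\Pi$-ring is a (commutative, unital) ring $R$ with a set of automorphisms $\Sigma=\{\sigma_i\}$ and sets of derivations $\Delta=\{\delta_i\}$, $\Pi=\{\partial_i\}$ such that any two elements of $\Sigma\cup\Delta\cup\Pi$ commute as maps on $R$; $\Sigma\Delta\Pi$-fields, -ideals, etc. are defined similarly. Differential-algebraic notions are those of Kolchin and Cassidy (finite sets of commuting derivations). $R^{\Sigma\Delta}=\{c\in R:\delta(c)=0\ \forall\delta\in\Delta,\ \sigma(c)=c\ \forall\sigma\in\Sigma\}$. A $\Sigma\Delta\Pi$-ring is simple if its only $\Sigma\Delta\Pi$-ideals are $(0)$ and itself. A $\Sigma\Delta$-linear system over $k$ is a system $\sigma_i(Y)=A_iY$ ($A_i\in\mathrm{GL}_n(k)$, $\sigma_i\in\Sigma$), $\delta_i(Y)=B_iY$ ($B_i\in\mathfrak{gl}_n(k)$, $\delta_i\in\Delta$) satisfying $\sigma_i(A_j)A_i=\sigma_j(A_i)A_j$, $\sigma_i(B_j)A_i=\delta_j(A_i)+A_iB_j$, $\delta_i(B_j)+B_jB_i=\delta_j(B_i)+B_iB_j$.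 A $\Sigma\Delta\Pi$-PV ring (extension) for the system is a simple $\Sigma\Delta\Pi$-ring $R\supset k$ containing $Z\in\mathrm{GL}_n(R)$ with $\sigma_i(Z)=A_iZ$, $\delta_i(Z)=B_iZ$ for all $i$, and with $R=k\{Z,1/\det Z\}_\Pi$ (generated over $k$ as a $\Pi$-ring by the entries of $Z$ and $1/\det Z$). $\mathrm{Aut}_{\Sigma\Delta\Pi}(K/k)$ is the group of ring automorphisms of $K$ over $k$ commuting with all elements of $\Sigma\cup\Delta\cup\Pi$; the identification is $\phi\mapsto M_\phi\in\mathrm{GL}_n(C)$ with $\phi(Z)=ZM_\phi$. A linear $\Pi$-differential algebraic group $G\subset \mathrm{GL}_n$ defined over $C$ is a subgroup defined by the vanishing of $\Pi$-differential polynomials over $C$ in the matrix entries. *)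

theory Defs
  imports "HOL-Analysis.Analysis" "HOL-Algebra.Ring" "HOL-Library.Poly_Mapping"
begin

text \<open>
  All rings that occur (the base field, the PV ring, the constants) are subrings of the total ring
  of quotients of the PV ring, which is an ambient type of class \<^class>\<open>comm_ring_1\<close>. The sets
  \<open>\<Sigma>\<close> and \<open>\<Delta>\<close> are sets of maps on it. The derivations in \<open>\<Pi>\<close> are given as a list \<open>ds\<close>, because they
  also act, under the same names, on differential field extensions that are not contained in the
  ambient ring.
\<close>


section \<open>Rings with commuting automorphisms and derivations\<close>

definition is_subring :: "'a::comm_ring_1 set \<Rightarrow> bool" where
  "is_subring X \<longleftrightarrow> 1 \<in> X \<and> (\<forall>x\<in>X. \<forall>y\<in>X. x - y \<in> X \<and> x * y \<in> X)"

definition is_automorphism :: "'a::comm_ring_1 set \<Rightarrow> ('a \<Rightarrow> 'a) \<Rightarrow> bool" where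
  "is_automorphism X \<sigma> \<longleftrightarrow> bij_betw \<sigma> X X \<and> \<sigma> 1 = 1 \<and>
     (\<forall>x\<in>X. \<forall>y\<in>X. \<sigma> (x + y) = \<sigma> x + \<sigma> y \<and> \<sigma> (x * y) = \<sigma> x * \<sigma> y)"

definition is_derivation :: "'a::comm_ring_1 set \<Rightarrow> ('a \<Rightarrow> 'a) \<Rightarrow> bool" where
  "is_derivation X \<delta> \<longleftrightarrow> \<delta> ` X \<subseteq> X \<and>
     (\<forall>x\<in>X. \<forall>y\<in>X. \<delta> (x + y) = \<delta> x + \<delta> y \<and> \<delta> (x * y) = \<delta> x * y + x * \<delta> y)"

definition sdp_ring ::
  "('a::comm_ring_1 \<Rightarrow> 'a) set \<Rightarrow> ('a \<Rightarrow> 'a) set \<Rightarrow> ('a \<Rightarrow> 'a) list \<Rightarrow> 'a set \<Rightarrow> bool" where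
  "sdp_ring \<Sigma> \<Delta> ds X \<longleftrightarrow> is_subring X \<and>
     (\<forall>\<sigma>\<in>\<Sigma>. is_automorphism X \<sigma>) \<and>
     (\<forall>\<delta>\<in>\<Delta> \<union> set ds. is_derivation X \<delta>) \<and>
     (\<forall>f\<in>\<Sigma> \<union> \<Delta> \<union> set ds. \<forall>g\<in>\<Sigma> \<union> \<Delta> \<union> set ds. \<forall>x\<in>X. f (g x) = g (f x))"

definition sdp_field ::
  "('a::comm_ring_1 \<Rightarrow> 'a) set \<Rightarrow> ('a \<Rightarrow> 'a) set \<Rightarrow> ('a \<Rightarrow> 'a) list \<Rightarrow> 'a set \<Rightarrow> bool" where
  "sdp_field \<Sigma> \<Delta> ds X \<longleftrightarrow> sdp_ring \<Sigma> \<Delta> ds X \<and> (\<forall>x\<in>X. x \<noteq> 0 \<longrightarrow> (\<exists>y\<in>X. x * y = 1))"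

definition sd_constants ::
  "('a::comm_ring_1 \<Rightarrow> 'a) set \<Rightarrow> ('a \<Rightarrow> 'a) set \<Rightarrow> 'a set \<Rightarrow> 'a set" where
  "sd_constants \<Sigma> \<Delta> X = {c \<in> X. (\<forall>\<delta>\<in>\<Delta>. \<delta> c = 0) \<and> (\<forall>\<sigma>\<in>\<Sigma>. \<sigma> c = c)}"

definition sdp_ideal ::
  "('a::comm_ring_1 \<Rightarrow> 'a) set \<Rightarrow> ('a \<Rightarrow> 'a) set \<Rightarrow> ('a \<Rightarrow> 'a) list \<Rightarrow> 'a set \<Rightarrow> 'a set \<Rightarrow> bool" where
  "sdp_ideal \<Sigma> \<Delta> ds X I \<longleftrightarrow> I \<subseteq> X \<and> 0 \<in> I \<and>
     (\<forall>x\<in>I. \<forall>y\<in>I. x + y \<in> I) \<and> (\<forall>r\<in>X. \<forall>x\<in>I. r * x \<in> I) \<and>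
     (\<forall>f\<in>\<Sigma> \<union> \<Delta> \<union> set ds. f ` I \<subseteq> I)"

definition simple_sdp_ring ::
  "('a::comm_ring_1 \<Rightarrow> 'a) set \<Rightarrow> ('a \<Rightarrow> 'a) set \<Rightarrow> ('a \<Rightarrow> 'a) list \<Rightarrow> 'a set \<Rightarrow> bool" where
  "simple_sdp_ring \<Sigma> \<Delta> ds X \<longleftrightarrow> sdp_ring \<Sigma> \<Delta> ds X \<and>
     (\<forall>I. sdp_ideal \<Sigma> \<Delta> ds X I \<longrightarrow> I = {0} \<or> I = X)"

definition pi_ring_generated :: "('a::comm_ring_1 \<Rightarrow> 'a) list \<Rightarrow> 'a set \<Rightarrow> 'a set" where
  "pi_ring_generated ds A = \<Inter> {X. is_subring X \<and> (\<forall>d\<in>set ds. d ` X \<subseteq> X) \<and> A \<subseteq> X}"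

definition nonzerodivisors :: "'a::comm_ring_1 set \<Rightarrow> 'a set" where
  "nonzerodivisors X = {s \<in> X. \<forall>t\<in>X. s * t = 0 \<longrightarrow> t = 0}"

text \<open>The whole ambient type is the total ring of quotients of its subring \<open>X\<close>.\<close>

definition total_quotient_ring_of :: "'a::comm_ring_1 set \<Rightarrow> bool" where
  "total_quotient_ring_of X \<longleftrightarrow> (\<forall>s\<in>nonzerodivisors X. s dvd 1) \<and>
     (\<forall>x. \<exists>r\<in>X. \<exists>s\<in>nonzerodivisors X. x * s = r)"


section \<open>Differential polynomials\<close>

text \<open>
  The variable \<open>(v, e)\<close> of the polynomial ring stands for the derivative of the unknown \<open>v\<close> by
  \<open>ds!0 ^ e 0 \<cdot> ds!1 ^ e 1 \<cdots>\<close>.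
\<close>

type_synonym ('v, 'a) dpoly = "(('v \<times> (nat \<Rightarrow>\<^sub>0 nat)) \<Rightarrow>\<^sub>0 nat) \<Rightarrow>\<^sub>0 'a"

definition dpolys :: "nat \<Rightarrow> 'a::comm_ring_1 set \<Rightarrow> 'v set \<Rightarrow> ('v, 'a) dpoly set" where
  "dpolys m C V = {p. (\<forall>t\<in>Poly_Mapping.keys p. Poly_Mapping.lookup p t \<in> C \<and>
     (\<forall>(v, e)\<in>Poly_Mapping.keys t. v \<in> V \<and> Poly_Mapping.keys e \<subseteq> {..<m}))}"

definition derivative_op :: "('a \<Rightarrow> 'a) list \<Rightarrow> (nat \<Rightarrow>\<^sub>0 nat) \<Rightarrow> 'a \<Rightarrow> 'a" where
  "derivative_op ds e = foldr (\<lambda>i f. (ds ! i ^^ Poly_Mapping.lookup e i) \<circ> f) [0..<length ds] id"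

definition dpoly_eval ::
  "('a::comm_ring_1 \<Rightarrow> 'a) list \<Rightarrow> ('v \<Rightarrow> 'a) \<Rightarrow> ('v, 'a) dpoly \<Rightarrow> 'a" where
  "dpoly_eval ds a p =
     (\<Sum>t\<in>Poly_Mapping.keys p. Poly_Mapping.lookup p t *
        (\<Prod>(v, e)\<in>Poly_Mapping.keys t. derivative_op ds e (a v) ^ Poly_Mapping.lookup t (v, e)))"


section \<open>Differentially closed fields\<close>

definition ring_on :: "'a::comm_ring_1 set \<Rightarrow> 'a ring" where
  "ring_on C = \<lparr>carrier = C, monoid.mult = (*), one = 1, zero = 0, add = (+)\<rparr>"

definition pi_field_extension ::
  "('a::comm_ring_1 \<Rightarrow> 'a) list \<Rightarrow> 'a set \<Rightarrow> ('e, 'b) ring_scheme \<Rightarrow> ('e \<Rightarrow> 'e) list \<Rightarrow>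
   ('a \<Rightarrow> 'e) \<Rightarrow> bool" where
  "pi_field_extension ds C E es h \<longleftrightarrow> field E \<and> h \<in> ring_hom (ring_on C) E \<and>
     length es = length ds \<and>
     (\<forall>d\<in>set es. d ` carrier E \<subseteq> carrier E \<and>
        (\<forall>x\<in>carrier E. \<forall>y\<in>carrier E. d (x \<oplus>\<^bsub>E\<^esub> y) = d x \<oplus>\<^bsub>E\<^esub> d y \<and>
           d (x \<otimes>\<^bsub>E\<^esub> y) = (d x \<otimes>\<^bsub>E\<^esub> y) \<oplus>\<^bsub>E\<^esub> (x \<otimes>\<^bsub>E\<^esub> d y))) \<and>
     (\<forall>d\<in>set es. \<forall>d'\<in>set es. \<forall>x\<in>carrier E. d (d' x) = d' (d x)) \<and>
     (\<forall>i<length ds. \<forall>c\<in>C. h ((ds ! i) c) = (es ! i) (h c))"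

definition dpoly_eval_ext ::
  "('e, 'b) ring_scheme \<Rightarrow> ('e \<Rightarrow> 'e) list \<Rightarrow> ('a::comm_ring_1 \<Rightarrow> 'e) \<Rightarrow> ('v \<Rightarrow> 'e) \<Rightarrow>
   ('v, 'a) dpoly \<Rightarrow> 'e" where
  "dpoly_eval_ext E es h a p =
     (\<Oplus>\<^bsub>E\<^esub>t\<in>Poly_Mapping.keys p. h (Poly_Mapping.lookup p t) \<otimes>\<^bsub>E\<^esub>
        (\<Otimes>\<^bsub>E\<^esub>x\<in>Poly_Mapping.keys t.
           derivative_op es (snd x) (a (fst x)) [^]\<^bsub>E\<^esub> Poly_Mapping.lookup t x))"

text \<open>
  HOL cannot quantify over all types inside a definition, so the carriers of the extensions are
  taken from one type which is large enough: a zero in an arbitrary extension of \<open>C\<close> already lies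
  in a finitely generated one, that is, up to isomorphism, in the field of fractions of
  \<open>C{y\<^sub>0,\<dots>,y\<^sub>n\<^sub>-\<^sub>1}/P\<close> for a prime differential ideal \<open>P\<close>, whose elements are sets of pairs of
  differential polynomials.
\<close>

type_synonym 'a ext_carrier = "((nat, 'a) dpoly \<times> (nat, 'a) dpoly) set"

definition differentially_closed :: "('a::comm_ring_1 \<Rightarrow> 'a) list \<Rightarrow> 'a set \<Rightarrow> bool" where
  "differentially_closed ds C \<longleftrightarrow>
     (\<forall>(n::nat) Ps Q. finite Ps \<and> Ps \<subseteq> dpolys (length ds) C {..<n} \<and> Q \<in> dpolys (length ds) C {..<n} \<and>
        (\<exists>(E :: 'a ext_carrier ring) es h a. pi_field_extension ds C E es h \<and>
           a ` {..<n} \<subseteq> carrier E \<and>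
           (\<forall>P\<in>Ps. dpoly_eval_ext E es h a P = \<zero>\<^bsub>E\<^esub>) \<and> dpoly_eval_ext E es h a Q \<noteq> \<zero>\<^bsub>E\<^esub>) \<longrightarrow>
        (\<exists>a. a ` {..<n} \<subseteq> C \<and>
           (\<forall>P\<in>Ps. dpoly_eval ds a P = 0) \<and> dpoly_eval ds a Q \<noteq> 0))"


section \<open>Linear systems and PV rings\<close>

definition mats :: "'a set \<Rightarrow> ('a ^ 'n ^ 'n) set" where
  "mats X = {M. \<forall>i j. M $ i $ j \<in> X}"

definition GL :: "'a::comm_ring_1 set \<Rightarrow> ('a ^ 'n::finite ^ 'n) monoid" where
  "GL X = \<lparr>carrier = {M \<in> mats X. \<exists>N\<in>mats X. M ** N = mat 1 \<and> N ** M = mat 1},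
           monoid.mult = (**), one = mat 1\<rparr>"

definition sd_linear_system ::
  "('a::comm_ring_1 \<Rightarrow> 'a) set \<Rightarrow> ('a \<Rightarrow> 'a) set \<Rightarrow> 'a set \<Rightarrow>
   (('a \<Rightarrow> 'a) \<Rightarrow> 'a ^ 'n::finite ^ 'n) \<Rightarrow> (('a \<Rightarrow> 'a) \<Rightarrow> 'a ^ 'n ^ 'n) \<Rightarrow> bool" where
  "sd_linear_system \<Sigma> \<Delta> k A B \<longleftrightarrow>
     (\<forall>\<sigma>\<in>\<Sigma>. A \<sigma> \<in> carrier (GL k)) \<and> (\<forall>\<delta>\<in>\<Delta>. B \<delta> \<in> mats k) \<and>
     (\<forall>\<sigma>\<in>\<Sigma>. \<forall>\<tau>\<in>\<Sigma>. map_matrix \<sigma> (A \<tau>) ** A \<sigma> = map_matrix \<tau> (A \<sigma>) ** A \<tau>) \<and>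
     (\<forall>\<sigma>\<in>\<Sigma>. \<forall>\<delta>\<in>\<Delta>. map_matrix \<sigma> (B \<delta>) ** A \<sigma> = map_matrix \<delta> (A \<sigma>) + A \<sigma> ** B \<delta>) \<and>
     (\<forall>\<delta>\<in>\<Delta>. \<forall>\<epsilon>\<in>\<Delta>. map_matrix \<delta> (B \<epsilon>) + B \<epsilon> ** B \<delta> = map_matrix \<epsilon> (B \<delta>) + B \<delta> ** B \<epsilon>)"

definition pv_ring ::
  "('a::comm_ring_1 \<Rightarrow> 'a) set \<Rightarrow> ('a \<Rightarrow> 'a) set \<Rightarrow> ('a \<Rightarrow> 'a) list \<Rightarrow> 'a set \<Rightarrow>
   (('a \<Rightarrow> 'a) \<Rightarrow> 'a ^ 'n::finite ^ 'n) \<Rightarrow> (('a \<Rightarrow> 'a) \<Rightarrow> 'a ^ 'n ^ 'n) \<Rightarrow>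
   'a ^ 'n ^ 'n \<Rightarrow> 'a set \<Rightarrow> bool" where
  "pv_ring \<Sigma> \<Delta> ds k A B Z R \<longleftrightarrow> simple_sdp_ring \<Sigma> \<Delta> ds R \<and> k \<subseteq> R \<and> Z \<in> carrier (GL R) \<and>
     (\<forall>\<sigma>\<in>\<Sigma>. map_matrix \<sigma> Z = A \<sigma> ** Z) \<and> (\<forall>\<delta>\<in>\<Delta>. map_matrix \<delta> Z = B \<delta> ** Z) \<and>
     R = pi_ring_generated ds (k \<union> {Z $ i $ j | i j. True} \<union> {w. w * det Z = 1})"


section \<open>Automorphism groups and linear differential algebraic groups\<close>

text \<open>The ambient type is \<open>K\<close>; the group operation is composition of maps.\<close>

definition aut_group ::
  "('a::comm_ring_1 \<Rightarrow> 'a) set \<Rightarrow> ('a \<Rightarrow> 'a) set \<Rightarrow> ('a \<Rightarrow> 'a) list \<Rightarrow> 'a set \<Rightarrow> ('a \<Rightarrow> 'a) monoid" where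
  "aut_group \<Sigma> \<Delta> ds k =
     \<lparr>carrier = {\<phi>. is_automorphism UNIV \<phi> \<and> (\<forall>x\<in>k. \<phi> x = x) \<and>
        (\<forall>f\<in>\<Sigma> \<union> \<Delta> \<union> set ds. \<forall>x. \<phi> (f x) = f (\<phi> x))},
      monoid.mult = (\<circ>), one = id\<rparr>"

text \<open>
  \<open>C\<close> is meant to be differentially closed; as usual a linear differential algebraic group over
  \<open>C\<close> is then identified with its group \<open>G\<close> of \<open>C\<close>-points.
\<close>

definition linear_diff_alg_group ::
  "('a::comm_ring_1 \<Rightarrow> 'a) list \<Rightarrow> 'a set \<Rightarrow> ('a ^ 'n::finite ^ 'n) set \<Rightarrow> bool" where
  "linear_diff_alg_group ds C G \<longleftrightarrow> subgroup G (GL C) \<and>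
     (\<exists>F \<subseteq> dpolys (length ds) C (UNIV :: ('n \<times> 'n) set).
        G = {M \<in> carrier (GL C). \<forall>p\<in>F. dpoly_eval ds (\<lambda>(i, j). M $ i $ j) p = 0})"

end

theory Submission
  imports Defs "HOL-Computational_Algebra.Polynomial"
begin

text \<open>
  The main point is that \<open>K\<close> has no new \<open>\<Sigma>\<Delta>\<close>-constants. Let \<open>c\<close> be one, and let \<open>R'\<close> be
  the \<open>\<Pi>\<close>-ring generated by \<open>R\<close> and \<open>c\<close>. By the theory of characteristic sets, finitely many
  equations and one inequation over \<open>C\<close> describe the specialisations of \<open>c\<close>, and \<open>C\<close> being
  differentially closed contains such a specialisation \<open>a\<close>, as generic as desired. The constants of
  \<open>K\<close> are linearly disjoint from \<open>k\<close> over \<open>C\<close>, so \<open>c \<mapsto> a\<close> extends to \<open>k{c} \<rightarrow> k\<close>.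
  A differential form of generic freeness shows that the relations \<open>p(c)\<close> with \<open>p(a) = 0\<close>, \<open>p\<close> over \<open>C\<close>,
  generate a proper ideal of \<open>R'\<close>. This ideal is stable under all operators because
  its generators are \<open>\<Sigma>\<Delta>\<close>-constants and form a set closed under \<open>\<Pi>\<close>, so it meets the simple ring \<open>R\<close> in \<open>0\<close>; writing \<open>c = r / s\<close> with
  \<open>r, s \<in> R\<close>, it contains \<open>(c - a) s = r - a s \<in> R\<close>, whence \<open>c = a \<in> C\<close>.

  Consequently \<open>Z\<^sup>-\<^sup>1 \<phi>(Z)\<close> has entries in \<open>C\<close> for every automorphism \<open>\<phi>\<close>. Conversely, if \<open>M\<close> is a zero of all
  differential polynomials over \<open>C\<close> that vanish on these matrices, then \<open>Z \<mapsto> Z M\<close> preserves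
  the \<open>k\<close>-relations of \<open>Z\<close>, and the resulting map extends to \<open>R\<close> and then to \<open>K\<close>.
\<close>

section \<open>Subrings and ideals of subrings\<close>

text \<open>\<open>R'\<close> is generated over \<open>k{c}\<close> by infinitely many derivatives,
  so generic freeness for finitely generated algebras does not cover it. Characteristic sets supply
  the missing finiteness. Call a derivative dependent if it is algebraic, modulo the prime
  \<open>P\<close>, over those of lower rank. By Dickson's lemma all dependent derivatives outside a
  finite set \<open>M\<close> are proper derivatives of members of \<open>M\<close>, and a
  differentiated relation is linear in its new leader, with the separant of the original relation as
  coefficient. Once finitely many separants are inverted, there remain independent derivatives,
  which generate freely, and finitely many further elements, to which the classical argument
  applies. The same analysis of the polynomial ring \<open>C{y}\<close> yields the finite
  description of the specialisations of \<open>c\<close>; both uses share the locale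
  \<open>diff_generated\<close>.

  No quotient ring is formed. A domain \<open>S/P\<close> is handled through congruences in
  \<open>S\<close>, and a subring of it is represented by a subring of \<open>S\<close> containing
  \<open>P\<close>. The fibre over an ideal \<open>q\<close> containing \<open>P\<close> is nonempty
  when \<open>1 \<notin> iext q S\<close>.\<close>

lemma is_subringD:
  assumes "is_subring X"
  shows "1 \<in> X" "0 \<in> X" "\<And>x y. x \<in> X \<Longrightarrow> y \<in> X \<Longrightarrow> x - y \<in> X" "\<And>x y. x \<in> X \<Longrightarrow> y \<in> X \<Longrightarrow> x * y \<in> X"
    "\<And>x. x \<in> X \<Longrightarrow> - x \<in> X" "\<And>x y. x \<in> X \<Longrightarrow> y \<in> X \<Longrightarrow> x + y \<in> X"
proof -
  show 1: "1 \<in> X" and m: "\<And>x y. x \<in> X \<Longrightarrow> y \<in> X \<Longrightarrow> x - y \<in> X"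
    and "\<And>x y. x \<in> X \<Longrightarrow> y \<in> X \<Longrightarrow> x * y \<in> X"
    using assms by (auto simp: is_subring_def)
  show 0: "0 \<in> X" using m[OF 1 1] by simp
  show u: "\<And>x. x \<in> X \<Longrightarrow> - x \<in> X" using m[OF 0] by simp
  show "\<And>x y. x \<in> X \<Longrightarrow> y \<in> X \<Longrightarrow> x + y \<in> X" using m[OF _ u] by simp
qed

lemma subring_sum:
  assumes "is_subring X" "\<And>i. i \<in> I \<Longrightarrow> f i \<in> X"
  shows "sum f I \<in> X"
  using assms(2) by (induction I rule: infinite_finite_induct) (auto intro: is_subringD[OF assms(1)])

lemma subring_prod:
  assumes "is_subring X" "\<And>i. i \<in> I \<Longrightarrow> f i \<in> X"
  shows "prod f I \<in> X"
  using assms(2) by (induction I rule: infinite_finite_induct) (auto intro: is_subringD[OF assms(1)])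

lemma subring_power: "is_subring X \<Longrightarrow> x \<in> X \<Longrightarrow> x ^ n \<in> X"
  by (induction n) (auto intro: is_subringD)

lemma subring_of_nat: "is_subring X \<Longrightarrow> of_nat n \<in> X"
  by (induction n) (auto intro: is_subringD)

section \<open>Generated subrings\<close>

inductive_set rgen :: "'a::comm_ring_1 set \<Rightarrow> 'a set" for A where
  base: "x \<in> A \<Longrightarrow> x \<in> rgen A"
| one: "1 \<in> rgen A"
| diff: "x \<in> rgen A \<Longrightarrow> y \<in> rgen A \<Longrightarrow> x - y \<in> rgen A"
| mult: "x \<in> rgen A \<Longrightarrow> y \<in> rgen A \<Longrightarrow> x * y \<in> rgen A"

lemma subring_rgen: "is_subring (rgen A)"
  by (auto simp: is_subring_def intro: rgen.intros)

lemma rgen_least: "is_subring X \<Longrightarrow> A \<subseteq> X \<Longrightarrow> rgen A \<subseteq> X"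
proof
  fix x assume "is_subring X" "A \<subseteq> X" "x \<in> rgen A"
  from this(3,1,2) show "x \<in> X"
    by (induction) (auto intro: is_subringD)
qed

lemma rgen_base: "A \<subseteq> rgen A"
  by (auto intro: rgen.base)

lemma rgen_mono: "A \<subseteq> rgen B \<Longrightarrow> rgen A \<subseteq> rgen B"
  by (rule rgen_least[OF subring_rgen])

text \<open>The inductive construction of an element mentions only finitely many generators. This is
  what makes an infinite family of derivatives accessible to induction on the highest one that
  occurs.\<close>

lemma rgen_finite:
  assumes "x \<in> rgen (D \<union> y ` V)"
  obtains W where "finite W" "W \<subseteq> V" "x \<in> rgen (D \<union> y ` W)"
proof -
  have "\<exists>W. finite W \<and> W \<subseteq> V \<and> x \<in> rgen (D \<union> y ` W)"
    using assms
  proof induction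
    case (base x)
    then show ?case
    proof
      assume "x \<in> D" then show ?thesis by (intro exI[of _ "{}"]) (auto intro: rgen.base)
    next
      assume "x \<in> y ` V"
      then obtain v where "v \<in> V" "x = y v" by auto
      then show ?thesis by (intro exI[of _ "{v}"]) (auto intro: rgen.base)
    qed
  next
    case one
    then show ?case by (intro exI[of _ "{}"]) (auto intro: rgen.one)
  next
    case (diff a b)
    then obtain W W' where *: "finite W" "W \<subseteq> V" "a \<in> rgen (D \<union> y ` W)"
      "finite W'" "W' \<subseteq> V" "b \<in> rgen (D \<union> y ` W')" by blast
    have "a \<in> rgen (D \<union> y ` (W \<union> W'))" "b \<in> rgen (D \<union> y ` (W \<union> W'))"
      using *(3,6) rgen_mono[of "D \<union> y ` W" "D \<union> y ` (W \<union> W')"] rgen_mono[of "D \<union> y ` W'" "D \<union> y ` (W \<union> W')"]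
        rgen_base[of "D \<union> y ` (W \<union> W')"] by blast+
    then show ?case using * by (intro exI[of _ "W \<union> W'"]) (auto intro: rgen.diff)
  next
    case (mult a b)
    then obtain W W' where *: "finite W" "W \<subseteq> V" "a \<in> rgen (D \<union> y ` W)"
      "finite W'" "W' \<subseteq> V" "b \<in> rgen (D \<union> y ` W')" by blast
    have "a \<in> rgen (D \<union> y ` (W \<union> W'))" "b \<in> rgen (D \<union> y ` (W \<union> W'))"
      using *(3,6) rgen_mono[of "D \<union> y ` W" "D \<union> y ` (W \<union> W')"] rgen_mono[of "D \<union> y ` W'" "D \<union> y ` (W \<union> W')"]
        rgen_base[of "D \<union> y ` (W \<union> W')"] by blast+
    then show ?case using * by (intro exI[of _ "W \<union> W'"]) (auto intro: rgen.mult)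
  qed
  with that show ?thesis by blast
qed

section \<open>Polynomials with coefficients in a subring, and extensions by one element\<close>

definition polys_over :: "'a::comm_ring_1 set \<Rightarrow> 'a poly set" where
  "polys_over D = {f. \<forall>i. coeff f i \<in> D}"

definition adj :: "'a::comm_ring_1 set \<Rightarrow> 'a \<Rightarrow> 'a set" where
  "adj D x = (\<lambda>f. poly f x) ` polys_over D"

lemma polys_over_ring:
  assumes "is_subring D"
  shows "f \<in> polys_over D \<Longrightarrow> g \<in> polys_over D \<Longrightarrow> f + g \<in> polys_over D"
    "f \<in> polys_over D \<Longrightarrow> g \<in> polys_over D \<Longrightarrow> f - g \<in> polys_over D"
    "f \<in> polys_over D \<Longrightarrow> g \<in> polys_over D \<Longrightarrow> f * g \<in> polys_over D"
    "f \<in> polys_over D \<Longrightarrow> f ^ n \<in> polys_over D"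
    "c \<in> D \<Longrightarrow> monom c n \<in> polys_over D"
    "c \<in> D \<Longrightarrow> [:c:] \<in> polys_over D"
    "c \<in> D \<Longrightarrow> f \<in> polys_over D \<Longrightarrow> smult c f \<in> polys_over D"
proof -
  note [intro] = is_subringD[OF assms]
  show "f \<in> polys_over D \<Longrightarrow> g \<in> polys_over D \<Longrightarrow> f + g \<in> polys_over D"
    "f \<in> polys_over D \<Longrightarrow> g \<in> polys_over D \<Longrightarrow> f - g \<in> polys_over D"
    "c \<in> D \<Longrightarrow> monom c n \<in> polys_over D"
    "c \<in> D \<Longrightarrow> f \<in> polys_over D \<Longrightarrow> smult c f \<in> polys_over D"
    by (auto simp: polys_over_def)
  show c: "c \<in> D \<Longrightarrow> [:c:] \<in> polys_over D" for c
    by (auto simp: polys_over_def coeff_pCons split: nat.splits)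
  show *: "f \<in> polys_over D \<Longrightarrow> g \<in> polys_over D \<Longrightarrow> f * g \<in> polys_over D" for f g
    by (auto simp: polys_over_def coeff_mult intro!: subring_sum[OF assms])
  show "f \<in> polys_over D \<Longrightarrow> f ^ n \<in> polys_over D"
    by (induction n) (auto intro!: * c simp: one_pCons)
qed

lemma poly_in_subring:
  assumes "is_subring X" "f \<in> polys_over X" "x \<in> X"
  shows "poly f x \<in> X"
  unfolding poly_altdef using assms
  by (auto intro!: subring_sum[OF assms(1)] is_subringD[OF assms(1)] subring_power simp: polys_over_def)

lemma polys_over_mono: "D \<subseteq> D' \<Longrightarrow> polys_over D \<subseteq> polys_over D'"
  by (auto simp: polys_over_def)

lemma subring_adj:
  assumes "is_subring D"
  shows "is_subring (adj D x)"
  unfolding is_subring_def adj_def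
proof (intro conjI ballI)
  show "1 \<in> (\<lambda>f. poly f x) ` polys_over D"
    using polys_over_ring(6)[OF assms is_subringD(1)[OF assms]] by (force simp: image_iff)
next
  fix a b assume "a \<in> (\<lambda>f. poly f x) ` polys_over D" "b \<in> (\<lambda>f. poly f x) ` polys_over D"
  then obtain f g where fg: "f \<in> polys_over D" "g \<in> polys_over D" "a = poly f x" "b = poly g x" by auto
  show "a - b \<in> (\<lambda>f. poly f x) ` polys_over D"
    using polys_over_ring(2)[OF assms fg(1,2)] fg by (auto simp: image_iff intro!: bexI[of _ "f - g"])
  show "a * b \<in> (\<lambda>f. poly f x) ` polys_over D"
    using polys_over_ring(3)[OF assms fg(1,2)] fg by (auto simp: image_iff intro!: bexI[of _ "f * g"])
qed

lemma adj_base: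
  assumes "is_subring D"
  shows "D \<subseteq> adj D x" "x \<in> adj D x"
proof -
  show "D \<subseteq> adj D x"
  proof
    fix d assume "d \<in> D"
    then show "d \<in> adj D x" using polys_over_ring(6)[OF assms, of d] unfolding adj_def
      by (auto simp: image_iff intro!: bexI[of _ "[:d:]"])
  qed
  show "x \<in> adj D x" using polys_over_ring(5)[OF assms is_subringD(1)[OF assms], of 1] unfolding adj_def
    by (auto simp: image_iff poly_monom intro!: bexI[of _ "monom 1 1"])
qed

lemma adj_subset:
  assumes "is_subring X" "D \<subseteq> X" "x \<in> X"
  shows "adj D x \<subseteq> X"
  using poly_in_subring[OF assms(1) _ assms(3)] polys_over_mono[OF assms(2)] by (auto simp: adj_def)

text \<open>Links the two descriptions of generated rings: \<open>rgen\<close> serves arbitrary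
  generating sets, while \<open>adj\<close> exhibits elements as values of polynomials, on which
  degree arguments can operate.\<close>

lemma rgen_insert: "rgen (insert x A) = adj (rgen A) x"
proof
  show "rgen (insert x A) \<subseteq> adj (rgen A) x"
    using adj_base[OF subring_rgen[of A], of x] rgen_base[of A]
    by (intro rgen_least subring_adj subring_rgen) auto
  have "rgen A \<subseteq> rgen (insert x A)"
    using rgen_base[of "insert x A"] by (intro rgen_mono) auto
  then show "adj (rgen A) x \<subseteq> rgen (insert x A)"
    using rgen_base[of "insert x A"] by (intro adj_subset subring_rgen) auto
qed

lemma rgen_subring: "is_subring D \<Longrightarrow> rgen D = D"
  using rgen_least[of D D] rgen_base by blast

section \<open>Ideals of a subring and their extension to a larger subring\<close>

definition ideal_in :: "'a::comm_ring_1 set \<Rightarrow> 'a set \<Rightarrow> bool" where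
  "ideal_in D q \<longleftrightarrow> q \<subseteq> D \<and> 0 \<in> q \<and> (\<forall>x\<in>q. \<forall>y\<in>q. x + y \<in> q) \<and> (\<forall>r\<in>D. \<forall>x\<in>q. r * x \<in> q)"

lemma ideal_inD:
  assumes "ideal_in D q"
  shows "q \<subseteq> D" "0 \<in> q" "\<And>x y. x \<in> q \<Longrightarrow> y \<in> q \<Longrightarrow> x + y \<in> q"
    "\<And>r x. r \<in> D \<Longrightarrow> x \<in> q \<Longrightarrow> r * x \<in> q" "\<And>r x. r \<in> D \<Longrightarrow> x \<in> q \<Longrightarrow> x * r \<in> q"
  using assms by (auto simp: ideal_in_def mult.commute)

lemma ideal_in_neg:
  assumes "is_subring D" "ideal_in D q"
  shows "x \<in> q \<Longrightarrow> - x \<in> q" "x \<in> q \<Longrightarrow> y \<in> q \<Longrightarrow> x - y \<in> q"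
proof -
  show *: "x \<in> q \<Longrightarrow> - x \<in> q" for x
    using ideal_inD(4)[OF assms(2), of "-1" x] is_subringD[OF assms(1)] by simp
  show "x \<in> q \<Longrightarrow> y \<in> q \<Longrightarrow> x - y \<in> q"
    using ideal_inD(3)[OF assms(2) _ *] by simp
qed

lemma ideal_in_sum:
  assumes "ideal_in D q" "\<And>i. i \<in> I \<Longrightarrow> f i \<in> q"
  shows "sum f I \<in> q"
  using assms(2) by (induction I rule: infinite_finite_induct) (auto intro: ideal_inD[OF assms(1)])

lemma ideal_in_cong:
  assumes "is_subring D" "ideal_in D q" "x - y \<in> q"
  shows "x \<in> q \<longleftrightarrow> y \<in> q"
  using ideal_inD(3)[OF assms(2), of "x - y" y] ideal_in_neg(2)[OF assms(1,2), of x "x - y"] assms(3)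
  by auto

lemma ideal_in_power_diff:
  assumes "is_subring D" "ideal_in D q" "x \<in> D" "y \<in> D" "x - y \<in> q"
  shows "x ^ n - y ^ n \<in> q"
proof (induction n)
  case (Suc n)
  have "x ^ Suc n - y ^ Suc n = x * (x ^ n - y ^ n) + (x - y) * y ^ n"
    by (simp add: algebra_simps)
  then show ?case
    using ideal_inD(3)[OF assms(2) ideal_inD(4)[OF assms(2,3) Suc] ideal_inD(5)[OF assms(2) subring_power[OF assms(1,4)] assms(5)]]
    by simp
qed (use ideal_inD[OF assms(2)] in auto)

text \<open>The ideal of \<open>T\<close> generated by \<open>q\<close>. A linear combination is
  built one term at a time, so that stability under operators, clearing of denominators and
  reduction to finitely many variables can be proved by induction on the number of terms.\<close>

inductive_set iext :: "'a::comm_ring_1 set \<Rightarrow> 'a set \<Rightarrow> 'a set" for q T where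
  zero: "0 \<in> iext q T"
| step: "x \<in> q \<Longrightarrow> t \<in> T \<Longrightarrow> y \<in> iext q T \<Longrightarrow> x * t + y \<in> iext q T"

lemma iext_add: "x \<in> iext q T \<Longrightarrow> y \<in> iext q T \<Longrightarrow> x + y \<in> iext q T"
  by (induction rule: iext.induct) (auto simp: add.assoc intro: iext.intros)

lemma iext_base: "is_subring T \<Longrightarrow> x \<in> q \<Longrightarrow> x \<in> iext q T"
  using iext.step[of x q 1 T 0] by (simp add: is_subringD iext.zero)

lemma iext_mult:
  assumes "is_subring T" "t \<in> T"
  shows "y \<in> iext q T \<Longrightarrow> t * y \<in> iext q T"
proof (induction rule: iext.induct)
  case (step x s y)
  have "t * (x * s + y) = x * (t * s) + t * y" by (simp add: algebra_simps)
  then show ?case using step(1,4) is_subringD(4)[OF assms(1,2) step(2)] by (simp add: iext.step)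
qed (simp add: iext.zero)

lemma iext_least: "ideal_in T J \<Longrightarrow> q \<subseteq> J \<Longrightarrow> iext q T \<subseteq> J"
proof
  fix x assume *: "ideal_in T J" "q \<subseteq> J" "x \<in> iext q T"
  from *(3) show "x \<in> J"
    by induction (use *(1,2) in \<open>auto intro!: ideal_inD(2-5)[OF *(1)]\<close>)
qed

lemma iext_mono: "q \<subseteq> q' \<Longrightarrow> T \<subseteq> T' \<Longrightarrow> iext q T \<subseteq> iext q' T'"
proof
  fix x assume *: "q \<subseteq> q'" "T \<subseteq> T'" "x \<in> iext q T"
  from *(3) show "x \<in> iext q' T'"
    by induction (use *(1,2) in \<open>auto intro!: iext.intros\<close>)
qed

lemma ideal_iext:
  assumes "is_subring T" "q \<subseteq> T"
  shows "ideal_in T (iext q T)"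
proof -
  have "x \<in> T" if "x \<in> iext q T" for x
    using that by induction (use assms in \<open>auto intro!: is_subringD\<close>)
  then show ?thesis unfolding ideal_in_def
    using iext.zero iext_add iext_mult[OF assms(1)] by blast
qed

text \<open>Collecting a combination by powers of \<open>x\<close>, the coefficients from
  \<open>D\<close> are absorbed by the ideal \<open>q\<close>. All later statements about extended
  ideals start from this normal form.\<close>

lemma iext_adj:
  assumes D: "is_subring D" and q: "ideal_in D q" and "y \<in> iext q (adj D x)"
  shows "\<exists>f\<in>polys_over q. y = poly f x"
  using assms(3)
proof induction
  case zero
  then show ?case using ideal_inD(2)[OF q] by (intro bexI[of _ 0]) (auto simp: polys_over_def)
next
  case (step a t y)
  then obtain f g where "f \<in> polys_over D" "t = poly f x" "g \<in> polys_over q" "y = poly g x"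
    by (auto simp: adj_def)
  then show ?case using step(1) ideal_inD[OF q]
    by (intro bexI[of _ "smult a f + g"]) (auto simp: polys_over_def)
qed

section \<open>Ideals extended along a finitely generated algebra\<close>

locale prime_ideal_in =
  fixes S P :: "'a::comm_ring_1 set"
  assumes S: "is_subring S" and P: "ideal_in S P"
    and prime: "x \<in> S \<Longrightarrow> y \<in> S \<Longrightarrow> x * y \<in> P \<Longrightarrow> x \<in> P \<or> y \<in> P"
    and one_notin: "1 \<notin> P"
begin

lemma power_notin: "x \<in> S \<Longrightarrow> x \<notin> P \<Longrightarrow> x ^ n \<notin> P"
  by (induction n) (use one_notin prime subring_power[OF S] in auto)

lemma prime_prod:
  "finite A \<Longrightarrow> (\<And>i. i \<in> A \<Longrightarrow> f i \<in> S - P) \<Longrightarrow> prod f A \<in> S - P"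
proof (induction A rule: finite_induct)
  case (insert x F)
  then have "f x \<in> S - P" "prod f F \<in> S - P" by auto
  then show ?case using insert(1,2) prime[of "f x" "prod f F"] is_subringD(4)[OF S] by auto
qed (use one_notin is_subringD[OF S] in auto)

text \<open>The degree of \<open>f\<close> may drop modulo \<open>P\<close>. Cutting
  \<open>f\<close> off above its last coefficient outside \<open>P\<close> gives a representative
  \<open>g\<close> of the same residue class whose degree and leading coefficient are those of the
  reduction.\<close>

lemma truncate:
  assumes f: "f \<in> polys_over D" and D: "is_subring D" "D \<subseteq> S" and i: "coeff f i \<notin> P"
  obtains g where "g \<in> polys_over D" "degree g \<le> degree f" "lead_coeff g \<notin> P"
    "\<And>x. x \<in> S \<Longrightarrow> poly f x - poly g x \<in> P" "\<And>j. coeff f j - coeff g j \<in> P"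
    "\<And>j. degree g < j \<Longrightarrow> coeff f j \<in> P"
proof -
  define N where "N = {j. coeff f j \<notin> P}"
  have sub: "N \<subseteq> {..degree f}"
    using ideal_inD(2)[OF P] by (auto simp: N_def) (metis le_degree)
  then have fin: "finite N" using finite_subset by blast
  define m where "m = Max N"
  have m: "m \<in> N" using Max_in[OF fin] i by (auto simp: N_def m_def)
  have gt: "coeff f j \<in> P" if "m < j" for j
    using Max_ge[OF fin, of j] that by (auto simp: N_def m_def)
  define g where "g = poly_cutoff (Suc m) f"
  have cg: "coeff g j = (if j \<le> m then coeff f j else 0)" for j
    by (simp add: g_def coeff_poly_cutoff less_Suc_eq_le)
  have "coeff g m \<noteq> 0" using m ideal_inD(2)[OF P] by (auto simp: cg N_def)
  then have dg: "degree g = m"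
    by (intro antisym degree_le le_degree) (auto simp: cg)
  have c: "coeff f j - coeff g j \<in> P" for j
    using gt[of j] ideal_inD(2)[OF P] by (auto simp: cg)
  show ?thesis
  proof
    show "g \<in> polys_over D" using f is_subringD(2)[OF D(1)] by (auto simp: polys_over_def cg)
    show "degree g \<le> degree f" using m sub by (auto simp: dg)
    show "lead_coeff g \<notin> P" using m by (simp add: dg cg N_def)
    fix x assume "x \<in> S"
    have "poly f x - poly g x = poly (f - g) x" by simp
    also have "\<dots> \<in> P" unfolding poly_altdef
      using \<open>x \<in> S\<close> c by (intro ideal_in_sum[OF P] ideal_inD(5)[OF P] subring_power[OF S]) auto
    finally show "poly f x - poly g x \<in> P" .
  next
    fix j show "coeff f j - coeff g j \<in> P" by fact
  next
    fix j assume "degree g < j" then show "coeff f j \<in> P" using gt dg by auto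
  qed
qed

lemma poly_in_P:
  assumes "\<And>j. coeff f j \<in> P" "x \<in> S"
  shows "poly f x \<in> P"
  unfolding poly_altdef using assms by (intro ideal_in_sum[OF P] ideal_inD(5)[OF P] subring_power[OF S])

text \<open>In terms of spectra: every basic open set of \<open>T\<close> that meets the fibre over \<open>P\<close> has an image
  containing a basic open neighbourhood of \<open>P\<close>. In this form generic freeness composes along towers.\<close>

definition good_ext :: "'a set \<Rightarrow> 'a set \<Rightarrow> bool" where
  "good_ext D T \<longleftrightarrow> (\<forall>u\<in>T - P. \<exists>v\<in>D - P. \<forall>q. ideal_in D q \<and> P \<subseteq> q \<and> (\<forall>n. v ^ n \<notin> q) \<longrightarrow>
     (\<forall>n. u ^ n \<notin> iext q T))"

text \<open>The element \<open>v\<close> that the upper extension provides in \<open>T\<close>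
  becomes the \<open>u\<close> of the lower one. This is why the definition speaks of powers of an
  arbitrary \<open>u\<close> outside \<open>P\<close> instead of only asking that \<open>1\<close>
  stay outside the extended ideal.\<close>

lemma good_ext_trans:
  assumes "good_ext D T" "good_ext T U" "is_subring D" "is_subring T" "is_subring U" "D \<subseteq> T"
  shows "good_ext D U"
  unfolding good_ext_def
proof
  fix u assume "u \<in> U - P"
  with assms(2) obtain v where v: "v \<in> T - P"
    "\<And>q n. ideal_in T q \<Longrightarrow> P \<subseteq> q \<Longrightarrow> (\<And>n. v ^ n \<notin> q) \<Longrightarrow> u ^ n \<notin> iext q U"
    unfolding good_ext_def by meson
  with assms(1) obtain w where w: "w \<in> D - P"
    "\<And>q n. ideal_in D q \<Longrightarrow> P \<subseteq> q \<Longrightarrow> (\<And>n. w ^ n \<notin> q) \<Longrightarrow> v ^ n \<notin> iext q T"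
    unfolding good_ext_def by meson
  have "u ^ n \<notin> iext q U" if q: "ideal_in D q" "P \<subseteq> q" "\<And>n. w ^ n \<notin> q" for q n
  proof -
    have "q \<subseteq> T" using ideal_inD(1)[OF q(1)] assms(6) by auto
    have qq: "q \<subseteq> iext q T" using iext_base[OF assms(4)] by auto
    have "u ^ n \<notin> iext (iext q T) U"
      using v(2)[OF ideal_iext[OF assms(4) \<open>q \<subseteq> T\<close>]] qq q(2) w(2)[OF q] by auto
    then show ?thesis using iext_mono[OF qq order.refl[of U]] by auto
  qed
  then show "\<exists>v\<in>D - P. \<forall>q. ideal_in D q \<and> P \<subseteq> q \<and> (\<forall>n. v ^ n \<notin> q) \<longrightarrow> (\<forall>n. u ^ n \<notin> iext q U)"
    using w(1) by blast
qed

end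

section \<open>Top coefficients and pseudo-division over rings with zero divisors\<close>

lemma coeff_mult_top:
  fixes f g :: "'a::comm_ring_1 poly"
  assumes "degree f \<le> m" "degree g \<le> n"
  shows "coeff (f * g) (m + n) = coeff f m * coeff g n"
proof -
  have "coeff (f * g) (m + n) = (\<Sum>i\<le>m + n. coeff f i * coeff g (m + n - i))"
    by (rule coeff_mult)
  also have "\<dots> = (\<Sum>i\<in>{m}. coeff f i * coeff g (m + n - i))"
  proof (rule sum.mono_neutral_right)
    show "\<forall>i\<in>{..m + n} - {m}. coeff f i * coeff g (m + n - i) = 0"
    proof
      fix i assume "i \<in> {..m + n} - {m}"
      then consider "i > m" | "m + n - i > n" by force
      then show "coeff f i * coeff g (m + n - i) = 0"
        using assms by cases (auto simp: coeff_eq_0)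
    qed
  qed auto
  finally show ?thesis by simp
qed

text \<open>The leading coefficient may be nilpotent, so \<open>f ^ n\<close> can have a smaller
  degree than expected; the coefficient in the expected top position is nevertheless the power of
  \<open>lead_coeff f\<close>.\<close>

lemma coeff_power_top:
  fixes f :: "'a::comm_ring_1 poly"
  shows "coeff (f ^ n) (n * degree f) = lead_coeff f ^ n \<and> degree (f ^ n) \<le> n * degree f"
proof (induction n)
  case (Suc n)
  have "degree (f ^ Suc n) \<le> degree f + degree (f ^ n)" using degree_mult_le by simp
  with Suc coeff_mult_top[of f "degree f" "f ^ n" "n * degree f"] show ?case by auto
qed simp

text \<open>Every term subtracted during the division is a multiple of a leading coefficient of the
  dividend, so quotient and remainder inherit coefficients in \<open>q\<close>, although those of
  \<open>f\<close> lie only in \<open>D\<close>. With \<open>q = D\<close> this is ordinary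
  pseudo-division; with a proper \<open>q\<close> it carries membership in an extended ideal over to
  remainders.\<close>

lemma pseudo_div:
  assumes D: "is_subring D" and q: "ideal_in D q" and f: "f \<in> polys_over D" "degree f = d" "d \<ge> 1"
    and h: "h \<in> polys_over q"
  shows "\<exists>N. \<exists>Q\<in>polys_over q. \<exists>r\<in>polys_over q. smult (lead_coeff f ^ N) h = f * Q + r \<and> degree r < d"
  using h
proof (induction "degree h" arbitrary: h rule: less_induct)
  case less
  note q0 = ideal_inD(2)[OF q]
  show ?case
  proof (cases "degree h < d")
    case True
    then show ?thesis using less(2) q0
      by (intro exI[of _ 0] bexI[of _ 0] bexI[of _ h]) (auto simp: polys_over_def)
  next
    case False
    define a where "a = lead_coeff f"
    define t where "t = monom (lead_coeff h) (degree h - d)"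
    define g where "g = smult a h - f * t"
    have a: "a \<in> D" using f(1) by (auto simp: a_def polys_over_def)
    have t: "t \<in> polys_over q" using less(2) q0 by (auto simp: t_def polys_over_def)
    have ft: "f * t \<in> polys_over q"
      using f(1) t by (auto simp: polys_over_def coeff_mult intro!: ideal_in_sum[OF q] ideal_inD(4)[OF q])
    have g: "g \<in> polys_over q"
      using less(2) a ft by (auto simp: g_def polys_over_def intro!: ideal_in_neg(2)[OF D q] ideal_inD(4)[OF q])
    have "degree t \<le> degree h - d" by (simp add: t_def degree_monom_le)
    then have dft: "degree (f * t) \<le> degree h"
      using degree_mult_le[of f t] f(2) False by linarith
    have "coeff (f * t) (degree h) = a * lead_coeff h"
      using coeff_mult_top[of f d t "degree h - d"] False f(2) \<open>degree t \<le> _\<close> by (simp add: t_def a_def)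
    then have "coeff g (degree h) = 0" by (simp add: g_def)
    moreover have "degree g \<le> degree h"
      unfolding g_def by (intro degree_diff_le dft) (simp add: degree_smult_le)
    moreover have "degree h > 0" using False f(3) by simp
    ultimately have "degree g < degree h"
      by (metis coeff_0_degree_minus_1 diff_less le_neq_implies_less zero_less_one leading_coeff_0_iff degree_0)
    from less(1)[OF this g] obtain N Q r where Q: "Q \<in> polys_over q" "r \<in> polys_over q"
      "smult (a ^ N) g = f * Q + r" "degree r < d" unfolding a_def by blast
    have "smult (a ^ Suc N) h = f * (Q + smult (a ^ N) t) + r"
      using Q(3) by (simp add: g_def smult_diff_right algebra_simps)
    moreover have "Q + smult (a ^ N) t \<in> polys_over q"
      using Q(1) t subring_power[OF D a] by (auto simp: polys_over_def intro!: ideal_inD(3,4)[OF q])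
    ultimately show ?thesis using Q unfolding a_def by blast
  qed
qed

section \<open>Generic freeness for one generator, finitely many generators and independent
  families\<close>

context prime_ideal_in
begin

text \<open>If \<open>x\<close> is transcendental over \<open>D\<close> modulo \<open>P\<close>, the
  leading coefficient of \<open>u\<close> as a polynomial in \<open>x\<close> serves as
  \<open>v\<close>. If \<open>x\<close> is algebraic, let \<open>a\<close> be the leading
  coefficient of a relation of least degree \<open>d\<close>: modulo \<open>P\<close> and with
  \<open>a\<close> inverted, the powers of \<open>x\<close> below \<open>d\<close> form a basis.
  Some multiple of \<open>u\<close> is congruent to an element \<open>b\<close> of
  \<open>D - P\<close>, and \<open>v = a * b\<close>.\<close>

lemma good_ext_adj:
  assumes D: "is_subring D" "D \<subseteq> S" "P \<subseteq> D" and x: "x \<in> S"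
  shows "good_ext D (adj D x)"
proof -
  let ?T = "adj D x"
  have T: "is_subring ?T" "?T \<subseteq> S" by (rule subring_adj[OF D(1)]) (rule adj_subset[OF S D(2) x])
  have inS: "poly f x \<in> S" if "f \<in> polys_over D" for f
    using that T(2) by (auto simp: adj_def)
  note neg = ideal_in_neg[OF S P] and cong = ideal_in_cong[OF S P]
  show ?thesis
  proof (cases "\<exists>f\<in>polys_over D. lead_coeff f \<notin> P \<and> poly f x \<in> P")
    case False
    have tr: "coeff f j \<in> P" if f: "f \<in> polys_over D" "poly f x \<in> P" for f j
    proof (rule ccontr)
      assume "coeff f j \<notin> P"
      from truncate[OF f(1) D(1,2) this] obtain g where g: "g \<in> polys_over D" "lead_coeff g \<notin> P"
        "poly f x - poly g x \<in> P" using x by metis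
      with f(2) cong[OF g(3)] False show False by blast
    qed
    show ?thesis unfolding good_ext_def
    proof
      fix u assume u: "u \<in> ?T - P"
      then obtain f where f: "f \<in> polys_over D" "u = poly f x" by (auto simp: adj_def)
      have "\<exists>i. coeff f i \<notin> P" using u f poly_in_P[OF _ x] by blast
      then obtain g where g: "g \<in> polys_over D" "lead_coeff g \<notin> P" "poly f x - poly g x \<in> P"
        using truncate[OF f(1) D(1,2)] x by metis
      have "u ^ n \<notin> iext q ?T" if q: "ideal_in D q" "P \<subseteq> q" "\<And>n. lead_coeff g ^ n \<notin> q" for q n
      proof
        assume un: "u ^ n \<in> iext q ?T"
        from iext_adj[OF D(1) q(1) this] obtain h where h: "h \<in> polys_over q" "u ^ n = poly h x" by auto
        \<comment> \<open>\<open>h\<close> and \<open>g ^ n\<close> have congruent values at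
          \<open>x\<close>, so by \<open>tr\<close> they agree modulo \<open>P\<close> coefficient
          by coefficient. Position \<open>n * degree g\<close> then exhibits
          \<open>lead_coeff g ^ n\<close> as an element of \<open>q\<close>.\<close>
        have "u ^ n - poly g x ^ n \<in> P"
          using ideal_in_power_diff[OF S P _ _ g(3)] f g(1) inS by auto
        moreover have "h \<in> polys_over D" using h(1) polys_over_mono[OF ideal_inD(1)[OF q(1)]] by auto
        moreover have "poly (h - g ^ n) x = u ^ n - poly g x ^ n" using h(2) by simp
        ultimately have "coeff (h - g ^ n) (n * degree g) \<in> P"
          by (intro tr polys_over_ring(2,4)[OF D(1)] g(1)) auto
        moreover have "coeff h (n * degree g) \<in> q" using h(1) by (simp add: polys_over_def)
        ultimately have "lead_coeff g ^ n \<in> q"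
          using q(2) coeff_power_top[of g n] ideal_in_cong[OF D(1) q(1), of "coeff h (n * degree g)"]
          by auto
        with q(3) show False by blast
      qed
      moreover have "lead_coeff g \<in> D - P" using g by (auto simp: polys_over_def)
      ultimately show "\<exists>v\<in>D - P. \<forall>q. ideal_in D q \<and> P \<subseteq> q \<and> (\<forall>n. v ^ n \<notin> q) \<longrightarrow> (\<forall>n. u ^ n \<notin> iext q ?T)"
        by blast
    qed
  next
    case True
    define d where "d = (LEAST d. \<exists>f\<in>polys_over D. lead_coeff f \<notin> P \<and> poly f x \<in> P \<and> degree f = d)"
    have "\<exists>d. \<exists>f\<in>polys_over D. lead_coeff f \<notin> P \<and> poly f x \<in> P \<and> degree f = d" using True by blast
    from LeastI_ex[OF this] obtain f where f: "f \<in> polys_over D" "lead_coeff f \<notin> P" "poly f x \<in> P" "degree f = d"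
      unfolding d_def by blast
    have least: "d \<le> degree g" if "g \<in> polys_over D" "lead_coeff g \<notin> P" "poly g x \<in> P" for g
      unfolding d_def by (rule Least_le) (use that in blast)
    have small: "coeff g j \<in> P" if g: "g \<in> polys_over D" "poly g x \<in> P" "degree g < d" for g j
    proof (rule ccontr)
      assume "coeff g j \<notin> P"
      from truncate[OF g(1) D(1,2) this] obtain h where h: "h \<in> polys_over D" "degree h \<le> degree g"
        "lead_coeff h \<notin> P" "poly g x - poly h x \<in> P" using x by metis
      with least[of h] cong[OF h(4)] g show False by auto
    qed
    have d1: "d \<ge> 1"
    proof (rule ccontr)
      assume "\<not> d \<ge> 1"
      then have "degree f = 0" using f(4) by simp
      then obtain c where "f = [:c:]" by (rule degree_eq_zeroE)
      then show False using f by simp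
    qed
    define a where "a = lead_coeff f"
    have a: "a \<in> D" "a \<notin> P" using f by (auto simp: a_def polys_over_def)
    have DD: "ideal_in D D" using is_subringD[OF D(1)] by (auto simp: ideal_in_def)
    show ?thesis unfolding good_ext_def
    proof
      fix u assume u: "u \<in> ?T - P"
      have uS: "u \<in> S" using u T by auto
      \<comment> \<open>Polynomials whose value at \<open>x\<close> is congruent to a multiple of
        \<open>u\<close> and not in \<open>P\<close>. A member of least degree will turn out to be
        constant, as in the proof that a nonzero algebraic element over a field has a nonzero
        multiple in the field.\<close>
      define A where "A = {g \<in> polys_over D. lead_coeff g \<notin> P \<and> poly g x \<notin> P \<and> (\<exists>w\<in>?T. u * w - poly g x \<in> P)}"
      have inA: "\<exists>h\<in>A. degree h \<le> degree g"
        if g: "g \<in> polys_over D" "poly g x \<notin> P" "w \<in> ?T" "u * w - poly g x \<in> P" for g w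
      proof -
        have "\<exists>i. coeff g i \<notin> P" using g(2) poly_in_P[OF _ x] by blast
        then obtain h where h: "h \<in> polys_over D" "degree h \<le> degree g" "lead_coeff h \<notin> P" "poly g x - poly h x \<in> P"
          using truncate[OF g(1) D(1,2)] x by metis
        have "u * w - poly h x \<in> P" using ideal_inD(3)[OF P g(4) h(4)] by simp
        then have "h \<in> A" using h g cong[OF h(4)] by (auto simp: A_def)
        with h(2) show ?thesis by blast
      qed
      obtain f0 where f0: "f0 \<in> polys_over D" "u = poly f0 x" using u by (auto simp: adj_def)
      \<comment> \<open>Reducing \<open>u\<close> by \<open>f\<close> puts a member of degree below
        \<open>d\<close> into \<open>A\<close>, so that \<open>small\<close> applies to whatever has
        lower degree than the minimal member.\<close>
      obtain N Q r where r: "r \<in> polys_over D" "smult (a ^ N) f0 = f * Q + r" "degree r < d" "Q \<in> polys_over D"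
        using pseudo_div[OF D(1) DD f(1,4) d1 f0(1)] unfolding a_def by blast
      have "poly (smult (a ^ N) f0) x = poly f x * poly Q x + poly r x" unfolding r(2) by simp
      then have "u * a ^ N - poly r x = poly f x * poly Q x" using f0(2) by (simp add: algebra_simps)
      then have eqP: "u * a ^ N - poly r x \<in> P" using ideal_inD(5)[OF P inS f(3)] r(4) by auto
      have aN: "a ^ N \<in> ?T" "a ^ N \<in> S" "a ^ N \<notin> P"
        using subring_power[OF D(1) a(1)] adj_base(1)[OF D(1)] power_notin[of a] a D(2) by auto
      then have "u * a ^ N \<notin> P" using prime[of u "a ^ N"] u uS by auto
      then have "poly r x \<notin> P" using cong[OF eqP] by simp
      with inA[OF r(1) this aN(1) eqP] r(3) obtain g0 where g0: "g0 \<in> A" "degree g0 < d" by auto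
      define g where "g = arg_min degree (\<lambda>g. g \<in> A)"
      have gA: "g \<in> A" and gmin: "\<And>h. h \<in> A \<Longrightarrow> degree g \<le> degree h"
        using arg_min_nat_lemma[of "\<lambda>g. g \<in> A" g0 degree] g0 by (auto simp: g_def)
      from gA obtain w where g: "g \<in> polys_over D" "lead_coeff g \<notin> P" "poly g x \<notin> P" "w \<in> ?T" "u * w - poly g x \<in> P"
        by (auto simp: A_def)
      have gd: "degree g < d" using gmin[OF g0(1)] g0(2) by simp
      have "degree g = 0"
      proof (rule ccontr)
        assume dg: "degree g \<noteq> 0"
        \<comment> \<open>Divide \<open>f\<close> by \<open>g\<close>. Since \<open>poly r x\<close>
          is congruent to a multiple of \<open>u\<close>, minimality of \<open>g\<close> forces it
          into \<open>P\<close>, and by \<open>small\<close> all coefficients of \<open>r\<close>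
          lie in \<open>P\<close>. Hence \<open>g * Q\<close> agrees modulo \<open>P\<close> with a
          multiple of \<open>f\<close>, and \<open>poly Q x\<close> is in \<open>P\<close> because
          \<open>poly g x\<close> is not. A relation has degree at least \<open>d\<close>, so the
          product would have degree above \<open>d\<close>.\<close>
        define b where "b = lead_coeff g"
        obtain N Q r where r: "r \<in> polys_over D" "smult (b ^ N) f = g * Q + r" "degree r < degree g" "Q \<in> polys_over D"
          using pseudo_div[OF D(1) DD g(1) refl _ f(1)] dg unfolding b_def by fastforce
        have b: "b \<in> D" "b \<notin> P" using g by (auto simp: b_def polys_over_def)
        have bN: "b ^ N \<in> S" "b ^ N \<notin> P" using b power_notin subring_power[OF S] D by auto
        have ev: "b ^ N * poly f x = poly g x * poly Q x + poly r x"
          using arg_cong[OF r(2), of "\<lambda>p. poly p x"] by simp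
        have bf: "b ^ N * poly f x \<in> P" using ideal_inD(4)[OF P bN(1) f(3)] .
        have wQ: "w * poly Q x \<in> ?T" using is_subringD(4)[OF T(1) g(4)] r(4) by (auto simp: adj_def)
        have "(u * w - poly g x) * poly Q x \<in> P" using ideal_inD(5)[OF P inS[OF r(4)] g(5)] .
        then have "- ((u * w - poly g x) * poly Q x + b ^ N * poly f x) \<in> P"
          by (intro neg(1) ideal_inD(3)[OF P] bf)
        moreover have "- ((u * w - poly g x) * poly Q x + b ^ N * poly f x) = u * - (w * poly Q x) - poly r x"
          unfolding ev by (simp add: algebra_simps)
        ultimately have minus: "u * - (w * poly Q x) - poly r x \<in> P" by simp
        have "\<exists>h\<in>A. degree h \<le> degree r" if "poly r x \<notin> P"
          using inA[OF r(1) that _ minus] wQ is_subringD(5)[OF T(1)] by blast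
        then have "poly r x \<in> P"
          using gmin r(3) by (meson leD order.trans)
        then have rP: "coeff r j \<in> P" for j using small[OF r(1)] r(3) gd by auto
        have "poly g x * poly Q x \<in> P"
          using neg(2)[OF bf \<open>poly r x \<in> P\<close>] ev by simp
        then have QP: "poly Q x \<in> P" using prime inS g(1,3) r(4) by blast
        have bfa: "coeff (smult (b ^ N) f) d \<notin> P"
          using prime[of "b ^ N" a] bN a D(2) by (auto simp: a_def f(4))
        have gQ: "coeff (smult (b ^ N) f) j - coeff (g * Q) j \<in> P" for j using rP r(2) by simp
        have "\<exists>i. coeff Q i \<notin> P"
        proof (rule ccontr)
          assume "\<nexists>i. coeff Q i \<notin> P"
          then have "coeff (g * Q) d \<in> P" unfolding coeff_mult
            using g(1) D(2) by (intro ideal_in_sum[OF P] ideal_inD(4)[OF P]) (auto simp: polys_over_def)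
          with bfa cong[OF gQ] show False by blast
        qed
        then obtain Q' where Q': "Q' \<in> polys_over D" "degree Q' \<le> degree Q" "lead_coeff Q' \<notin> P"
          "poly Q x - poly Q' x \<in> P" "\<And>j. coeff Q j - coeff Q' j \<in> P" "\<And>j. degree Q' < j \<Longrightarrow> coeff Q j \<in> P"
          using truncate[OF r(4) D(1,2)] x by metis
        have "poly Q' x \<in> P" using cong[OF Q'(4)] QP by simp
        then have "d \<le> degree Q'" using least[OF Q'(1,3)] by simp
        let ?k = "degree g + degree Q'"
        have "coeff (g * Q) ?k - coeff (g * Q') ?k = coeff (g * (Q - Q')) ?k" by (simp add: algebra_simps)
        also have "\<dots> \<in> P" unfolding coeff_mult
          using g(1) D(2) Q'(5) by (intro ideal_in_sum[OF P] ideal_inD(4)[OF P]) (auto simp: polys_over_def)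
        finally have "coeff (g * Q) ?k - coeff (g * Q') ?k \<in> P" .
        moreover have "coeff (g * Q') ?k \<notin> P"
          unfolding coeff_mult_degree_sum using prime[of "lead_coeff g" "lead_coeff Q'"] g(1,2) Q'(1,3) D(2)
          by (auto simp: polys_over_def)
        ultimately have "coeff (smult (b ^ N) f) ?k \<notin> P" using cong gQ by blast
        then have "coeff f ?k \<noteq> 0" using ideal_inD(2)[OF P] by auto
        then have "?k \<le> d" using f(4) le_degree by blast
        with \<open>d \<le> degree Q'\<close> dg show False by simp
      qed
      then obtain b where gb: "g = [:b:]" by (rule degree_eq_zeroE)
      have b: "b \<in> D" "b \<notin> P" "u * w - b \<in> P"
        using g(1,2,5) by (auto simp: gb polys_over_def dest: spec[of _ 0])
      have ab: "a * b \<in> D - P" using prime[of a b] a b D is_subringD(4)[OF D(1)] by auto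
      have "u ^ n \<notin> iext q ?T" if q: "ideal_in D q" "P \<subseteq> q" "\<And>n. (a * b) ^ n \<notin> q" for q n
      proof
        assume un: "u ^ n \<in> iext q ?T"
        have iq: "ideal_in ?T (iext q ?T)" using ideal_iext[OF T(1)] ideal_inD(1)[OF q(1)] adj_base(1)[OF D(1)] by blast
        have w: "w \<in> S" using g(4) T(2) by auto
        have "(u * w) ^ n \<in> iext q ?T"
          unfolding power_mult_distrib using ideal_inD(5)[OF iq subring_power[OF T(1) g(4)] un] .
        moreover have "(u * w) ^ n - b ^ n \<in> P"
          using ideal_in_power_diff[OF S P _ _ b(3)] is_subringD(4)[OF S uS w] b(1) D(2) by auto
        ultimately have "b ^ n \<in> iext q ?T"
          using ideal_in_cong[OF T(1) iq] iext_base[OF T(1)] q(2) by blast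
        from iext_adj[OF D(1) q(1) this] obtain h where h: "h \<in> polys_over q" "b ^ n = poly h x" by auto
        obtain N Q r where r: "r \<in> polys_over q" "smult (a ^ N) h = f * Q + r" "degree r < d" "Q \<in> polys_over q"
          using pseudo_div[OF D(1) q(1) f(1,4) d1 h(1)] unfolding a_def by blast
        have mono: "polys_over q \<subseteq> polys_over D" using polys_over_mono[OF ideal_inD(1)[OF q(1)]] .
        have "a ^ N * b ^ n = poly f x * poly Q x + poly r x"
          using arg_cong[OF r(2), of "\<lambda>p. poly p x"] h(2) by simp
        then have "poly (r - [:a ^ N * b ^ n:]) x = - (poly f x * poly Q x)" by (simp add: algebra_simps)
        moreover have "- (poly f x * poly Q x) \<in> P"
          using neg(1)[OF ideal_inD(5)[OF P inS f(3)]] r(4) mono by auto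
        moreover have "a ^ N * b ^ n \<in> D" using a b by (intro is_subringD(4) subring_power D(1))
        ultimately have "coeff (r - [:a ^ N * b ^ n:]) 0 \<in> P"
          using r(1,3) mono d1 by (intro small polys_over_ring(2,6)[OF D(1)]) (auto intro: degree_diff_less)
        then have "coeff r 0 - a ^ N * b ^ n \<in> q" using q(2) by auto
        moreover have "coeff r 0 \<in> q" using r(1) by (auto simp: polys_over_def)
        ultimately have "a ^ N * b ^ n \<in> q" using ideal_in_cong[OF D(1) q(1)] by blast
        \<comment> \<open>The exponents of \<open>a\<close> and \<open>b\<close> are balanced, since
          the hypothesis on \<open>q\<close> concerns powers of the single element
          \<open>a * b\<close>.\<close>
        then have "a ^ n * b ^ N * (a ^ N * b ^ n) \<in> q"
          using ideal_inD(4)[OF q(1) is_subringD(4)[OF D(1) subring_power[OF D(1) a(1)] subring_power[OF D(1) b(1)]]]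
          by blast
        moreover have "a ^ n * b ^ N * (a ^ N * b ^ n) = (a * b) ^ (n + N)"
          by (simp add: power_mult_distrib power_add algebra_simps)
        ultimately show False using q(3) by simp
      qed
      then show "\<exists>v\<in>D - P. \<forall>q. ideal_in D q \<and> P \<subseteq> q \<and> (\<forall>n. v ^ n \<notin> q) \<longrightarrow> (\<forall>n. u ^ n \<notin> iext q ?T)"
        using ab by blast
    qed
  qed
qed

lemma good_ext_refl: "is_subring D \<Longrightarrow> good_ext D D"
  unfolding good_ext_def using iext_least[of D] by blast

lemma good_ext_finite:
  assumes "finite F" "F \<subseteq> S" "is_subring D" "D \<subseteq> S" "P \<subseteq> D"
  shows "good_ext D (rgen (D \<union> F))"
  using assms(1,2)
proof (induction F rule: finite_induct)
  case empty
  then show ?case using good_ext_refl[OF assms(3)] rgen_subring[OF assms(3)] by simp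
next
  case (insert x F)
  let ?T = "rgen (D \<union> F)"
  have T: "is_subring ?T" "?T \<subseteq> S" "D \<subseteq> ?T"
    using insert(4) assms(4) rgen_base[of "D \<union> F"] rgen_least[OF S, of "D \<union> F"] subring_rgen by auto
  have "good_ext ?T (adj ?T x)" using insert(4) order.trans[OF assms(5) T(3)] by (intro good_ext_adj T) auto
  moreover have "adj ?T x = rgen (D \<union> insert x F)" by (simp add: rgen_insert)
  ultimately show ?case
    using good_ext_trans[OF insert(3) _ assms(3) T(1) subring_rgen T(3)] insert(4) by auto
qed

text \<open>\<open>V\<close> may be infinite, so \<open>u\<close> and each membership in an extended
  ideal are first confined to finitely many variables. Every nonempty finite subset of
  \<open>V\<close> lies in a closed initial segment \<open>insert z (L z)\<close>, and since each
  \<open>y z\<close> is free over the lower ones, an element of a segment that lies in the extension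
  of \<open>q\<close> to a larger segment already lies in the extension to its own.\<close>

lemma good_ext_transcendental:
  fixes y :: "'v \<Rightarrow> 'a" and less :: "'v \<Rightarrow> 'v \<Rightarrow> bool"
  assumes D: "is_subring D" "D \<subseteq> S" "P \<subseteq> D" and y: "y ` V \<subseteq> S"
    and wf: "wfP less" and trans: "\<And>u v w. less u v \<Longrightarrow> less v w \<Longrightarrow> less u w"
    and total: "\<And>u v. u \<in> V \<Longrightarrow> v \<in> V \<Longrightarrow> u \<noteq> v \<Longrightarrow> less u v \<or> less v u"
    and tr: "\<And>z f j. z \<in> V \<Longrightarrow> f \<in> polys_over (rgen (D \<union> y ` {w \<in> V. less w z})) \<Longrightarrow> poly f (y z) \<in> P \<Longrightarrow> coeff f j \<in> P"
  shows "good_ext D (rgen (D \<union> y ` V))"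
proof -
  define E where "E W = rgen (D \<union> y ` W)" for W
  define L where "L z = {w \<in> V. less w z}" for z
  have E: "is_subring (E W)" "D \<subseteq> E W" for W
    using rgen_base[of "D \<union> y ` W"] by (auto simp: E_def subring_rgen)
  have ES: "E W \<subseteq> S" if "W \<subseteq> V" for W
    unfolding E_def using that D(2) y by (intro rgen_least[OF S]) blast
  have Emono: "E W \<subseteq> E W'" if "W \<subseteq> W'" for W W'
    unfolding E_def using that rgen_base[of "D \<union> y ` W'"] by (intro rgen_mono) auto
  have Eins: "E (insert z W) = adj (E W) (y z)" for z W
    unfolding E_def by (simp add: rgen_insert)
  have mx: "\<exists>z\<in>W. W \<subseteq> insert z (L z)" if "finite W" "W \<noteq> {}" "W \<subseteq> V" for W
    using that
  proof (induction W rule: finite_ne_induct)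
    case (insert x W)
    then obtain z where z: "z \<in> W" "W \<subseteq> insert z (L z)" by auto
    have "x \<in> V" "z \<in> V" "x \<noteq> z" using insert z by auto
    then consider "less x z" | "less z x" using total by blast
    then show ?case
    proof cases
      case 1
      then show ?thesis using z insert by (intro bexI[of _ z]) (auto simp: L_def)
    next
      case 2
      then show ?thesis using z insert trans \<open>z \<in> V\<close> by (intro bexI[of _ x]) (auto simp: L_def)
    qed
  qed auto
  have gz: "good_ext (E (L z)) (E (insert z (L z)))" if "z \<in> V" for z
    unfolding Eins using that y order.trans[OF D(3) E(2)] ES[of "L z"] by (intro good_ext_adj E) (auto simp: L_def)
  \<comment> \<open>Modulo \<open>P\<close> the adjunction of \<open>y z\<close> is free: the
    constant coefficient of a polynomial over the extended ideal that represents \<open>e\<close> is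
    congruent to \<open>e\<close>.\<close>
  have contr: "e \<in> iext q (E (L z))"
    if z: "z \<in> V" and q: "ideal_in D q" "P \<subseteq> q" and e: "e \<in> E (L z)" "e \<in> iext q (E (insert z (L z)))" for z q e
  proof -
    let ?q = "iext q (E (L z))"
    have q': "ideal_in (E (L z)) ?q"
      using ideal_inD(1)[OF q(1)] E(2) by (intro ideal_iext[OF E(1)]) blast
    have qq: "q \<subseteq> ?q" using iext_base[OF E(1)] by blast
    have "e \<in> iext ?q (adj (E (L z)) (y z))"
      using e(2) iext_mono[OF qq order.refl] unfolding Eins by blast
    from iext_adj[OF E(1) q' this] obtain f where f: "f \<in> polys_over ?q" "e = poly f (y z)" by auto
    have "f - [:e:] \<in> polys_over (E (L z))"
      using f(1) polys_over_mono[OF ideal_inD(1)[OF q']] e(1) by (intro polys_over_ring(2,6)[OF E(1)]) auto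
    then have "coeff (f - [:e:]) 0 \<in> P"
      using z f ideal_inD(2)[OF P] by (intro tr) (auto simp: E_def L_def)
    then have "coeff f 0 - e \<in> ?q" using q(2) qq by auto
    then show ?thesis using ideal_in_cong[OF E(1) q'] f(1) by (auto simp: polys_over_def)
  qed
  have fin: "\<exists>W. finite W \<and> W \<subseteq> W' \<and> e \<in> iext q (E W)" if "e \<in> iext q (E W')" for e q W'
    using that
  proof induction
    case zero
    then show ?case by (intro exI[of _ "{}"]) (auto intro: iext.zero)
  next
    case (step x t e)
    then obtain W where W: "finite W" "W \<subseteq> W'" "e \<in> iext q (E W)" by blast
    obtain W2 where W2: "finite W2" "W2 \<subseteq> W'" "t \<in> E W2" using step(2) unfolding E_def by (rule rgen_finite)
    have "e \<in> iext q (E (W \<union> W2))" "t \<in> E (W \<union> W2)"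
      using W(3) W2(3) iext_mono[OF order.refl Emono, of W "W \<union> W2"] Emono[of W2 "W \<union> W2"] by auto
    then show ?case using W W2 step(1) by (intro exI[of _ "W \<union> W2"]) (auto intro: iext.step)
  qed
  \<comment> \<open>After contraction to \<open>E (L z)\<close> only finitely many variables matter,
    and the largest of them, \<open>z'\<close>, lies strictly below \<open>z\<close>. The descent
    stops at a segment contained in \<open>W0\<close> or at the empty set.\<close>
  have down: "e \<in> iext q (E W0)"
    if q: "ideal_in D q" "P \<subseteq> q" and W0: "W0 = {} \<or> (\<exists>w\<in>V. W0 = insert w (L w))"
      and e: "e \<in> E W0" "e \<in> iext q (E (insert z (L z)))" "z \<in> V" for e q z W0
    using e(2,3)
  proof (induction z rule: wfp_induct_rule[OF wf])
    case (1 z)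
    show ?case
    proof (cases "z \<in> W0")
      case True
      then have "insert z (L z) \<subseteq> W0" using W0 trans by (auto simp: L_def)
      then show ?thesis using 1(2) iext_mono[OF order.refl Emono] by blast
    next
      case False
      have "W0 \<subseteq> L z"
      proof
        fix w assume w: "w \<in> W0"
        then obtain w0 where w0: "w0 \<in> V" "W0 = insert w0 (L w0)" using W0 by auto
        have "less w0 z" using total[of w0 z] False w0 1(3) by (auto simp: L_def)
        then show "w \<in> L z" using w w0 trans by (auto simp: L_def)
      qed
      then have "e \<in> E (L z)" using e(1) Emono by blast
      from contr[OF 1(3) q this 1(2)] have "e \<in> iext q (E (L z))" .
      from fin[OF this] obtain W where W: "finite W" "W \<subseteq> L z" "e \<in> iext q (E W)" by blast
      show ?thesis
      proof (cases "W = {}")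
        case True
        then show ?thesis using W(3) iext_mono[OF order.refl Emono[of "{}" W0]] by auto
      next
        case ne: False
        then obtain z' where z': "z' \<in> W" "W \<subseteq> insert z' (L z')" using mx[OF W(1)] W(2) by (auto simp: L_def)
        have "e \<in> iext q (E (insert z' (L z')))" using W(3) iext_mono[OF order.refl Emono[OF z'(2)]] by blast
        then show ?thesis using 1(1)[of z'] z' W(2) by (auto simp: L_def)
      qed
    qed
  qed
  have low: "good_ext D (E (insert z (L z)))" if "z \<in> V" for z
    using that
  proof (induction z rule: wfp_induct_rule[OF wf])
    case (1 z)
    have "good_ext D (E (L z))" unfolding good_ext_def
    proof
      fix u assume u: "u \<in> E (L z) - P"
      then have "u \<in> rgen (D \<union> y ` L z)" by (simp add: E_def)
      then obtain W where W: "finite W" "W \<subseteq> L z" "u \<in> E W" unfolding E_def by (rule rgen_finite)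
      have "\<exists>W0. (W0 = {} \<or> (\<exists>w\<in>L z. W0 = insert w (L w))) \<and> W \<subseteq> W0"
        using mx[OF W(1)] W(2) by (cases "W = {}") (auto simp: L_def)
      then obtain W0 where W0: "W0 = {} \<or> (\<exists>w\<in>L z. W0 = insert w (L w))" "W \<subseteq> W0" by blast
      have "good_ext D (E W0)"
      proof (cases "W0 = {}")
        case True
        then show ?thesis using good_ext_refl[OF D(1)] rgen_subring[OF D(1)] by (simp add: E_def)
      next
        case False
        then show ?thesis using W0(1) 1(1) by (auto simp: L_def)
      qed
      moreover have "u \<in> E W0 - P" using W(3) Emono[OF W0(2)] u by auto
      ultimately obtain v where v: "v \<in> D - P"
        "\<And>q n. ideal_in D q \<Longrightarrow> P \<subseteq> q \<Longrightarrow> (\<And>n. v ^ n \<notin> q) \<Longrightarrow> u ^ n \<notin> iext q (E W0)"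
        unfolding good_ext_def by meson
      have "u ^ n \<notin> iext q (E (L z))" if q: "ideal_in D q" "P \<subseteq> q" "\<And>n. v ^ n \<notin> q" for q n
      proof
        assume "u ^ n \<in> iext q (E (L z))"
        then have "u ^ n \<in> iext q (E (insert z (L z)))" using iext_mono[OF order.refl Emono] by blast
        moreover have "W0 = {} \<or> (\<exists>w\<in>V. W0 = insert w (L w))" using W0 by (auto simp: L_def)
        moreover have "u ^ n \<in> E W0" using \<open>u \<in> E W0 - P\<close> subring_power[OF E(1)] by blast
        ultimately show False using down[OF q(1,2)] v(2)[OF q] 1(2) by blast
      qed
      then show "\<exists>v\<in>D - P. \<forall>q. ideal_in D q \<and> P \<subseteq> q \<and> (\<forall>n. v ^ n \<notin> q) \<longrightarrow> (\<forall>n. u ^ n \<notin> iext q (E (L z)))"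
        using v(1) by blast
    qed
    then show ?case
      using good_ext_trans[OF _ gz[OF 1(2)] D(1) E(1) E(1) E(2)] by blast
  qed
  have "good_ext D (E V)" unfolding good_ext_def
  proof
    fix u assume u: "u \<in> E V - P"
    then have "u \<in> rgen (D \<union> y ` V)" by (simp add: E_def)
    then obtain W where W: "finite W" "W \<subseteq> V" "u \<in> E W" unfolding E_def by (rule rgen_finite)
    have "\<exists>W0. (W0 = {} \<or> (\<exists>w\<in>V. W0 = insert w (L w))) \<and> W \<subseteq> W0"
      using mx[OF W(1)] W(2) by (cases "W = {}") auto
    then obtain W0 where W0: "W0 = {} \<or> (\<exists>w\<in>V. W0 = insert w (L w))" "W \<subseteq> W0" by blast
    have "good_ext D (E W0)"
    proof (cases "W0 = {}")
      case True
      then show ?thesis using good_ext_refl[OF D(1)] rgen_subring[OF D(1)] by (simp add: E_def)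
    next
      case False
      then show ?thesis using W0(1) low by auto
    qed
    moreover have uW: "u \<in> E W0 - P" using W(3) Emono[OF W0(2)] u by auto
    ultimately obtain v where v: "v \<in> D - P"
      "\<And>q n. ideal_in D q \<Longrightarrow> P \<subseteq> q \<Longrightarrow> (\<And>n. v ^ n \<notin> q) \<Longrightarrow> u ^ n \<notin> iext q (E W0)"
      unfolding good_ext_def by meson
    have "u ^ n \<notin> iext q (E V)" if q: "ideal_in D q" "P \<subseteq> q" "\<And>n. v ^ n \<notin> q" for q n
    proof
      assume "u ^ n \<in> iext q (E V)"
      from fin[OF this] obtain W1 where W1: "finite W1" "W1 \<subseteq> V" "u ^ n \<in> iext q (E W1)" by blast
      have un: "u ^ n \<in> E W0" using uW subring_power[OF E(1)] by blast
      show False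
      proof (cases "W1 = {}")
        case True
        then show False using W1(3) v(2)[OF q] iext_mono[OF order.refl Emono[of "{}" W0]] by auto
      next
        case False
        then obtain z' where z': "z' \<in> W1" "W1 \<subseteq> insert z' (L z')" using mx[OF W1(1)] W1(2) by auto
        have "u ^ n \<in> iext q (E (insert z' (L z')))" using W1(3) iext_mono[OF order.refl Emono[OF z'(2)]] by blast
        then show False using down[OF q(1,2) W0(1) un] v(2)[OF q] z' W1(2) by blast
      qed
    qed
    then show "\<exists>v\<in>D - P. \<forall>q. ideal_in D q \<and> P \<subseteq> q \<and> (\<forall>n. v ^ n \<notin> q) \<longrightarrow> (\<forall>n. u ^ n \<notin> iext q (E V))"
      using v(1) by blast
  qed
  then show ?thesis by (simp add: E_def)
qed

end

section \<open>A ranking of the derivatives\<close>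

type_synonym dvar = "nat \<times> (nat \<Rightarrow>\<^sub>0 nat)"

definition dvars :: "nat \<Rightarrow> nat \<Rightarrow> dvar set" where
  "dvars m N = {(i, e). i < N \<and> Poly_Mapping.keys e \<subseteq> {..<m}}"

text \<open>The ranking compares exponents lexicographically and then the unknowns. Membership in
  \<open>dvars\<close> is built into the relation because the order on exponents is well-founded
  only over a fixed finite set of derivations: \<open>Poly_Mapping.single i 1\<close> decreases as
  \<open>i\<close> grows.\<close>

definition dless :: "nat \<Rightarrow> nat \<Rightarrow> dvar \<Rightarrow> dvar \<Rightarrow> bool" where
  "dless m N u v \<longleftrightarrow> u \<in> dvars m N \<and> v \<in> dvars m N \<and> (snd u < snd v \<or> snd u = snd v \<and> fst u < fst v)"

text \<open>The derivative of the derivative \<open>z\<close> by the operator with exponent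
  \<open>f\<close>; applying derivations adds exponents.\<close>

definition shift :: "dvar \<Rightarrow> (nat \<Rightarrow>\<^sub>0 nat) \<Rightarrow> dvar" where
  "shift z f = (fst z, snd z + f)"

lemma dless_trans: "dless m N u v \<Longrightarrow> dless m N v w \<Longrightarrow> dless m N u w"
  by (auto simp: dless_def)

lemma dless_total: "u \<in> dvars m N \<Longrightarrow> v \<in> dvars m N \<Longrightarrow> u \<noteq> v \<Longrightarrow> dless m N u v \<or> dless m N v u"
  by (cases u; cases v) (auto simp: dless_def)

lemma less_lookup:
  fixes e f :: "nat \<Rightarrow>\<^sub>0 nat"
  shows "e < f \<longleftrightarrow> (\<exists>k. Poly_Mapping.lookup e k < Poly_Mapping.lookup f k \<and> (\<forall>j<k. Poly_Mapping.lookup e j = Poly_Mapping.lookup f j))"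
  unfolding less_poly_mapping.rep_eq less_fun_def by (rule refl)

text \<open>An exponent bounded by \<open>m\<close> is determined by its list of \<open>m\<close>
  entries, and the lexicographic order on lists of a fixed length is well-founded.\<close>

lemma wf_exponents:
  "wf {(e, f). (e::nat \<Rightarrow>\<^sub>0 nat) < f \<and> Poly_Mapping.keys e \<subseteq> {..<m} \<and> Poly_Mapping.keys f \<subseteq> {..<m}}"
proof (rule wf_subset)
  define L where "L e = map (Poly_Mapping.lookup e) [0..<m]" for e :: "nat \<Rightarrow>\<^sub>0 nat"
  show "wf (inv_image (lenlex less_than) L)" by (intro wf_inv_image wf_lenlex) simp
  show "{(e, f). e < f \<and> Poly_Mapping.keys e \<subseteq> {..<m} \<and> Poly_Mapping.keys f \<subseteq> {..<m}}
     \<subseteq> inv_image (lenlex less_than) L"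
  proof clarify
    fix e f :: "nat \<Rightarrow>\<^sub>0 nat"
    assume *: "e < f" "Poly_Mapping.keys e \<subseteq> {..<m}" "Poly_Mapping.keys f \<subseteq> {..<m}"
    then obtain k where k: "Poly_Mapping.lookup e k < Poly_Mapping.lookup f k" "\<And>j. j < k \<Longrightarrow> Poly_Mapping.lookup e j = Poly_Mapping.lookup f j"
      by (auto simp: less_lookup)
    then have "k \<in> Poly_Mapping.keys f" by (auto simp: in_keys_iff)
    then have km: "k < m" using * by auto
    have eq: "take k (L e) = take k (L f)"
      using k(2) km by (intro nth_equalityI) (auto simp: L_def)
    have "L e = take k (L e) @ L e ! k # drop (Suc k) (L e)" "L f = take k (L f) @ L f ! k # drop (Suc k) (L f)"
      using km by (intro id_take_nth_drop; simp add: L_def)+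
    moreover have "(L e ! k, L f ! k) \<in> less_than" using k km by (simp add: L_def)
    moreover have "length (L e) = length (L f)" by (simp add: L_def)
    ultimately have "(L e, L f) \<in> lex less_than"
      unfolding lex_conv using eq by (metis (mono_tags, lifting) case_prodI mem_Collect_eq)
    then show "(e, f) \<in> inv_image (lenlex less_than) L" by (simp add: lenlex_conv L_def)
  qed
qed

lemma wf_dless: "wfP (dless m N)"
proof -
  let ?r = "{(e, f). (e::nat \<Rightarrow>\<^sub>0 nat) < f \<and> Poly_Mapping.keys e \<subseteq> {..<m} \<and> Poly_Mapping.keys f \<subseteq> {..<m}}"
  have "wf (inv_image (?r <*lex*> less_than) (\<lambda>z. (snd z, fst z)))"
    using wf_exponents[of m] by (intro wf_inv_image wf_lex_prod) auto
  moreover have "{(u, v). dless m N u v} \<subseteq> inv_image (?r <*lex*> less_than) (\<lambda>z. (snd z, fst z))"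
    by (auto simp: dless_def dvars_def)
  ultimately show ?thesis unfolding wfp_def by (rule wf_subset)
qed

lemma keys_plus_nat: "Poly_Mapping.keys (e + f :: nat \<Rightarrow>\<^sub>0 nat) = Poly_Mapping.keys e \<union> Poly_Mapping.keys f"
  by (auto simp: in_keys_iff lookup_add)

lemma shift_dvars: "shift z f \<in> dvars m N \<longleftrightarrow> z \<in> dvars m N \<and> Poly_Mapping.keys f \<subseteq> {..<m}"
  by (cases z) (auto simp: shift_def dvars_def keys_plus_nat)

lemma dless_shift: "dless m N u v \<Longrightarrow> Poly_Mapping.keys f \<subseteq> {..<m} \<Longrightarrow> dless m N (shift u f) (shift v f)"
  using shift_dvars[of u f m N] shift_dvars[of v f m N] by (auto simp: dless_def shift_def add_strict_right_mono)

lemma dless_shift_self: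
  assumes "z \<in> dvars m N" "Poly_Mapping.keys f \<subseteq> {..<m}" "f \<noteq> 0"
  shows "dless m N z (shift z f)"
proof -
  have "0 < f" unfolding less_lookup
  proof -
    define k where "k = (LEAST k. Poly_Mapping.lookup f k \<noteq> 0)"
    have "\<exists>k. Poly_Mapping.lookup f k \<noteq> 0" using assms(3) by (metis lookup_zero poly_mapping_eqI)
    then have "Poly_Mapping.lookup f k \<noteq> 0" "\<forall>j<k. Poly_Mapping.lookup f j = 0"
      unfolding k_def by (rule LeastI_ex) (use not_less_Least in blast)
    then show "\<exists>k. Poly_Mapping.lookup 0 k < Poly_Mapping.lookup f k \<and> (\<forall>j<k. Poly_Mapping.lookup 0 j = Poly_Mapping.lookup f j)" by (intro exI[of _ k]) auto
  qed
  then have "snd z < snd z + f" using add_strict_left_mono[of 0 f "snd z"] by simp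
  then show ?thesis using assms shift_dvars[of z f m N] by (simp add: dless_def shift_def)
qed

lemma shift_shift: "shift (shift z f) g = shift z (f + g)" "shift z 0 = z"
  by (auto simp: shift_def add.assoc)

section \<open>Dickson's lemma for derivatives\<close>

lemma dickson_subseq:
  fixes f :: "nat \<Rightarrow> nat \<Rightarrow> nat"
  shows "\<exists>r. strict_mono (r :: nat \<Rightarrow> nat) \<and> (\<forall>k<m. mono (\<lambda>n. f (r n) k))"
proof (induction m)
  case 0
  show ?case by (intro exI[of _ id]) (auto simp: strict_mono_def)
next
  case (Suc m)
  then obtain r :: "nat \<Rightarrow> nat" where r: "strict_mono r" "\<And>k. k < m \<Longrightarrow> mono (\<lambda>n. f (r n) k)" by blast
  obtain s :: "nat \<Rightarrow> nat" where s: "strict_mono s" "monoseq (\<lambda>n. f (r (s n)) m)"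
    using seq_monosub[of "\<lambda>n. f (r n) m"] by blast
  have ms: "mono s" using s(1) by (rule strict_mono_mono)
  have old: "mono (\<lambda>n. f (r (s (t n))) k)" if "k < m" "mono t" for k t
    using r(2)[OF that(1)] ms that(2) by (auto simp: mono_def)
  from s(2) consider "incseq (\<lambda>n. f (r (s n)) m)" | "decseq (\<lambda>n. f (r (s n)) m)"
    by (auto simp: monoseq_iff)
  then show ?case
  proof cases
    case 1
    have "mono (\<lambda>n. f (r (s n)) k)" if "k < Suc m" for k
      using that 1 old[of k "\<lambda>n. n"] by (cases "k = m") (auto simp: mono_def)
    then show ?thesis using strict_mono_o[OF r(1) s(1)] by (intro exI[of _ "r \<circ> s"]) (simp add: comp_def)
  next
    case 2
    \<comment> \<open>A non-increasing sequence of naturals is constant from the place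
      \<open>n0\<close> where it attains its minimum; dropping the first \<open>n0\<close> terms
      makes this coordinate monotone as well.\<close>
    define a where "a = (LEAST a. \<exists>n. f (r (s n)) m = a)"
    have "\<exists>n. f (r (s n)) m = a" unfolding a_def by (rule LeastI_ex) blast
    then obtain n0 where n0: "f (r (s n0)) m = a" by blast
    have "f (r (s (n0 + n))) m = a" for n
    proof (rule antisym)
      show "f (r (s (n0 + n))) m \<le> a" using 2 n0 by (auto simp: decseq_def)
      show "a \<le> f (r (s (n0 + n))) m" unfolding a_def by (rule Least_le) blast
    qed
    then have "mono (\<lambda>n. f (r (s (n0 + n))) k)" if "k < Suc m" for k
      using that old[of k "\<lambda>n. n0 + n"] by (cases "k = m") (auto simp: mono_def)
    moreover have "strict_mono (\<lambda>n. r (s (n0 + n)))"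
      using strict_mono_o[OF r(1) s(1)] by (auto simp: strict_mono_def)
    ultimately show ?thesis by blast
  qed
qed

lemma dickson_dvars:
  assumes "A \<subseteq> dvars m N"
  obtains M where "finite M" "M \<subseteq> A" "\<And>z. z \<in> A \<Longrightarrow> \<exists>x\<in>M. \<exists>f. Poly_Mapping.keys f \<subseteq> {..<m} \<and> z = shift x f"
proof -
  define le where "le x z \<longleftrightarrow> fst x = fst z \<and> (\<forall>k<m. Poly_Mapping.lookup (snd x) k \<le> Poly_Mapping.lookup (snd z) k)" for x z :: dvar
  have "\<exists>M. finite M \<and> M \<subseteq> A \<and> (\<forall>z\<in>A. \<exists>x\<in>M. le x z)"
  proof (rule ccontr)
    assume *: "\<not> ?thesis"
    have bad: "\<exists>z\<in>A. \<forall>x\<in>M. \<not> le x z" if "finite M" "M \<subseteq> A" for M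
    proof (rule ccontr)
      assume "\<not> (\<exists>z\<in>A. \<forall>x\<in>M. \<not> le x z)"
      with that have "finite M \<and> M \<subseteq> A \<and> (\<forall>z\<in>A. \<exists>x\<in>M. le x z)" by blast
      with * show False by blast
    qed
    \<comment> \<open>A bad sequence is built by choice: each new element of \<open>A\<close> fails
      to be a derivative of any element chosen before.\<close>
    define good where "good l z \<longleftrightarrow> z \<in> A \<and> (\<forall>x\<in>set l. \<not> le x z)" for l z
    define nxt where "nxt l = (SOME z. good l z)" for l
    have nxt: "good l (nxt l)" if "set l \<subseteq> A" for l
    proof -
      have "\<exists>z. good l z" unfolding good_def using bad[OF finite_set that] by blast
      then show ?thesis unfolding nxt_def by (rule someI_ex)
    qed
    define l where "l = rec_nat [] (\<lambda>_ l. nxt l # l)"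
    have l: "l 0 = []" "l (Suc n) = nxt (l n) # l n" for n by (simp_all add: l_def)
    have lA: "set (l n) \<subseteq> A" for n
    proof (induction n)
      case (Suc n)
      then show ?case using nxt[OF Suc] by (simp add: l good_def)
    qed (simp add: l)
    have mem: "nxt (l i) \<in> set (l j)" if "i < j" for i j
      using that
    proof (induction j)
      case (Suc j)
      then show ?case by (cases "i = j") (simp_all add: l)
    qed simp
    have nle: "\<not> le (nxt (l i)) (nxt (l j))" if "i < j" for i j
      using nxt[OF lA, of j] mem[OF that] unfolding good_def by blast
    \<comment> \<open>The extra coordinate \<open>m\<close> records the unknown. It is bounded by
      \<open>N\<close>, so two terms of the subsequence belong to the same unknown, and monotonicity
      of the other coordinates makes the later one a derivative of the earlier.\<close>
    define f where "f n k = (if k = m then fst (nxt (l n)) else Poly_Mapping.lookup (snd (nxt (l n))) k)" for n k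
    have bnd: "f n m < N" for n using subsetD[OF assms, of "nxt (l n)"] nxt[OF lA[of n]] by (auto simp: f_def good_def dvars_def)
    obtain r :: "nat \<Rightarrow> nat" where r: "strict_mono r" "\<And>k. k < Suc m \<Longrightarrow> mono (\<lambda>n. f (r n) k)"
      using dickson_subseq[of "Suc m" f] by blast
    have "range (\<lambda>n. f (r n) m) \<subseteq> {..<N}" using bnd by auto
    then have "finite (range (\<lambda>n. f (r n) m))" by (rule finite_subset) simp
    then have "\<not> inj (\<lambda>n. f (r n) m)" using finite_imageD infinite_UNIV_nat by blast
    then obtain i' j' where ij': "f (r i') m = f (r j') m" "i' \<noteq> j'" by (auto simp: inj_def)
    define i j where "i = min i' j'" and "j = max i' j'"
    have ij: "i < j" "f (r i) m = f (r j) m" using ij' by (auto simp: i_def j_def min_def max_def)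
    have "f (r i) k \<le> f (r j) k" if "k < m" for k
      using r(2)[of k] that ij(1) by (auto simp: mono_def)
    moreover have "f (r i) k = Poly_Mapping.lookup (snd (nxt (l (r i)))) k" "f (r j) k = Poly_Mapping.lookup (snd (nxt (l (r j)))) k"
      if "k < m" for k using that by (simp_all add: f_def)
    ultimately have "le (nxt (l (r i))) (nxt (l (r j)))" using ij(2) unfolding le_def by (simp add: f_def)
    moreover have "r i < r j" using r(1) ij(1) by (simp add: strict_mono_def)
    ultimately show False using nle by blast
  qed
  then obtain M where M: "finite M" "M \<subseteq> A" "\<And>z. z \<in> A \<Longrightarrow> \<exists>x\<in>M. le x z" by blast
  have "\<exists>f. Poly_Mapping.keys f \<subseteq> {..<m} \<and> z = shift x f" if xz: "x \<in> A" "z \<in> A" "le x z" for x z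
  proof (intro exI conjI)
    have keys: "Poly_Mapping.keys (snd x) \<subseteq> {..<m}" "Poly_Mapping.keys (snd z) \<subseteq> {..<m}"
      using subsetD[OF assms xz(1)] subsetD[OF assms xz(2)] by (auto simp: dvars_def)
    have out: "Poly_Mapping.lookup (snd x) k = 0" "Poly_Mapping.lookup (snd z) k = 0" if "\<not> k < m" for k
      using keys that unfolding subset_iff in_keys_iff by blast+
    show "Poly_Mapping.keys (snd z - snd x) \<subseteq> {..<m}"
    proof
      fix k assume "k \<in> Poly_Mapping.keys (snd z - snd x)"
      then show "k \<in> {..<m}" using out[of k] by (auto simp: in_keys_iff lookup_minus)
    qed
    show "z = shift x (snd z - snd x)"
    proof -
      have "Poly_Mapping.lookup (snd z) k = Poly_Mapping.lookup (snd x + (snd z - snd x)) k" for k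
      proof (cases "k < m")
        case True
        then have "Poly_Mapping.lookup (snd x) k \<le> Poly_Mapping.lookup (snd z) k" using xz(3) by (simp add: le_def)
        then show ?thesis by (simp add: lookup_add lookup_minus)
      qed (simp add: out lookup_add lookup_minus)
      then have "snd z = snd x + (snd z - snd x)" by (rule poly_mapping_eqI)
      then show ?thesis using xz(3) by (simp add: shift_def le_def prod_eq_iff)
    qed
  qed
  then have "\<And>z. z \<in> A \<Longrightarrow> \<exists>x\<in>M. \<exists>f. Poly_Mapping.keys f \<subseteq> {..<m} \<and> z = shift x f"
    using M by blast
  with M(1,2) show ?thesis by (rule that)
qed

section \<open>Characteristic sets of prime differential ideals\<close>

lemma derivation_zero: "is_derivation X d \<Longrightarrow> is_subring X \<Longrightarrow> d 0 = 0"
  unfolding is_derivation_def by (metis add_cancel_right_right add_0_right is_subringD(2))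

lemma derivation_minus:
  assumes "is_derivation X d" "is_subring X" "x \<in> X" "y \<in> X"
  shows "d (x - y) = d x - d y"
proof -
  have "d ((x - y) + y) = d (x - y) + d y"
    using assms is_subringD(3)[OF assms(2-4)] unfolding is_derivation_def by blast
  then show ?thesis by simp
qed

lemma derivation_one: "is_derivation X d \<Longrightarrow> is_subring X \<Longrightarrow> d 1 = 0"
  unfolding is_derivation_def by (metis add_cancel_right_right is_subringD(1) mult_1 mult_1_right)

lemma pCons_polys_over: "pCons c f \<in> polys_over D \<longleftrightarrow> c \<in> D \<and> f \<in> polys_over D"
  by (force simp: polys_over_def coeff_pCons split: nat.splits)

text \<open>The library's \<open>pderiv\<close> is restricted to coefficient rings without zero divisors.\<close>

definition formal_deriv :: "'a::comm_ring_1 poly \<Rightarrow> 'a poly" where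
  "formal_deriv f = (\<Sum>i<degree f. monom (of_nat (Suc i) * coeff f (Suc i)) i)"

lemma coeff_formal_deriv: "coeff (formal_deriv f) n = of_nat (Suc n) * coeff f (Suc n)"
  unfolding formal_deriv_def coeff_sum coeff_monom
  by (cases "n < degree f") (auto simp: coeff_eq_0 simp del: of_nat_Suc)

lemma formal_deriv_pCons: "formal_deriv (pCons c f) = f + pCons 0 (formal_deriv f)"
  by (rule poly_eqI) (auto simp: coeff_formal_deriv coeff_pCons algebra_simps split: nat.splits)

lemma formal_deriv_0: "formal_deriv 0 = 0"
  by (simp add: formal_deriv_def)

text \<open>The common setting of two applications: \<open>R'\<close> over the coefficient ring
  \<open>k{c} + P\<close>, and the differential polynomials in one unknown over the constant
  polynomials. \<open>y (i, e)\<close> is the derivative with exponent \<open>e\<close> of the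
  \<open>i\<close>-th generator. \<open>char0\<close> says that \<open>S/P\<close> has no torsion as
  an additive group; it enters through the separants.\<close>

locale diff_generated = prime_ideal_in S P
  for S P :: "'a::comm_ring_1 set" +
  fixes D :: "'a set" and ds :: "('a \<Rightarrow> 'a) list" and N :: nat and y :: "dvar \<Rightarrow> 'a"
  assumes D: "is_subring D" "D \<subseteq> S"
    and gen: "S = rgen (D \<union> y ` dvars (length ds) N)"
    and der: "d \<in> set ds \<Longrightarrow> is_derivation S d"
    and derD: "d \<in> set ds \<Longrightarrow> d ` D \<subseteq> D"
    and derP: "d \<in> set ds \<Longrightarrow> d ` P \<subseteq> P"
    and dery: "z \<in> dvars (length ds) N \<Longrightarrow> j < length ds \<Longrightarrow>
      (ds ! j) (y z) = y (shift z (Poly_Mapping.single j 1))"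
    and char0: "s \<in> S \<Longrightarrow> of_nat (Suc n) * s \<in> P \<Longrightarrow> s \<in> P"
begin

abbreviation "X \<equiv> dvars (length ds) N"
abbreviation "lt \<equiv> dless (length ds) N"
abbreviation "exps \<equiv> {e. Poly_Mapping.keys e \<subseteq> {..<length ds}}"

text \<open>An element with leader \<open>z\<close> is viewed as an ordinary polynomial in
  \<open>y z\<close> over \<open>low z\<close>; \<open>lowq z\<close> is the ring of values of these
  polynomials.\<close>

definition low :: "dvar \<Rightarrow> 'a set" where
  "low z = rgen (D \<union> y ` {w. lt w z})"

definition lowq :: "dvar \<Rightarrow> 'a set" where
  "lowq z = rgen (D \<union> y ` insert z {w. lt w z})"

lemma lowq_adj: "lowq z = adj (low z) (y z)"
  by (simp add: lowq_def low_def rgen_insert)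

lemma subring_low: "is_subring (low z)" "is_subring (lowq z)"
  by (auto simp: low_def lowq_def subring_rgen)

lemma D_low: "D \<subseteq> low z"
  using rgen_base[of "D \<union> y ` {w. lt w z}"] by (auto simp: low_def)

lemma yS: "z \<in> X \<Longrightarrow> y z \<in> S"
  using rgen_base[of "D \<union> y ` X"] by (auto simp: gen)

lemma low_S: "low z \<subseteq> S"
proof -
  have "y w \<in> S" if "lt w z" for w using yS[of w] that by (simp add: dless_def)
  then show ?thesis unfolding low_def using D(2) by (intro rgen_least[OF S]) blast
qed

lemma low_SD: "x \<in> low z \<Longrightarrow> x \<in> S"
  using low_S by blast

lemma y_low: "lt w z \<Longrightarrow> y w \<in> low z"
  using rgen_base[of "D \<union> y ` {w. lt w z}"] by (auto simp: low_def)

lemma lowq_low: "lt w z \<Longrightarrow> lowq w \<subseteq> low z"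
  unfolding lowq_adj
proof (rule adj_subset[OF subring_low(1)])
  assume *: "lt w z"
  show "low w \<subseteq> low z"
    unfolding low_def[of w] using D_low y_low dless_trans[OF _ *]
    by (intro rgen_least[OF subring_low(1)]) blast
  show "y w \<in> low z" using * by (rule y_low)
qed

lemma der_rgen:
  assumes W: "W \<subseteq> X" and j: "j < length ds" and T: "is_subring T" "D \<subseteq> T"
    and yT: "\<And>w. w \<in> W \<Longrightarrow> y w \<in> T \<and> y (shift w (Poly_Mapping.single j 1)) \<in> T"
    and x: "x \<in> rgen (D \<union> y ` W)"
  shows "x \<in> T \<and> (ds ! j) x \<in> T"
proof -
  have WS: "rgen (D \<union> y ` W) \<subseteq> S" using W yS D(2) by (intro rgen_least[OF S]) blast
  note dj = der[OF nth_mem[OF j]]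
  show ?thesis using x
  proof induction
    case (base x)
    then show ?case
    proof
      assume "x \<in> D"
      then show ?thesis using derD[OF nth_mem[OF j]] T(2) by blast
    next
      assume "x \<in> y ` W"
      then show ?thesis using yT dery[OF _ j] W by auto
    qed
  next
    case one
    then show ?case using derivation_one[OF dj S] is_subringD[OF T(1)] by simp
  next
    case (diff a b)
    then show ?case using derivation_minus[OF dj S] WS is_subringD(3)[OF T(1)] by (metis subsetD)
  next
    case (mult a b)
    then have "(ds ! j) (a * b) = (ds ! j) a * b + a * (ds ! j) b"
      using dj WS unfolding is_derivation_def by blast
    then show ?case using mult is_subringD(4,6)[OF T(1)] by simp
  qed
qed

lemma single_exp:
  assumes "j < length ds"
  shows "Poly_Mapping.single j (1::nat) \<in> exps" "Poly_Mapping.single j (1::nat) \<noteq> 0"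
proof -
  show "Poly_Mapping.single j (1::nat) \<in> exps" using assms by simp
  show "Poly_Mapping.single j (1::nat) \<noteq> 0" by (metis lookup_single_eq lookup_zero zero_neq_one)
qed

lemma der_low:
  assumes "z \<in> X" "j < length ds" "x \<in> low z"
  shows "x \<in> low (shift z (Poly_Mapping.single j 1)) \<and> (ds ! j) x \<in> low (shift z (Poly_Mapping.single j 1))"
proof (rule der_rgen[OF _ assms(2) subring_low(1) D_low _ assms(3)[unfolded low_def]])
  let ?s = "Poly_Mapping.single j 1 :: nat \<Rightarrow>\<^sub>0 nat"
  have s: "Poly_Mapping.keys ?s \<subseteq> {..<length ds}" "?s \<noteq> 0"
    using single_exp[OF assms(2)] by auto
  show "{w. lt w z} \<subseteq> X" by (auto simp: dless_def)
  fix w assume "w \<in> {w. lt w z}"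
  then have w: "lt w z" by simp
  have "lt w (shift z ?s)" using dless_trans[OF w dless_shift_self[OF assms(1) s]] .
  moreover have "lt (shift w ?s) (shift z ?s)" using dless_shift[OF w s(1)] .
  ultimately show "y w \<in> low (shift z ?s) \<and> y (shift w ?s) \<in> low (shift z ?s)" using y_low by blast
qed

text \<open>Every proper derivative of a relation for \<open>y z\<close> is linear in its leader, and the coefficient of the
  leader is always the separant of the relation.\<close>

lemma deriv_relation_single:
  assumes z: "z \<in> X" and j: "j < length ds" and f: "f \<in> polys_over (low z)"
  shows "(ds ! j) (poly f (y z)) - poly (formal_deriv f) (y z) * y (shift z (Poly_Mapping.single j 1))
    \<in> low (shift z (Poly_Mapping.single j 1))"
  using f
proof (induction f)
  case 0
  then show ?case using derivation_zero[OF der[OF nth_mem[OF j]] S] is_subringD(2)[OF subring_low(1)]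
    by (simp add: formal_deriv_0)
next
  case (pCons c f)
  let ?z = "shift z (Poly_Mapping.single j 1)" and ?d = "ds ! j"
  have *: "is_derivation S ?d" by (rule der[OF nth_mem[OF j]])
  have c: "c \<in> low z" and f: "f \<in> polys_over (low z)" using pCons(3) by (auto simp: pCons_polys_over)
  have fS: "poly f (y z) \<in> S" using f low_SD[of _ z] yS[OF z] by (intro poly_in_subring[OF S]) (auto simp: polys_over_def)
  have yf: "y z * poly f (y z) \<in> S" using is_subringD(4)[OF S yS[OF z] fS] .
  have "?d (c + y z * poly f (y z)) = ?d c + (?d (y z) * poly f (y z) + y z * ?d (poly f (y z)))"
    using * c low_S yS[OF z] fS yf unfolding is_derivation_def by (metis subsetD)
  then have "?d (poly (pCons c f) (y z)) - poly (formal_deriv (pCons c f)) (y z) * y ?z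
      = ?d c + y z * (?d (poly f (y z)) - poly (formal_deriv f) (y z) * y ?z)"
    by (simp add: dery[OF z j] formal_deriv_pCons algebra_simps)
  also have "\<dots> \<in> low ?z"
  proof (intro is_subringD(4,6)[OF subring_low(1)])
    show "?d c \<in> low ?z" using der_low[OF z j c] by simp
    show "y z \<in> low ?z" using dless_shift_self[OF z _ single_exp(2)[OF j]] single_exp(1)[OF j] by (intro y_low) auto
    show "?d (poly f (y z)) - poly (formal_deriv f) (y z) * y ?z \<in> low ?z" by (rule pCons(2)[OF f])
  qed
  finally show ?case .
qed

lemma formal_deriv_polys_over: "is_subring T \<Longrightarrow> f \<in> polys_over T \<Longrightarrow> formal_deriv f \<in> polys_over T"
  unfolding polys_over_def by (auto simp: coeff_formal_deriv simp del: of_nat_Suc intro!: is_subringD subring_of_nat)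

lemma exp_induct [consumes 1, case_names zero add]:
  fixes Q :: "(nat \<Rightarrow>\<^sub>0 nat) \<Rightarrow> bool"
  assumes "e \<in> exps" "Q 0"
    "\<And>e j. e \<in> exps \<Longrightarrow> j < length ds \<Longrightarrow> Q e \<Longrightarrow> Q (e + Poly_Mapping.single j 1)"
  shows "Q e"
  using assms(1)
proof (induction "\<Sum>k<length ds. Poly_Mapping.lookup e k" arbitrary: e)
  case 0
  then have "Poly_Mapping.lookup e k = 0" for k
    by (cases "k < length ds") (auto simp: in_keys_iff)
  then have "e = 0" by (intro poly_mapping_eqI) simp
  then show ?case using assms(2) by simp
next
  case (Suc n)
  then obtain k where k: "k < length ds" "Poly_Mapping.lookup e k \<noteq> 0"
    by (metis (no_types, lifting) lessThan_iff nat.distinct(1) sum.neutral)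
  define e' where "e' = e - Poly_Mapping.single k 1"
  have l: "Poly_Mapping.lookup e' i = (if i = k then Poly_Mapping.lookup e k - 1 else Poly_Mapping.lookup e i)" for i
    by (simp add: e'_def lookup_minus lookup_single when_def)
  have e: "e = e' + Poly_Mapping.single k 1"
    using k by (intro poly_mapping_eqI) (auto simp: lookup_add l lookup_single when_def)
  have e': "e' \<in> exps" using Suc(3) unfolding e by (auto simp: keys_plus_nat)
  have "(\<Sum>k<length ds. Poly_Mapping.lookup e k) = (\<Sum>i<length ds. Poly_Mapping.lookup e' i) + 1"
    unfolding e lookup_add sum.distrib using k(1) by (simp add: lookup_single when_def sum.delta)
  then have "Q e'" using Suc(1)[of e'] Suc(2) e' by simp
  then show ?case using assms(3)[OF e' k(1)] e by simp
qed

text \<open>The remainder \<open>t\<close> is fixed before \<open>Q\<close> because it comes from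
  differentiating the relation itself, independently of any ideal. In \<open>ritt\<close> one and
  the same \<open>t\<close> has to serve for \<open>P\<close> and for \<open>Q\<close>.\<close>

lemma deriv_relation:
  assumes z: "z \<in> X" and f: "f \<in> polys_over (low z)" and e: "e \<in> exps" "e \<noteq> 0"
  shows "\<exists>t\<in>low (shift z e). \<forall>Q. (\<forall>d\<in>set ds. d ` Q \<subseteq> Q) \<longrightarrow> poly f (y z) \<in> Q \<longrightarrow>
    poly (formal_deriv f) (y z) * y (shift z e) + t \<in> Q"
  using e
proof (induction e rule: exp_induct)
  case (add e j)
  let ?s = "poly (formal_deriv f) (y z)" and ?j = "Poly_Mapping.single j (1::nat)" and ?d = "ds ! j"
  show ?case
  proof (cases "e = 0")
    case True
    then show ?thesis
      using deriv_relation_single[OF z add(2) f] nth_mem[OF add(2)]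
      by (intro bexI[of _ "?d (poly f (y z)) - ?s * y (shift z ?j)"]) (auto simp: image_subset_iff)
  next
    case False
    with add obtain t where t: "t \<in> low (shift z e)"
      "\<And>Q. (\<forall>d\<in>set ds. d ` Q \<subseteq> Q) \<Longrightarrow> poly f (y z) \<in> Q \<Longrightarrow> ?s * y (shift z e) + t \<in> Q" by blast
    have ze: "shift z e \<in> X" using z add(1) by (simp add: shift_dvars)
    have zz: "shift (shift z e) ?j = shift z (e + ?j)" by (simp add: shift_shift)
    have "?s \<in> lowq z" unfolding lowq_adj adj_def using formal_deriv_polys_over[OF subring_low(1) f] by blast
    moreover have "lt z (shift z e)" using dless_shift_self[OF z _ False] add(1) by simp
    ultimately have s: "?s \<in> low (shift z e)" using lowq_low by blast
    have dj: "is_derivation S ?d" by (rule der[OF nth_mem[OF add(2)]])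
    have sS: "?s \<in> S" "y (shift z e) \<in> S" "t \<in> S" using low_SD[OF s] low_SD[OF t(1)] yS[OF ze] by auto
    \<comment> \<open>By the product rule the leader is differentiated once more and keeps its
      coefficient. The term with the differentiated separant involves only derivatives below the new
      leader and joins the remainder.\<close>
    define t' where "t' = ?d ?s * y (shift z e) + ?d t"
    have eq: "?d (?s * y (shift z e) + t) = ?s * y (shift z (e + ?j)) + t'"
    proof -
      have "?d (?s * y (shift z e) + t) = ?d (?s * y (shift z e)) + ?d t"
        using dj sS is_subringD(4)[OF S] unfolding is_derivation_def by blast
      also have "?d (?s * y (shift z e)) = ?d ?s * y (shift z e) + ?s * ?d (y (shift z e))"
        using dj sS unfolding is_derivation_def by blast
      finally show ?thesis using dery[OF ze add(2), unfolded zz] by (simp add: t'_def algebra_simps)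
    qed
    have "t' \<in> low (shift z (e + ?j))"
      unfolding t'_def zz[symmetric]
      using der_low[OF ze add(2) s] der_low[OF ze add(2) t(1)]
        y_low[OF dless_shift_self[OF ze _ single_exp(2)[OF add(2)]]] single_exp(1)[OF add(2)]
      by (intro is_subringD(4,6)[OF subring_low(1)]) auto
    moreover have "?s * y (shift z (e + ?j)) + t' \<in> Q" if "\<forall>d\<in>set ds. d ` Q \<subseteq> Q" "poly f (y z) \<in> Q" for Q
      using t(2)[OF that] that(1) nth_mem[OF add(2)] unfolding eq[symmetric] by blast
    ultimately show ?thesis by blast
  qed
qed simp

section \<open>Leaders, minimal relations and separants\<close>

definition dep :: "dvar set" where
  "dep = {z \<in> X. \<exists>f\<in>polys_over (low z). lead_coeff f \<notin> P \<and> poly f (y z) \<in> P}"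

text \<open>At a minimal leader, \<open>rel z\<close> plays the role of the member of a
  characteristic set with leader \<open>z\<close>: \<open>lead_coeff (rel z)\<close> is its initial
  and \<open>sep z\<close> its separant. Least degree means that polynomials of smaller degree with
  value in \<open>P\<close> vanish modulo \<open>P\<close>.\<close>

definition rel :: "dvar \<Rightarrow> 'a poly" where
  "rel z = arg_min degree (\<lambda>f. f \<in> polys_over (low z) \<and> lead_coeff f \<notin> P \<and> poly f (y z) \<in> P)"

definition sep :: "dvar \<Rightarrow> 'a" where
  "sep z = poly (formal_deriv (rel z)) (y z)"

lemma indep:
  assumes "z \<in> X" "z \<notin> dep" "f \<in> polys_over (low z)" "poly f (y z) \<in> P"
  shows "coeff f j \<in> P"
proof (rule ccontr)
  assume "coeff f j \<notin> P"
  from truncate[OF assms(3) subring_low(1) low_S this] obtain g where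
    g: "g \<in> polys_over (low z)" "lead_coeff g \<notin> P" "poly f (y z) - poly g (y z) \<in> P"
    using yS[OF assms(1)] by metis
  then have "poly g (y z) \<in> P" using ideal_in_cong[OF S P g(3)] assms(4) by blast
  with g assms(1,2) show False by (auto simp: dep_def)
qed

text \<open>Minimality of the degree keeps the separant out of \<open>P\<close>: the formal
  derivative has smaller degree, and its coefficient in position \<open>degree (rel z) - 1\<close>
  is the degree times the initial, which \<open>char0\<close> keeps out of \<open>P\<close>.\<close>

lemma rel:
  assumes "z \<in> dep"
  shows "rel z \<in> polys_over (low z)" "lead_coeff (rel z) \<notin> P" "poly (rel z) (y z) \<in> P"
    "\<And>f j. f \<in> polys_over (low z) \<Longrightarrow> degree f < degree (rel z) \<Longrightarrow> poly f (y z) \<in> P \<Longrightarrow> coeff f j \<in> P"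
    "degree (rel z) \<ge> 1" "sep z \<in> lowq z" "sep z \<in> S" "sep z \<notin> P" "lead_coeff (rel z) \<in> S" "poly (rel z) (y z) \<in> S"
proof -
  have z: "z \<in> X" using assms by (auto simp: dep_def)
  let ?Q = "\<lambda>f. f \<in> polys_over (low z) \<and> lead_coeff f \<notin> P \<and> poly f (y z) \<in> P"
  obtain f0 where "?Q f0" using assms by (auto simp: dep_def)
  from arg_min_nat_lemma[of ?Q, OF this, of degree]
  have 1: "?Q (rel z)" and least: "\<And>f. ?Q f \<Longrightarrow> degree (rel z) \<le> degree f" unfolding rel_def by blast+
  show r: "rel z \<in> polys_over (low z)" "lead_coeff (rel z) \<notin> P" "poly (rel z) (y z) \<in> P" using 1 by auto
  show small: "coeff f j \<in> P" if f: "f \<in> polys_over (low z)" "degree f < degree (rel z)" "poly f (y z) \<in> P" for f j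
  proof (rule ccontr)
    assume "coeff f j \<notin> P"
    from truncate[OF f(1) subring_low(1) low_S this] obtain g where
      g: "g \<in> polys_over (low z)" "degree g \<le> degree f" "lead_coeff g \<notin> P" "poly f (y z) - poly g (y z) \<in> P"
      using yS[OF z] by metis
    then have "?Q g" using ideal_in_cong[OF S P g(4)] f(3) by blast
    with least[of g] g(2) f(2) show False by simp
  qed
  show d1: "degree (rel z) \<ge> 1"
  proof (rule ccontr)
    assume "\<not> 1 \<le> degree (rel z)"
    then have "degree (rel z) = 0" by simp
    then obtain c where "rel z = [:c:]" by (rule degree_eq_zeroE)
    then show False using r by simp
  qed
  have pd: "formal_deriv (rel z) \<in> polys_over (low z)" using formal_deriv_polys_over[OF subring_low(1) r(1)] .
  show su: "sep z \<in> lowq z" unfolding lowq_adj adj_def sep_def using pd by blast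
  have "lowq z \<subseteq> S" unfolding lowq_adj using low_S yS[OF z] by (intro adj_subset[OF S])
  with su show "sep z \<in> S" by blast
  show lc: "lead_coeff (rel z) \<in> S" using r(1) low_SD[of _ z] by (auto simp: polys_over_def)
  show "poly (rel z) (y z) \<in> S" using r(3) ideal_inD(1)[OF P] by blast
  show "sep z \<notin> P"
  proof
    assume "sep z \<in> P"
    moreover have "degree (formal_deriv (rel z)) < degree (rel z)"
    proof -
      have "degree (formal_deriv (rel z)) \<le> degree (rel z) - 1"
        by (intro degree_le) (auto simp: coeff_formal_deriv coeff_eq_0)
      then show ?thesis using d1 by simp
    qed
    ultimately have "coeff (formal_deriv (rel z)) (degree (rel z) - 1) \<in> P"
      using small[OF pd] by (simp add: sep_def)
    moreover obtain n where n: "degree (rel z) = Suc n" using d1 by (cases "degree (rel z)") auto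
    ultimately have "of_nat (Suc n) * lead_coeff (rel z) \<in> P" unfolding n coeff_formal_deriv by simp
    with char0[OF lc] r(2) show False by blast
  qed
qed

text \<open>By Dickson's lemma finitely many leaders produce all others by differentiation, so that
  finitely many relations and separants control all of them.\<close>

lemma dep_basis:
  "\<exists>M. finite M \<and> M \<subseteq> dep \<and> (\<forall>z. z \<in> dep \<longrightarrow> z \<notin> M \<longrightarrow> (\<exists>x\<in>M. \<exists>e\<in>exps. e \<noteq> 0 \<and> z = shift x e))"
proof -
  have "dep \<subseteq> X" by (auto simp: dep_def)
  from dickson_dvars[OF this] obtain M where M: "finite M" "M \<subseteq> dep"
    "\<And>z. z \<in> dep \<Longrightarrow> \<exists>x\<in>M. \<exists>f. Poly_Mapping.keys f \<subseteq> {..<length ds} \<and> z = shift x f" by blast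
  have "\<exists>x\<in>M. \<exists>e\<in>exps. e \<noteq> 0 \<and> z = shift x e" if "z \<in> dep" "z \<notin> M" for z
    using M(3)[OF that(1)] that(2) shift_shift(2) by (metis mem_Collect_eq)
  with M(1,2) show ?thesis by blast
qed

lemma finite_max:
  assumes "finite W" "W \<noteq> {}" "W \<subseteq> X"
  shows "\<exists>z\<in>W. \<forall>w\<in>W. w = z \<or> lt w z"
  using assms
proof (induction W rule: finite_ne_induct)
  case (insert x W)
  then obtain z where z: "z \<in> W" "\<forall>w\<in>W. w = z \<or> lt w z" by auto
  have "x \<in> X" "z \<in> X" "x \<noteq> z" using insert z by auto
  then consider "lt x z" | "lt z x" using dless_total by blast
  then show ?case
  proof cases
    case 1
    then show ?thesis using z by blast
  next
    case 2
    then show ?thesis using z dless_trans[of _ _ _ z x] by (metis insert_iff)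
  qed
qed auto

text \<open>An element outside \<open>D\<close> has a leader, namely the highest derivative in a
  finite expression for it. This justifies induction along the ranking.\<close>

lemma top_variable:
  assumes "x \<in> rgen (D \<union> y ` W)" "W \<subseteq> X"
  shows "x \<in> D \<or> (\<exists>z\<in>W. x \<in> lowq z)"
proof -
  obtain W' where W': "finite W'" "W' \<subseteq> W" "x \<in> rgen (D \<union> y ` W')" using assms(1) by (rule rgen_finite)
  show ?thesis
  proof (cases "W' = {}")
    case True
    then show ?thesis using W'(3) rgen_subring[OF D(1)] by simp
  next
    case False
    then obtain z where z: "z \<in> W'" "\<forall>w\<in>W'. w = z \<or> lt w z"
      using finite_max[OF W'(1)] W'(2) assms(2) by blast
    have "rgen (D \<union> y ` W') \<subseteq> lowq z" unfolding lowq_def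
      using z rgen_base by (intro rgen_mono) (blast intro: rgen.base)
    then show ?thesis using W' z by blast
  qed
qed

text \<open>A power of the product \<open>H\<close> of separants multiplies each element of \<open>S\<close> into a ring that is generated by
  independent derivatives and finitely many further elements.\<close>

theorem generic_fibre:
  assumes PD: "P \<subseteq> D"
  shows "\<exists>v\<in>D - P. \<forall>q. ideal_in D q \<and> P \<subseteq> q \<and> (\<forall>n. v ^ n \<notin> q) \<longrightarrow> 1 \<notin> iext q S"
proof -
  obtain M where M: "finite M" "M \<subseteq> dep"
    "\<And>z. z \<in> dep \<Longrightarrow> z \<notin> M \<Longrightarrow> \<exists>x\<in>M. \<exists>e\<in>exps. e \<noteq> 0 \<and> z = shift x e" using dep_basis by metis
  define V where "V = X - dep"
  define B where "B = rgen (D \<union> y ` V)"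
  define B' where "B' = rgen (B \<union> (y ` M \<union> sep ` M))"
  define H where "H = (\<Prod>x\<in>M. sep x)"
  have MX: "M \<subseteq> X" using M(2) by (auto simp: dep_def)
  have B: "is_subring B" "D \<subseteq> B" using rgen_base[of "D \<union> y ` V"] by (auto simp: B_def subring_rgen)
  have BS: "B \<subseteq> S" unfolding B_def using D(2) yS by (intro rgen_least[OF S]) (auto simp: V_def)
  have FS: "y ` M \<union> sep ` M \<subseteq> S" using MX M(2) yS rel(7) by blast
  have B': "is_subring B'" "B \<subseteq> B'" "y ` M \<subseteq> B'" "sep ` M \<subseteq> B'"
    using rgen_base[of "B \<union> (y ` M \<union> sep ` M)"] by (auto simp: B'_def subring_rgen)
  have "good_ext D B" unfolding B_def
  proof (rule good_ext_transcendental[OF D PD _ wf_dless dless_trans])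
    show "y ` V \<subseteq> S" using yS by (auto simp: V_def)
    show "lt u v \<or> lt v u" if "u \<in> V" "v \<in> V" "u \<noteq> v" for u v
      using that dless_total by (auto simp: V_def)
    fix z f j assume z: "z \<in> V" and f: "f \<in> polys_over (rgen (D \<union> y ` {w \<in> V. lt w z}))" "poly f (y z) \<in> P"
    have "rgen (D \<union> y ` {w \<in> V. lt w z}) \<subseteq> low z" unfolding low_def
      by (intro rgen_mono) (auto intro: rgen.base)
    then have "f \<in> polys_over (low z)" using f(1) polys_over_mono by blast
    then show "coeff f j \<in> P" using indep[of z f j] f(2) z by (simp add: V_def)
  qed
  moreover have "good_ext B B'" unfolding B'_def
    using M(1) FS B(1) BS PD B(2) by (intro good_ext_finite) auto
  ultimately have "good_ext D B'" by (rule good_ext_trans[OF _ _ D(1) B(1) B'(1) B(2)])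
  moreover have HB: "H \<in> B'" unfolding H_def using B'(4) by (intro subring_prod[OF B'(1)]) auto
  moreover have HP: "H \<in> S - P" unfolding H_def using M rel(7,8) by (intro prime_prod) auto
  moreover have "H \<in> B' - P" using HB HP by simp
  ultimately obtain v where v: "v \<in> D - P"
    "\<And>q n. ideal_in D q \<Longrightarrow> P \<subseteq> q \<Longrightarrow> (\<And>n. v ^ n \<notin> q) \<Longrightarrow> H ^ n \<notin> iext q B'"
    unfolding good_ext_def by meson
  \<comment> \<open>Membership in the localisation of \<open>B'\<close> at \<open>H\<close>,
    expressed by clearing denominators.\<close>
  define T where "T = {t. \<exists>n. H ^ n * t \<in> B'}"
  have up: "H ^ (n + k) * t \<in> B'" if "H ^ n * t \<in> B'" for n k t
    using is_subringD(4)[OF B'(1) subring_power[OF B'(1) HB, of k] that] by (simp add: power_add mult_ac)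
  have T: "is_subring T" unfolding is_subring_def
  proof (intro conjI ballI)
    show "1 \<in> T" using is_subringD(1)[OF B'(1)] by (auto simp: T_def intro: exI[of _ 0])
    fix a b assume "a \<in> T" "b \<in> T"
    then obtain n k where nk: "H ^ n * a \<in> B'" "H ^ k * b \<in> B'" by (auto simp: T_def)
    have "H ^ (n + k) * (a - b) = H ^ (n + k) * a - H ^ (k + n) * b" by (simp add: algebra_simps)
    also have "\<dots> \<in> B'" using is_subringD(3)[OF B'(1) up[OF nk(1)] up[OF nk(2)]] .
    finally show "a - b \<in> T" by (auto simp: T_def)
    have "H ^ (n + k) * (a * b) = (H ^ n * a) * (H ^ k * b)" by (simp add: power_add mult_ac)
    also have "\<dots> \<in> B'" using is_subringD(4)[OF B'(1) nk] .
    finally show "a * b \<in> T" by (auto simp: T_def)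
  qed
  have B'T: "B' \<subseteq> T" by (auto simp: T_def intro: exI[of _ 0])
  have DT: "D \<subseteq> T" using B(2) B'(2) B'T by blast
  have yT: "y z \<in> T" if "z \<in> X" for z
    using that
  proof (induction z rule: wfp_induct_rule[OF wf_dless[of "length ds" N]])
    case (1 z)
    consider "z \<in> V" | "z \<in> M" | "z \<in> dep" "z \<notin> M" using 1(2) by (auto simp: V_def)
    then show ?case
    proof cases
      case 1
      then have "y z \<in> B" unfolding B_def by (intro rgen.base) simp
      then show ?thesis using B'(2) B'T by blast
    next
      case 2
      then show ?thesis using B'(3) B'T by auto
    next
      case 3
      then obtain x e where x: "x \<in> M" "e \<in> exps" "e \<noteq> 0" "z = shift x e" using M(3) by blast
      have xd: "x \<in> dep" "x \<in> X" using x M(2) MX by auto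
      \<comment> \<open>The derived relation lies in \<open>P\<close>, hence in \<open>T\<close>,
        and \<open>t\<close> involves only lower derivatives, hence lies in \<open>T\<close> by
        induction. So \<open>sep x * y z\<close> lies in \<open>T\<close>, and multiplication by the
        remaining separants replaces \<open>sep x\<close> by \<open>H\<close>.\<close>
      obtain t where t: "t \<in> low z" "sep x * y z + t \<in> P"
      proof -
        have "\<forall>d\<in>set ds. d ` P \<subseteq> P" using derP by simp
        then show ?thesis
          using deriv_relation[OF xd(2) rel(1)[OF xd(1)] x(2,3)] rel(3)[OF xd(1)] that
          unfolding sep_def x(4) by blast
      qed
      have "y w \<in> T" if "lt w z" for w using 1(1)[OF that] that by (simp add: dless_def)
      then have "low z \<subseteq> T" unfolding low_def using DT by (intro rgen_least[OF T]) blast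
      then have "(sep x * y z + t) - t \<in> T" using t PD DT by (intro is_subringD(3)[OF T]) auto
      then have "(\<Prod>x\<in>M - {x}. sep x) * (sep x * y z) \<in> T"
        using B'(4) B'T by (intro is_subringD(4)[OF T subring_prod[OF T]]) (simp_all add: image_subset_iff subset_iff)
      moreover have "(\<Prod>x\<in>M - {x}. sep x) * (sep x * y z) = H * y z"
        unfolding H_def using prod.remove[OF M(1) x(1), of sep] by (simp add: mult_ac)
      ultimately obtain n where "H ^ n * (H * y z) \<in> B'" by (auto simp: T_def)
      then have "H ^ Suc n * y z \<in> B'" by (simp add: mult_ac)
      then show ?thesis unfolding T_def by blast
    qed
  qed
  have ST: "S \<subseteq> T" unfolding gen using yT DT by (intro rgen_least[OF T]) auto
  have "1 \<notin> iext q S" if q: "ideal_in D q" "P \<subseteq> q" "\<And>n. v ^ n \<notin> q" for q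
  proof
    have I: "ideal_in B' (iext q B')" using ideal_inD(1)[OF q(1)] B(2) B'(2) by (intro ideal_iext[OF B'(1)]) blast
    \<comment> \<open>The coefficients from \<open>S\<close> of a combination acquire a common
      denominator, a power of \<open>H\<close>. If \<open>1\<close> lay in the ideal extended to
      \<open>S\<close>, a power of \<open>H\<close> would lie in the ideal extended to
      \<open>B'\<close>, against the choice of \<open>v\<close> for \<open>u = H\<close>.\<close>
    have "\<exists>n. H ^ n * x \<in> iext q B'" if "x \<in> iext q S" for x
      using that
    proof induction
      case zero
      show ?case by (intro exI[of _ 0]) (simp add: iext.zero)
    next
      case (step a t b)
      then obtain n where n: "H ^ n * b \<in> iext q B'" by blast
      obtain k where k: "H ^ k * t \<in> B'" using step(2) ST by (auto simp: T_def)
      have "H ^ (n + k) * (a * t + b) = H ^ n * (H ^ k * t) * a + H ^ k * (H ^ n * b)"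
        by (simp add: algebra_simps power_add)
      also have "\<dots> \<in> iext q B'"
        by (rule ideal_inD(3)[OF I ideal_inD(4)[OF I is_subringD(4)[OF B'(1) subring_power[OF B'(1) HB] k] iext_base[OF B'(1) step(1)]]
          ideal_inD(4)[OF I subring_power[OF B'(1) HB] n]])
      finally show ?case by blast
    qed
    moreover assume "1 \<in> iext q S"
    ultimately obtain n where "H ^ n * 1 \<in> iext q B'" by blast
    then show False using v(2)[OF q] by simp
  qed
  then show ?thesis using v(1) by blast
qed

text \<open>Characteristic sets determine prime differential ideals: up to factors from initials and
  separants, every element of \<open>P\<close> reduces to zero by relations that come from
  \<open>A\<close> through differentiation. A prime differential ideal containing \<open>A\<close>
  but not \<open>h\<close> therefore contains \<open>P\<close>. Applied to kernels of evaluations,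
  this turns infinitely many relations into finitely many equations and one inequation.\<close>

theorem ritt:
  assumes DP: "D \<inter> P \<subseteq> {0}"
  obtains A h where "finite A" "A \<subseteq> P" "h \<in> S - P"
    "\<And>Q. prime_ideal_in S Q \<Longrightarrow> (\<And>d. d \<in> set ds \<Longrightarrow> d ` Q \<subseteq> Q) \<Longrightarrow> A \<subseteq> Q \<Longrightarrow> h \<notin> Q \<Longrightarrow> P \<subseteq> Q"
proof -
  obtain M where M: "finite M" "M \<subseteq> dep"
    "\<And>z. z \<in> dep \<Longrightarrow> z \<notin> M \<Longrightarrow> \<exists>x\<in>M. \<exists>e\<in>exps. e \<noteq> 0 \<and> z = shift x e" using dep_basis by metis
  define A where "A = (\<lambda>x. poly (rel x) (y x)) ` M"
  define h where "h = (\<Prod>x\<in>M. sep x * lead_coeff (rel x))"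
  have MX: "M \<subseteq> X" using M(2) by (auto simp: dep_def)
  have slS: "sep x * lead_coeff (rel x) \<in> S - P" if "x \<in> M" for x
    using that M(2) rel(2,7-9)[of x] prime is_subringD(4)[OF S] by blast
  show ?thesis
  proof
    show "finite A" "A \<subseteq> P" using M rel(3) by (auto simp: A_def)
    show "h \<in> S - P" unfolding h_def using M(1) slS by (rule prime_prod)
    fix Q assume Q: "prime_ideal_in S Q" and Qd: "\<And>d. d \<in> set ds \<Longrightarrow> d ` Q \<subseteq> Q" and AQ: "A \<subseteq> Q" and hQ: "h \<notin> Q"
    interpret Q: prime_ideal_in S Q by fact
    have nQ: "sep x \<notin> Q" "lead_coeff (rel x) \<notin> Q" if x: "x \<in> M" for x
    proof -
      have xd: "x \<in> dep" using x M(2) by auto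
      let ?r = "\<Prod>x\<in>M - {x}. sep x * lead_coeff (rel x)"
      have r: "?r \<in> S" using slS by (intro subring_prod[OF S]) auto
      have h: "h = sep x * (lead_coeff (rel x) * ?r)" "h = lead_coeff (rel x) * (sep x * ?r)"
        unfolding h_def using prod.remove[OF M(1) x, of "\<lambda>x. sep x * lead_coeff (rel x)"] by (simp_all add: mult_ac)
      have lr: "lead_coeff (rel x) * ?r \<in> S" "sep x * ?r \<in> S"
        using is_subringD(4)[OF S _ r] rel(7,9)[OF xd] by blast+
      show "sep x \<notin> Q" using hQ ideal_inD(5)[OF Q.P lr(1)] unfolding h(1) by blast
      show "lead_coeff (rel x) \<notin> Q" using hQ ideal_inD(5)[OF Q.P lr(2)] unfolding h(2) by blast
    qed
    have DQ: "D \<inter> P \<subseteq> Q" using DP ideal_inD(2)[OF Q.P] by blast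
    \<comment> \<open>Induction on the leader: reduction at \<open>z\<close> leaves coefficients in
      \<open>low z\<close>, whose leaders are smaller.\<close>
    have main: "lowq z \<inter> P \<subseteq> Q" if "z \<in> X" for z
      using that
    proof (induction z rule: wfp_induct_rule[OF wf_dless[of "length ds" N]])
      case (1 z)
      have lowPQ: "low z \<inter> P \<subseteq> Q"
      proof
        fix p assume p: "p \<in> low z \<inter> P"
        have "p \<in> D \<or> (\<exists>w\<in>{w. lt w z}. p \<in> lowq w)"
        proof (rule top_variable)
          show "p \<in> rgen (D \<union> y ` {w. lt w z})" using p by (simp add: low_def)
          show "{w. lt w z} \<subseteq> X" unfolding dless_def by blast
        qed
        then show "p \<in> Q"
        proof
          assume "p \<in> D" then show ?thesis using p DQ by blast
        next
          assume "\<exists>w\<in>{w. lt w z}. p \<in> lowq w"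
          then obtain w where w: "lt w z" "p \<in> lowq w" by blast
          moreover have "w \<in> X" using w(1) by (simp add: dless_def)
          ultimately show ?thesis using 1(1) p by blast
        qed
      qed
      \<comment> \<open>\<open>f\<close> is a relation with leader \<open>z\<close> that holds
        modulo both ideals. The pseudo-remainder of \<open>p\<close> has value in \<open>P\<close>
        and too small a degree, so its coefficients lie in \<open>P\<close> and by
        \<open>lowPQ\<close> in \<open>Q\<close>. Hence a power of the leading coefficient of
        \<open>f\<close> times \<open>p\<close> lies in \<open>Q\<close>, and primality removes the
        power.\<close>
      have red: "p \<in> Q" if f: "f \<in> polys_over (low z)" "poly f (y z) \<in> Q" "poly f (y z) \<in> P" "lead_coeff f \<notin> Q" "degree f \<ge> 1"
        and small: "\<And>r j. r \<in> polys_over (low z) \<Longrightarrow> degree r < degree f \<Longrightarrow> poly r (y z) \<in> P \<Longrightarrow> coeff r j \<in> P"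
        and p: "p \<in> lowq z" "p \<in> P" for f p
      proof -
        obtain g where g: "g \<in> polys_over (low z)" "p = poly g (y z)" using p(1) by (auto simp: lowq_adj adj_def)
        have "ideal_in (low z) (low z)" using is_subringD[OF subring_low(1)] by (auto simp: ideal_in_def)
        from pseudo_div[OF subring_low(1) this f(1) refl f(5) g(1)] obtain n R r where
          r: "R \<in> polys_over (low z)" "r \<in> polys_over (low z)" "smult (lead_coeff f ^ n) g = f * R + r" "degree r < degree f"
          by blast
        have ev: "lead_coeff f ^ n * p = poly f (y z) * poly R (y z) + poly r (y z)"
          using arg_cong[OF r(3), of "\<lambda>p. poly p (y z)"] g(2) by simp
        have RS: "poly R (y z) \<in> S" using r(1) low_SD[of _ z] yS[OF 1(2)] by (intro poly_in_subring[OF S]) (auto simp: polys_over_def)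
        have lS: "lead_coeff f \<in> S" using f(1) low_SD[of _ z] by (auto simp: polys_over_def)
        have "poly r (y z) = lead_coeff f ^ n * p - poly f (y z) * poly R (y z)" using ev by simp
        also have "\<dots> \<in> P"
          using ideal_in_neg(2)[OF S P ideal_inD(4)[OF P subring_power[OF S lS] p(2)] ideal_inD(5)[OF P RS f(3)]] .
        finally have "coeff r j \<in> P" for j using small[OF r(2,4)] by blast
        then have "coeff r j \<in> Q" for j using lowPQ r(2) unfolding polys_over_def by blast
        then have "poly r (y z) \<in> Q" using Q.poly_in_P yS[OF 1(2)] by blast
        then have "lead_coeff f ^ n * p \<in> Q" unfolding ev by (intro ideal_inD(3)[OF Q.P] ideal_inD(5)[OF Q.P RS f(2)])
        then show "p \<in> Q" using Q.prime[OF subring_power[OF S lS]] Q.power_notin[OF lS f(4)] p(2) ideal_inD(1)[OF P] by blast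
      qed
      consider "z \<notin> dep" | "z \<in> M" | "z \<in> dep" "z \<notin> M" by blast
      then show ?case
      proof cases
        case i: 1
        show ?thesis
        proof
          fix p assume p: "p \<in> lowq z \<inter> P"
          then obtain g where g: "g \<in> polys_over (low z)" "p = poly g (y z)" by (auto simp: lowq_adj adj_def)
          then have "coeff g j \<in> P" for j using indep[OF 1(2) i g(1)] p by blast
          then have "coeff g j \<in> Q" for j using g(1) lowPQ unfolding polys_over_def by blast
          then show "p \<in> Q" using Q.poly_in_P yS[OF 1(2)] g(2) by blast
        qed
      next
        case i: 2
        then have zd: "z \<in> dep" using M(2) by auto
        have "poly (rel z) (y z) \<in> Q" using AQ i by (simp add: A_def image_subset_iff)
        then have "p \<in> Q" if "p \<in> lowq z" "p \<in> P" for p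
          by (rule red[OF rel(1)[OF zd] _ rel(3)[OF zd] nQ(2)[OF i] rel(5)[OF zd] rel(4)[OF zd] that])
        then show ?thesis by blast
      next
        case i: 3
        then obtain x e where x: "x \<in> M" "e \<in> exps" "e \<noteq> 0" "z = shift x e" using M(3) by blast
        have xd: "x \<in> dep" "x \<in> X" using x M(2) MX by auto
        obtain t where t: "t \<in> low z" "sep x * y z + t \<in> P" "sep x * y z + t \<in> Q"
        proof -
          have "poly (rel x) (y x) \<in> Q" using AQ x(1) by (simp add: A_def image_subset_iff)
          moreover have "\<forall>d\<in>set ds. d ` Q \<subseteq> Q" "\<forall>d\<in>set ds. d ` P \<subseteq> P" using Qd derP by blast+
          moreover obtain t where "t \<in> low z" "\<And>Q. \<forall>d\<in>set ds. d ` Q \<subseteq> Q \<Longrightarrow> poly (rel x) (y x) \<in> Q \<Longrightarrow> sep x * y z + t \<in> Q"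
            using deriv_relation[OF xd(2) rel(1)[OF xd(1)] x(2,3)] unfolding sep_def x(4) by meson
          ultimately show ?thesis using that[of t] rel(3)[OF xd(1)] by simp
        qed
        have "lt x z" unfolding x(4) using dless_shift_self[OF xd(2) _ x(3)] x(2) by auto
        then have sl: "sep x \<in> low z" using lowq_low rel(6)[OF xd(1)] by blast
        have s0: "sep x \<noteq> 0" using nQ(1)[OF x(1)] ideal_inD(2)[OF Q.P] by auto
        \<comment> \<open>For a proper derivative of a minimal leader the reducing relation is
          linear, with the separant as leading coefficient; its remainders are constants in
          \<open>y z\<close>, so the condition on small degrees is immediate.\<close>
        let ?f = "[:t, sep x:]"
        have "(0 :: 'a poly) \<in> polys_over (low z)" using is_subringD(2)[OF subring_low(1)] by (simp add: polys_over_def)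
        then have f: "?f \<in> polys_over (low z)" "degree ?f = 1" "lead_coeff ?f = sep x" "poly ?f (y z) = sep x * y z + t"
          using s0 sl t(1) by (simp_all add: pCons_polys_over mult.commute)
        have "coeff r j \<in> P" if r: "degree r < degree ?f" "poly r (y z) \<in> P" for r j
        proof -
          have "degree r = 0" using r(1) f(2) by simp
          then obtain c where "r = [:c:]" by (rule degree_eq_zeroE)
          then show ?thesis using r(2) ideal_inD(2)[OF P] by (auto simp: coeff_pCons split: nat.splits)
        qed
        note small = this
        have "p \<in> Q" if p: "p \<in> lowq z" "p \<in> P" for p
        proof (rule red[of ?f, OF f(1) _ _ _ _ _ p])
          show "poly ?f (y z) \<in> Q" "poly ?f (y z) \<in> P" unfolding f(4) by fact+
          show "lead_coeff ?f \<notin> Q" unfolding f(3) by (rule nQ(1)[OF x(1)])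
          show "1 \<le> degree ?f" unfolding f(2) by simp
        qed (rule small)
        then show ?thesis by blast
      qed
    qed
    show "P \<subseteq> Q"
    proof
      fix p assume p: "p \<in> P"
      then have "p \<in> rgen (D \<union> y ` X)" using ideal_inD(1)[OF P] gen by auto
      from top_variable[OF this] show "p \<in> Q" using p DQ main by blast
    qed
  qed
qed

end

section \<open>Differential polynomials and their evaluation\<close>

abbreviation lkp :: "('a \<Rightarrow>\<^sub>0 'b::zero) \<Rightarrow> 'a \<Rightarrow> 'b" where "lkp \<equiv> Poly_Mapping.lookup"
abbreviation kys :: "('a \<Rightarrow>\<^sub>0 'b::zero) \<Rightarrow> 'a set" where "kys \<equiv> Poly_Mapping.keys"
abbreviation sgl :: "'a \<Rightarrow> 'b \<Rightarrow> 'a \<Rightarrow>\<^sub>0 'b::zero" where "sgl \<equiv> Poly_Mapping.single"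

lemma keys_plus_monom: "kys (s + t :: 'x \<Rightarrow>\<^sub>0 nat) = kys s \<union> kys t"
  by (auto simp: in_keys_iff lookup_add)

lemma sum_singles: "p = (\<Sum>t\<in>kys p. sgl t (lkp p t))"
proof (rule poly_mapping_eqI)
  fix s
  show "lkp p s = lkp (\<Sum>t\<in>kys p. sgl t (lkp p t)) s"
    by (simp add: lookup_sum lookup_single when_def in_keys_iff)
qed

lemma monom_induct [case_names zero add]:
  fixes s :: "'x \<Rightarrow>\<^sub>0 nat"
  assumes "Q 0" "\<And>s x. Q s \<Longrightarrow> Q (s + sgl x 1)"
  shows "Q s"
proof (induction "\<Sum>x\<in>kys s. lkp s x" arbitrary: s)
  case 0
  then have "s = 0" by (intro poly_mapping_eqI) (auto simp: in_keys_iff)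
  then show ?case using assms(1) by simp
next
  case (Suc n)
  then obtain x where x: "x \<in> kys s" by fastforce
  define s' where "s' = s - sgl x 1"
  have l: "lkp s' y = (if y = x then lkp s x - 1 else lkp s y)" for y
    by (simp add: s'_def lookup_minus lookup_single when_def)
  have s: "s = s' + sgl x 1"
    using x by (intro poly_mapping_eqI) (auto simp: lookup_add l lookup_single when_def in_keys_iff)
  have "(\<Sum>x\<in>kys s'. lkp s' x) = (\<Sum>x\<in>kys s. lkp s' x)"
    unfolding s by (intro sum.mono_neutral_left) (auto simp: keys_plus_monom in_keys_iff)
  moreover have "(\<Sum>x\<in>kys s. lkp s x) = (\<Sum>y\<in>kys s. lkp s' y) + 1"
  proof -
    have "(\<Sum>y\<in>kys s. lkp s y) = (\<Sum>y\<in>kys s. lkp s' y + (if y = x then 1 else 0))"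
      using x by (intro sum.cong) (auto simp: l in_keys_iff)
    then show ?thesis using x by (simp add: sum.distrib)
  qed
  ultimately have "Q s'" using Suc by simp
  then show ?case unfolding s by (rule assms(2))
qed

definition mono_eval :: "('a::comm_ring_1 \<Rightarrow> 'a) list \<Rightarrow> ('v \<Rightarrow> 'a) \<Rightarrow> (('v \<times> (nat \<Rightarrow>\<^sub>0 nat)) \<Rightarrow>\<^sub>0 nat) \<Rightarrow> 'a" where
  "mono_eval ds a t = (\<Prod>x\<in>kys t. derivative_op ds (snd x) (a (fst x)) ^ lkp t x)"

lemma dpoly_eval_mono: "dpoly_eval ds a p = (\<Sum>t\<in>kys p. lkp p t * mono_eval ds a t)"
  unfolding dpoly_eval_def mono_eval_def by (intro sum.cong prod.cong refl arg_cong2[where f = "(*)"]) auto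

lemma mono_eval_superset:
  assumes "finite W" "kys t \<subseteq> W"
  shows "mono_eval ds a t = (\<Prod>x\<in>W. derivative_op ds (snd x) (a (fst x)) ^ lkp t x)"
  unfolding mono_eval_def using assms by (intro prod.mono_neutral_left) (auto simp: in_keys_iff)

lemma mono_eval_add: "mono_eval ds a (s + t) = mono_eval ds a s * mono_eval ds a t"
proof -
  let ?W = "kys s \<union> kys t"
  show ?thesis
    by (simp add: mono_eval_superset[of ?W] keys_plus_monom lookup_add power_add prod.distrib)
qed

lemma mono_eval_0 [simp]: "mono_eval ds a 0 = 1"
  by (simp add: mono_eval_def)

lemma mono_eval_single: "mono_eval ds a (sgl x 1) = derivative_op ds (snd x) (a (fst x))"
  by (simp add: mono_eval_def)

lemma dpoly_eval_superset:
  assumes "finite W" "kys p \<subseteq> W"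
  shows "dpoly_eval ds a p = (\<Sum>t\<in>W. lkp p t * mono_eval ds a t)"
  unfolding dpoly_eval_mono using assms by (intro sum.mono_neutral_left) (auto simp: in_keys_iff)

lemma dpoly_eval_add: "dpoly_eval ds a (p + q) = dpoly_eval ds a p + dpoly_eval ds a q"
proof -
  have W: "finite (kys p \<union> kys q)" "kys p \<subseteq> kys p \<union> kys q" "kys q \<subseteq> kys p \<union> kys q" "kys (p + q) \<subseteq> kys p \<union> kys q"
    using keys_add[of p q] by auto
  show ?thesis
    unfolding dpoly_eval_superset[OF W(1,2)] dpoly_eval_superset[OF W(1,3)] dpoly_eval_superset[OF W(1,4)]
      lookup_add distrib_right sum.distrib ..
qed

lemma dpoly_eval_0 [simp]: "dpoly_eval ds a 0 = 0"
  by (simp add: dpoly_eval_mono)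

lemma dpoly_eval_sum: "dpoly_eval ds a (sum f I) = (\<Sum>i\<in>I. dpoly_eval ds a (f i))"
  by (induction I rule: infinite_finite_induct) (auto simp: dpoly_eval_add)

lemma dpoly_eval_diff: "dpoly_eval ds a (p - q) = dpoly_eval ds a p - dpoly_eval ds a q"
  using dpoly_eval_add[of ds a "p - q" q] by simp

lemma dpoly_eval_single: "dpoly_eval ds a (sgl t c) = c * mono_eval ds a t"
  by (cases "c = 0") (auto simp: dpoly_eval_mono)

lemma dpoly_eval_1 [simp]: "dpoly_eval ds a 1 = 1"
  using dpoly_eval_single[of ds a 0 1] by simp

lemma dpoly_mult_singles: "p * q = (\<Sum>s\<in>kys p. \<Sum>t\<in>kys q. sgl (s + t) (lkp p s * lkp q t))"
  for p q :: "'x::comm_monoid_add \<Rightarrow>\<^sub>0 'a::comm_ring_1"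
proof -
  have "p * q = (\<Sum>s\<in>kys p. sgl s (lkp p s)) * (\<Sum>t\<in>kys q. sgl t (lkp q t))"
    using sum_singles[of p] sum_singles[of q] by simp
  then show ?thesis by (simp add: sum_product mult_single)
qed

lemma dpoly_eval_mult: "dpoly_eval ds a (p * q) = dpoly_eval ds a p * dpoly_eval ds a q"
proof -
  have "dpoly_eval ds a (p * q) = (\<Sum>s\<in>kys p. \<Sum>t\<in>kys q. (lkp p s * mono_eval ds a s) * (lkp q t * mono_eval ds a t))"
    unfolding dpoly_mult_singles[of p q] by (simp add: dpoly_eval_sum dpoly_eval_single mono_eval_add mult_ac)
  also have "\<dots> = dpoly_eval ds a p * dpoly_eval ds a q"
    by (simp add: dpoly_eval_mono sum_product)
  finally show ?thesis .
qed

lemma dpoly_eval_power: "dpoly_eval ds a (p ^ n) = dpoly_eval ds a p ^ n"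
  by (induction n) (auto simp: dpoly_eval_mult)

section \<open>Generators of the ring of differential polynomials\<close>

definition dvar :: "'v \<times> (nat \<Rightarrow>\<^sub>0 nat) \<Rightarrow> ('v, 'a::comm_ring_1) dpoly" where
  "dvar z = sgl (sgl z 1) 1"

definition dconst :: "'a::comm_ring_1 \<Rightarrow> ('v, 'a) dpoly" where
  "dconst c = sgl 0 c"

lemma dpoly_eval_dvar [simp]: "dpoly_eval ds a (dvar z) = derivative_op ds (snd z) (a (fst z))"
  by (simp add: dvar_def dpoly_eval_single mono_eval_single[simplified])

lemma dpoly_eval_dconst [simp]: "dpoly_eval ds a (dconst c) = c"
  by (simp add: dconst_def dpoly_eval_single)

lemma derivative_op_0 [simp]: "derivative_op ds 0 x = x"
proof -
  have "foldr (\<lambda>i f. (ds ! i ^^ 0) \<circ> f) l id x = x" for l :: "nat list" by (induction l) auto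
  then show ?thesis by (simp add: derivative_op_def)
qed

lemma derivative_op_closed:
  assumes "\<And>d. d \<in> set ds \<Longrightarrow> d ` X \<subseteq> X" "x \<in> X"
  shows "derivative_op ds e x \<in> X"
proof -
  have "(d ^^ k) z \<in> X" if "d \<in> set ds" "z \<in> X" for d k z
    using assms(1)[OF that(1)] that(2) by (induction k) auto
  then have "foldr (\<lambda>i f. (ds ! i ^^ lkp e i) \<circ> f) l id x \<in> X" if "set l \<subseteq> {..<length ds}" for l
    using that assms(2) by (induction l) auto
  then show ?thesis by (simp add: derivative_op_def lessThan_atLeast0)
qed

text \<open>\<open>derivative_op\<close> composes the derivations in the order of the list, with
  index \<open>0\<close> outermost. An additional factor \<open>ds ! j\<close> has to be moved past
  the powers with smaller index, which is where commutation is used.\<close>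

lemma derivative_op_add_single:
  assumes comm: "\<And>d d' x. d \<in> set ds \<Longrightarrow> d' \<in> set ds \<Longrightarrow> d (d' x) = d' (d x)" and j: "j < length ds"
  shows "derivative_op ds (e + sgl j 1) x = (ds ! j) (derivative_op ds e x)"
proof -
  let ?F = "\<lambda>e l. foldr (\<lambda>i f. (ds ! i ^^ lkp e i) \<circ> f) l id x"
  let ?e = "e + sgl j 1"
  have pow: "(d ^^ k) ((ds ! j) z) = (ds ! j) ((d ^^ k) z)" if "d \<in> set ds" for d k z
    using comm[OF that nth_mem[OF j]] by (induction k) auto
  have step: "?F e' (i # l) = (ds ! i ^^ lkp e' i) (?F e' l)" for e' i l by simp
  have out: "?F ?e l = ?F e l" if "j \<notin> set l" for l
    using that by (induction l) (auto simp: lookup_add lookup_single)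
  have "?F ?e l = (ds ! j) (?F e l)" if "j \<in> set l" "distinct l" "set l \<subseteq> {..<length ds}" for l
    using that
  proof (induction l)
    case (Cons i l)
    show ?case
    proof (cases "i = j")
      case True
      then have "lkp ?e i = Suc (lkp e i)" by (simp add: lookup_add)
      moreover have "?F ?e l = ?F e l" using out[of l] Cons(3) True by simp
      ultimately have "?F ?e (i # l) = (ds ! i ^^ Suc (lkp e i)) (?F e l)" by (simp only: step)
      then show ?thesis unfolding step using True by simp
    next
      case False
      then have "lkp ?e i = lkp e i" by (simp add: lookup_add lookup_single)
      moreover have "?F ?e l = (ds ! j) (?F e l)" using Cons(2-4) False by (intro Cons(1)) auto
      moreover have "ds ! i \<in> set ds" using Cons(4) by simp
      ultimately show ?thesis using pow[of "ds ! i"] by (simp only: step)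
    qed
  qed simp
  from this[of "[0..<length ds]"] show ?thesis using j by (simp add: derivative_op_def lessThan_atLeast0)
qed

lemma dpolys_iff: "p \<in> dpolys m C V \<longleftrightarrow>
  (\<forall>t\<in>kys p. lkp p t \<in> C \<and> (\<forall>z\<in>kys t. fst z \<in> V \<and> kys (snd z) \<subseteq> {..<m}))"
  by (simp add: dpolys_def case_prod_beta)

lemma dpolys_mono: "C \<subseteq> C' \<Longrightarrow> V \<subseteq> V' \<Longrightarrow> dpolys m C V \<subseteq> dpolys m C' V'"
  unfolding dpolys_iff subset_iff by blast

lemma dpolys_single:
  assumes "c \<in> C" "\<And>z. z \<in> kys t \<Longrightarrow> fst z \<in> V \<and> kys (snd z) \<subseteq> {..<m}"
  shows "sgl t c \<in> dpolys m C V"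
  using assms by (auto simp: dpolys_iff)

lemma subring_dpolys:
  fixes V :: "'v set"
  assumes C: "is_subring C"
  shows "is_subring (dpolys m C V)"
proof -
  have sub: "p - q \<in> dpolys m C V" if "p \<in> dpolys m C V" "q \<in> dpolys m C V" for p q :: "('v, 'a) dpoly"
  proof -
    have z: "lkp r t \<in> C" if "r \<in> dpolys m C V" for r :: "('v, 'a) dpoly" and t
      using that is_subringD(2)[OF C] by (cases "t \<in> kys r") (auto simp: dpolys_iff in_keys_iff)
    have "kys (p - q) \<subseteq> kys p \<union> kys q" by (rule keys_diff)
    then show ?thesis using that z unfolding dpolys_iff lookup_minus
      by (blast intro: is_subringD(3)[OF C])
  qed
  have zero: "0 \<in> dpolys m C V" by (simp add: dpolys_iff)
  have add: "p + q \<in> dpolys m C V" if "p \<in> dpolys m C V" "q \<in> dpolys m C V" for p q :: "('v, 'a) dpoly"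
    using sub[OF that(1) sub[OF zero that(2)]] by simp
  have sum: "sum f I \<in> dpolys m C V" if "\<And>i. i \<in> I \<Longrightarrow> f i \<in> dpolys m C V" for f :: "'i \<Rightarrow> ('v, 'a) dpoly" and I
    using that by (induction I rule: infinite_finite_induct) (auto intro: zero add)
  have sum2: "sum f I \<in> dpolys m C V" if "\<And>i. i \<in> I \<Longrightarrow> f i \<in> dpolys m C V" for f :: "_ \<Rightarrow> ('v, 'a) dpoly" and I
    using that by (induction I rule: infinite_finite_induct) (auto intro: zero add)
  have "p * q \<in> dpolys m C V" if "p \<in> dpolys m C V" "q \<in> dpolys m C V" for p q :: "('v, 'a) dpoly"
    unfolding dpoly_mult_singles[of p q] using that is_subringD(4)[OF C]
    by (intro sum2 dpolys_single) (auto simp: dpolys_iff keys_plus_monom)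
  moreover have "1 \<in> dpolys m C V" using dpolys_single[of 1 C 0 V m] is_subringD(1)[OF C] by simp
  ultimately show ?thesis using sub by (auto simp: is_subring_def)
qed

lemma dconst_dpolys: "c \<in> C \<Longrightarrow> dconst c \<in> dpolys m C V"
  unfolding dconst_def by (rule dpolys_single) auto

lemma dvar_dpolys: "is_subring C \<Longrightarrow> fst z \<in> V \<Longrightarrow> kys (snd z) \<subseteq> {..<m} \<Longrightarrow> dvar z \<in> dpolys m C V"
  unfolding dvar_def by (rule dpolys_single) (auto intro: is_subringD)

text \<open>Brings the polynomial ring into the form required by \<open>diff_generated\<close>:
  constants as coefficient ring, variables as the family of derivatives.\<close>

lemma dpolys_rgen:
  fixes V :: "'v set"
  assumes C: "is_subring C"
  shows "dpolys m C V = rgen (dconst ` C \<union> dvar ` {z. fst z \<in> V \<and> kys (snd z) \<subseteq> {..<m}})" (is "_ = rgen ?A")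
proof
  show "rgen ?A \<subseteq> dpolys m C V"
    using dconst_dpolys dvar_dpolys[OF C] by (intro rgen_least subring_dpolys[OF C]) auto
  show "dpolys m C V \<subseteq> rgen ?A"
  proof
    fix p :: "('v, 'a) dpoly" assume p: "p \<in> dpolys m C V"
    have mon: "sgl s 1 \<in> rgen ?A" if "\<forall>z\<in>kys s. fst z \<in> V \<and> kys (snd z) \<subseteq> {..<m}" for s
      using that
    proof (induction s rule: monom_induct)
      case zero
      then show ?case using rgen.one[of ?A] by simp
    next
      case (add s x)
      have "sgl (s + sgl x 1) (1::'a) = sgl s 1 * dvar x" by (simp add: dvar_def mult_single)
      moreover have "dvar x \<in> rgen ?A" using add(2) by (intro rgen.base) (auto simp: keys_plus_monom)
      moreover have "sgl s 1 \<in> rgen ?A" using add by (auto simp: keys_plus_monom)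
      ultimately show ?case by (simp add: rgen.mult)
    qed
    have "sgl t (lkp p t) \<in> rgen ?A" if "t \<in> kys p" for t
    proof -
      have "sgl t (lkp p t) = dconst (lkp p t) * sgl t 1" by (simp add: dconst_def mult_single)
      moreover have "dconst (lkp p t) \<in> rgen ?A" using p that by (intro rgen.base) (auto simp: dpolys_iff)
      ultimately show ?thesis using mon[of t] p that by (auto simp: dpolys_iff intro: rgen.mult)
    qed
    then have "(\<Sum>t\<in>kys p. sgl t (lkp p t)) \<in> rgen ?A" by (intro subring_sum[OF subring_rgen])
    then show "p \<in> rgen ?A" using sum_singles[of p] by simp
  qed
qed

section \<open>The derivations of the ring of differential polynomials\<close>

definition mono_deriv :: "nat \<Rightarrow> (('v \<times> (nat \<Rightarrow>\<^sub>0 nat)) \<Rightarrow>\<^sub>0 nat) \<Rightarrow> ('v, 'a::comm_ring_1) dpoly" where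
  "mono_deriv j s = (\<Sum>x\<in>kys s. sgl (s - sgl x 1 + sgl (fst x, snd x + sgl j 1) 1) (of_nat (lkp s x)))"

definition dpoly_deriv :: "('a::comm_ring_1 \<Rightarrow> 'a) \<Rightarrow> nat \<Rightarrow> ('v, 'a) dpoly \<Rightarrow> ('v, 'a) dpoly" where
  "dpoly_deriv d j p = (\<Sum>t\<in>kys p. sgl t (d (lkp p t)) + dconst (lkp p t) * mono_deriv j t)"

lemma mono_deriv_superset:
  assumes "finite W" "kys s \<subseteq> W"
  shows "mono_deriv j s = (\<Sum>x\<in>W. sgl (s - sgl x 1 + sgl (fst x, snd x + sgl j 1) 1) (of_nat (lkp s x)))"
  unfolding mono_deriv_def using assms by (intro sum.mono_neutral_left) (auto simp: in_keys_iff)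

text \<open>Product rule for monomials. The subtraction \<open>s - sgl x 1\<close> is truncated, so
  it means division by \<open>x\<close> only if \<open>x\<close> occurs in \<open>s\<close>;
  otherwise the coefficient \<open>of_nat (lkp s x)\<close> is zero and the term disappears.\<close>

lemma mono_deriv_add: "mono_deriv j (s + t) = mono_deriv j s * sgl t 1 + sgl s 1 * (mono_deriv j t :: ('v, 'a::comm_ring_1) dpoly)"
proof -
  let ?W = "kys s \<union> kys t"
  let ?x = "\<lambda>x :: 'v \<times> (nat \<Rightarrow>\<^sub>0 nat). sgl (fst x, snd x + sgl j 1) (1::nat)"
  have half: "sgl (s + t - sgl x 1 + ?x x) (of_nat (lkp s x) :: 'a) = sgl (s - sgl x 1 + ?x x) (of_nat (lkp s x)) * sgl t 1"
    for s t :: "('v \<times> (nat \<Rightarrow>\<^sub>0 nat)) \<Rightarrow>\<^sub>0 nat" and x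
  proof (cases "lkp s x = 0")
    case False
    have "s + t - sgl x 1 = (s - sgl x 1) + t"
      using False by (intro poly_mapping_eqI) (auto simp: lookup_add lookup_minus lookup_single when_def)
    then have "s + t - sgl x 1 + ?x x = (s - sgl x 1 + ?x x) + t" by (simp add: ac_simps)
    then show ?thesis by (simp add: mult_single)
  qed simp
  have "(mono_deriv j (s + t) :: ('v, 'a) dpoly) = (\<Sum>x\<in>?W. sgl (s + t - sgl x 1 + ?x x) (of_nat (lkp s x)) + sgl (t + s - sgl x 1 + ?x x) (of_nat (lkp t x)))"
    by (simp add: mono_deriv_superset[of ?W] keys_plus_monom lookup_add single_add add.commute)
  also have "\<dots> = mono_deriv j s * sgl t 1 + mono_deriv j t * sgl s 1"
  proof -
    have 1: "(\<Sum>x\<in>?W. sgl (s + t - sgl x 1 + ?x x) (of_nat (lkp s x) :: 'a)) = mono_deriv j s * sgl t 1"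
      unfolding mono_deriv_superset[of ?W s, OF finite_Un[THEN iffD2] Un_upper1, OF conjI, OF finite_keys finite_keys] sum_distrib_right
      by (rule sum.cong[OF refl half])
    have 2: "(\<Sum>x\<in>?W. sgl (t + s - sgl x 1 + ?x x) (of_nat (lkp t x) :: 'a)) = mono_deriv j t * sgl s 1"
      unfolding mono_deriv_superset[of ?W t, OF finite_Un[THEN iffD2] Un_upper2, OF conjI, OF finite_keys finite_keys] sum_distrib_right
      by (rule sum.cong[OF refl half])
    show ?thesis unfolding sum.distrib 1 2 ..
  qed
  finally show ?thesis by (simp add: mult.commute)
qed

lemma mono_deriv_0 [simp]: "mono_deriv j 0 = 0"
  by (simp add: mono_deriv_def)

lemma mono_deriv_single: "mono_deriv j (sgl x 1) = dvar (fst x, snd x + sgl j 1)"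
  by (simp add: mono_deriv_def dvar_def)

context
  fixes d :: "'a::comm_ring_1 \<Rightarrow> 'a" and j :: nat
  assumes d: "is_derivation UNIV d"
begin

lemma d_simps: "d (x + y) = d x + d y" "d (x * y) = d x * y + x * d y" "d 0 = 0" "d 1 = 0"
proof -
  have U: "is_subring (UNIV :: 'a set)" by (simp add: is_subring_def)
  show "d (x + y) = d x + d y" "d (x * y) = d x * y + x * d y" using d by (auto simp: is_derivation_def)
  show "d 0 = 0" "d 1 = 0" using derivation_zero[OF d U] derivation_one[OF d U] by auto
qed

lemma d_sum: "d (sum f I) = (\<Sum>i\<in>I. d (f i))"
  by (induction I rule: infinite_finite_induct) (auto simp: d_simps)

abbreviation "term_deriv t c \<equiv> sgl t (d c) + dconst c * mono_deriv j t"

lemma term_deriv_add: "term_deriv t (b + c) = term_deriv t b + term_deriv t c"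
  by (simp add: d_simps single_add dconst_def algebra_simps)

lemma dpoly_deriv_superset:
  assumes "finite W" "kys p \<subseteq> W"
  shows "dpoly_deriv d j p = (\<Sum>t\<in>W. term_deriv t (lkp p t))"
  unfolding dpoly_deriv_def using assms
  by (intro sum.mono_neutral_left) (auto simp: in_keys_iff d_simps dconst_def)

lemma dpoly_deriv_add: "dpoly_deriv d j (p + q) = dpoly_deriv d j p + dpoly_deriv d j q"
proof -
  have W: "finite (kys p \<union> kys q)" "kys p \<subseteq> kys p \<union> kys q" "kys q \<subseteq> kys p \<union> kys q" "kys (p + q) \<subseteq> kys p \<union> kys q"
    using keys_add[of p q] by auto
  show ?thesis
    unfolding dpoly_deriv_superset[OF W(1,2)] dpoly_deriv_superset[OF W(1,3)] dpoly_deriv_superset[OF W(1,4)]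
      lookup_add term_deriv_add sum.distrib ..
qed

lemma dpoly_deriv_0: "dpoly_deriv d j 0 = 0"
  by (simp add: dpoly_deriv_def)

lemma dpoly_deriv_sum: "dpoly_deriv d j (sum f I) = (\<Sum>i\<in>I. dpoly_deriv d j (f i))"
  by (induction I rule: infinite_finite_induct) (auto simp: dpoly_deriv_add dpoly_deriv_0)

lemma dpoly_deriv_single: "dpoly_deriv d j (sgl t c) = term_deriv t c"
  by (cases "c = 0") (auto simp: dpoly_deriv_def d_simps dconst_def)

lemma dpoly_deriv_dconst: "dpoly_deriv d j (dconst c) = dconst (d c)"
  by (simp add: dconst_def dpoly_deriv_single)

lemma dpoly_deriv_dvar: "dpoly_deriv d j (dvar x) = dvar (fst x, snd x + sgl j 1)"
  by (simp add: dvar_def[of x] dpoly_deriv_single d_simps mono_deriv_single[simplified]) (simp add: dconst_def)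

lemma dpoly_deriv_mult: "dpoly_deriv d j (p * q) = dpoly_deriv d j p * q + p * dpoly_deriv d j q"
proof -
  have mon: "term_deriv (s + t) (b * c) = term_deriv s b * sgl t c + sgl s b * term_deriv t c" for s t b c
  proof -
    have 1: "sgl t c = dconst c * sgl t 1" "sgl s b = dconst b * sgl s 1" "dconst (b * c) = dconst b * dconst c"
      by (simp_all add: dconst_def mult_single)
    have "sgl (s + t) (d (b * c)) = sgl s (d b) * sgl t c + sgl s b * sgl t (d c)"
      by (simp add: d_simps mult_single single_add)
    moreover have "dconst (b * c) * mono_deriv j (s + t) = dconst b * mono_deriv j s * sgl t c + sgl s b * (dconst c * mono_deriv j t)"
      unfolding mono_deriv_add 1 by (simp add: algebra_simps)
    ultimately show ?thesis by (simp add: algebra_simps)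
  qed
  have "dpoly_deriv d j (p * q) = (\<Sum>s\<in>kys p. \<Sum>t\<in>kys q. term_deriv (s + t) (lkp p s * lkp q t))"
    unfolding dpoly_mult_singles[of p q] by (simp add: dpoly_deriv_sum dpoly_deriv_single)
  also have "\<dots> = (\<Sum>s\<in>kys p. \<Sum>t\<in>kys q. term_deriv s (lkp p s) * sgl t (lkp q t)) + (\<Sum>s\<in>kys p. \<Sum>t\<in>kys q. sgl s (lkp p s) * term_deriv t (lkp q t))"
    unfolding mon sum.distrib ..
  also have "\<dots> = dpoly_deriv d j p * (\<Sum>t\<in>kys q. sgl t (lkp q t)) + (\<Sum>s\<in>kys p. sgl s (lkp p s)) * dpoly_deriv d j q"
    unfolding sum_product dpoly_deriv_def ..
  finally show ?thesis using sum_singles[of p] sum_singles[of q] by simp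
qed

lemma derivation_dpoly_deriv:
  fixes V :: "'v set"
  assumes C: "is_subring C" "d ` C \<subseteq> C" and j: "j < m"
  shows "is_derivation (dpolys m C V) (dpoly_deriv d j)"
proof -
  have "dpoly_deriv d j p \<in> dpolys m C V" if p: "p \<in> dpolys m C V" for p :: "('v, 'a) dpoly"
    unfolding dpoly_deriv_def mono_deriv_def
  proof (intro subring_sum[OF subring_dpolys[OF C(1)]] is_subringD(4,6)[OF subring_dpolys[OF C(1)]] dconst_dpolys)
    fix t assume t: "t \<in> kys p"
    then have tt: "\<And>z. z \<in> kys t \<Longrightarrow> fst z \<in> V \<and> kys (snd z) \<subseteq> {..<m}" and c: "lkp p t \<in> C"
      using p by (auto simp: dpolys_iff)
    show "sgl t (d (lkp p t)) \<in> dpolys m C V" using c C(2) tt by (intro dpolys_single) auto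
    show "lkp p t \<in> C" by (rule c)
    fix x assume x: "x \<in> kys t"
    show "sgl (t - sgl x 1 + sgl (fst x, snd x + sgl j 1) 1) (of_nat (lkp t x)) \<in> dpolys m C V"
    proof (rule dpolys_single[OF subring_of_nat[OF C(1)]])
      fix z assume z: "z \<in> kys (t - sgl x 1 + sgl (fst x, snd x + sgl j 1) 1)"
      then have "z \<in> kys t \<or> z = (fst x, snd x + sgl j 1)"
        unfolding keys_plus_monom by (auto simp: in_keys_iff lookup_minus)
      then show "fst z \<in> V \<and> kys (snd z) \<subseteq> {..<m}"
        using tt[of z] tt[OF x] j by (auto simp: keys_plus_nat)
    qed
  qed
  then show ?thesis unfolding is_derivation_def using dpoly_deriv_add dpoly_deriv_mult by blast
qed

end

text \<open>With this, evaluation is a homomorphism of differential rings, so its kernel is a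
  differential ideal; kernels at \<open>c\<close> and at its specialisations are the ideals to which
  \<open>ritt\<close> is applied.\<close>

lemma dpoly_eval_deriv:
  assumes der: "\<And>d. d \<in> set ds \<Longrightarrow> is_derivation UNIV d"
    and comm: "\<And>d d' x. d \<in> set ds \<Longrightarrow> d' \<in> set ds \<Longrightarrow> d (d' x) = d' (d x)" and j: "j < length ds"
  shows "dpoly_eval ds a (dpoly_deriv (ds ! j) j p) = (ds ! j) (dpoly_eval ds a p)"
proof -
  let ?d = "ds ! j"
  have d: "is_derivation UNIV ?d" using der j by simp
  note ds = d_simps[OF d]
  have dop: "derivative_op ds (e + sgl j 1) x = ?d (derivative_op ds e x)" for e x
  proof (rule derivative_op_add_single)
    fix d d' x assume "d \<in> set ds" "d' \<in> set ds"
    then show "d (d' x) = d' (d x)" by (rule comm)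
  qed (rule j)
  note dop = dop dop[simplified]
  have m: "?d (mono_eval ds a s) = dpoly_eval ds a (mono_deriv j s)" for s
  proof (induction s rule: monom_induct)
    case zero
    then show ?case by (simp add: ds)
  next
    case (add s x)
    have "?d (mono_eval ds a (sgl x 1)) = dpoly_eval ds a (mono_deriv j (sgl x 1))"
      unfolding mono_eval_single mono_deriv_single by (simp add: dop)
    then show ?case using add
      by (simp add: mono_eval_add ds mono_deriv_add dpoly_eval_add dpoly_eval_mult dpoly_eval_single algebra_simps)
  qed
  have "dpoly_eval ds a (dpoly_deriv ?d j p) = (\<Sum>t\<in>kys p. ?d (lkp p t * mono_eval ds a t))"
    unfolding dpoly_deriv_def dpoly_eval_sum dpoly_eval_add dpoly_eval_mult dpoly_eval_single
    by (intro sum.cong refl) (simp add: ds m)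
  then show ?thesis by (simp add: dpoly_eval_mono d_sum[OF d])
qed

section \<open>Prime differential ideals\<close>

lemma derivation_power:
  fixes d :: "'a::comm_ring_1 \<Rightarrow> 'a"
  assumes d: "is_derivation UNIV d"
  shows "d (x ^ Suc n) = of_nat (Suc n) * x ^ n * d x"
proof (induction n)
  case (Suc n)
  have "d (x ^ Suc (Suc n)) = d x * x ^ Suc n + x * d (x ^ Suc n)"
    by (simp only: power_Suc[of x "Suc n"] d_simps[OF d])
  also have "\<dots> = of_nat (Suc (Suc n)) * x ^ Suc n * d x"
    unfolding Suc by (simp add: algebra_simps)
  finally show ?case .
qed simp

definition radical_in :: "'a::comm_ring_1 set \<Rightarrow> 'a set \<Rightarrow> 'a set" where
  "radical_in S I = {x \<in> S. \<exists>n. x ^ n \<in> I}"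

lemma ideal_radical:
  assumes S: "is_subring S" and I: "ideal_in S I"
  shows "ideal_in S (radical_in S I)"
  unfolding ideal_in_def
proof (intro conjI ballI)
  show "radical_in S I \<subseteq> S" by (auto simp: radical_in_def)
  show "0 \<in> radical_in S I"
    using is_subringD(2)[OF S] ideal_inD(2)[OF I] by (auto simp: radical_in_def intro!: exI[of _ 1])
next
  fix x y assume "x \<in> radical_in S I" "y \<in> radical_in S I"
  then obtain n m where nm: "x \<in> S" "y \<in> S" "x ^ n \<in> I" "y ^ m \<in> I" by (auto simp: radical_in_def)
  have "of_nat (n + m choose i) * x ^ i * y ^ (n + m - i) \<in> I" for i
  proof (cases "n \<le> i")
    case True
    then have "x ^ i = x ^ (i - n) * x ^ n" by (simp add: power_add[symmetric])
    then have eq: "of_nat (n + m choose i) * x ^ i * y ^ (n + m - i)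
      = (of_nat (n + m choose i) * x ^ (i - n) * y ^ (n + m - i)) * x ^ n" by (simp add: mult_ac)
    show ?thesis unfolding eq using nm(1,2)
      by (intro ideal_inD(4)[OF I _ nm(3)] is_subringD(4)[OF S] subring_of_nat[OF S] subring_power[OF S])
  next
    case False
    then have "y ^ (n + m - i) = y ^ (n - i) * y ^ m" by (simp add: power_add[symmetric])
    then have eq: "of_nat (n + m choose i) * x ^ i * y ^ (n + m - i)
      = (of_nat (n + m choose i) * x ^ i * y ^ (n - i)) * y ^ m" by (simp add: mult_ac)
    show ?thesis unfolding eq using nm(1,2)
      by (intro ideal_inD(4)[OF I _ nm(4)] is_subringD(4)[OF S] subring_of_nat[OF S] subring_power[OF S])
  qed
  then have "(x + y) ^ (n + m) \<in> I" unfolding binomial_ring by (intro ideal_in_sum[OF I])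
  then show "x + y \<in> radical_in S I" using is_subringD(6)[OF S nm(1,2)] by (auto simp: radical_in_def)
next
  fix r x assume r: "r \<in> S" and "x \<in> radical_in S I"
  then obtain n where "x \<in> S" "x ^ n \<in> I" by (auto simp: radical_in_def)
  moreover from this r have "(r * x) ^ n \<in> I"
    unfolding power_mult_distrib by (intro ideal_inD(4)[OF I] subring_power[OF S])
  ultimately show "r * x \<in> radical_in S I" using is_subringD(4)[OF S r] by (auto simp: radical_in_def)
qed

text \<open>With \<open>y = d x\<close>, the proof passes from \<open>x ^ n \<in> I\<close> to
  \<open>x ^ (n - j) * y ^ (2 * j) \<in> I\<close> by induction on \<open>j\<close>. Differentiating
  lowers the exponent of \<open>x\<close>, the factor \<open>y\<close> supplied afterwards makes the
  other term a multiple of the previous element, and \<open>char0\<close> cancels the integer. At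
  \<open>j = n\<close> only a power of \<open>y\<close> is left.\<close>

lemma radical_deriv:
  fixes d :: "'a::comm_ring_1 \<Rightarrow> 'a"
  assumes S: "is_subring S" and I: "ideal_in S I" and d: "is_derivation UNIV d" "d ` S \<subseteq> S" "d ` I \<subseteq> I"
    and char0: "\<And>n s. s \<in> S \<Longrightarrow> of_nat (Suc n) * s \<in> I \<Longrightarrow> s \<in> I"
  shows "d ` radical_in S I \<subseteq> radical_in S I"
proof
  fix y assume "y \<in> d ` radical_in S I"
  then obtain x n where x: "y = d x" "x \<in> S" "x ^ n \<in> I" by (auto simp: radical_in_def)
  have y: "y \<in> S" using x d(2) by auto
  have dy: "d y \<in> S" using y d(2) by auto
  have "x ^ (n - j) * y ^ (2 * j) \<in> I" if "j \<le> n" for j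
    using that
  proof (induction j)
    case 0
    then show ?case using x by simp
  next
    case (Suc j)
    define m where "m = n - Suc j"
    have nj: "n - j = Suc m" using Suc(2) by (simp add: m_def)
    have IH: "x ^ Suc m * y ^ (2 * j) \<in> I" using Suc nj by simp
    have "d (x ^ Suc m * y ^ (2 * j)) * y = of_nat (Suc m) * (x ^ m * y ^ (2 * Suc j)) + x ^ Suc m * d (y ^ (2 * j)) * y"
      by (simp add: d_simps(2)[OF d(1)] derivation_power[OF d(1)] x(1)[symmetric] algebra_simps power_add del: of_nat_Suc power_Suc)
         (simp add: algebra_simps)
    also have "x ^ Suc m * d (y ^ (2 * j)) * y = of_nat (2 * j) * d y * (x ^ Suc m * y ^ (2 * j))"
    proof (cases j)
      case 0
      then show ?thesis using d_simps(4)[OF d(1)] by simp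
    next
      case (Suc i)
      have "d (y ^ (2 * j)) = of_nat (2 * j) * y ^ (2 * j - 1) * d y"
        using derivation_power[OF d(1), of y "2 * j - 1"] Suc by simp
      moreover have "y ^ (2 * j - 1) * y = y ^ (2 * j)" using Suc by (simp add: power_Suc2[symmetric])
      moreover have "x ^ Suc m * (of_nat (2 * j) * y ^ (2 * j - 1) * d y) * y
        = of_nat (2 * j) * d y * (x ^ Suc m * (y ^ (2 * j - 1) * y))" by (simp only: mult_ac)
      ultimately show ?thesis by (simp only:)
    qed
    finally have eq: "of_nat (Suc m) * (x ^ m * y ^ (2 * Suc j)) =
      d (x ^ Suc m * y ^ (2 * j)) * y - of_nat (2 * j) * d y * (x ^ Suc m * y ^ (2 * j))" by simp
    have "d (x ^ Suc m * y ^ (2 * j)) \<in> I" using IH d(3) by auto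
    then have "of_nat (Suc m) * (x ^ m * y ^ (2 * Suc j)) \<in> I" unfolding eq
      by (rule ideal_in_neg(2)[OF S I ideal_inD(5)[OF I y] ideal_inD(4)[OF I is_subringD(4)[OF S subring_of_nat[OF S] dy] IH]])
    then have "x ^ m * y ^ (2 * Suc j) \<in> I"
      by (rule char0[OF is_subringD(4)[OF S subring_power[OF S x(2)] subring_power[OF S y]]])
    then show ?case by (simp add: m_def)
  qed
  from this[of n] have "y ^ (2 * n) \<in> I" by simp
  then show "y \<in> radical_in S I" using y by (auto simp: radical_in_def)
qed

text \<open>A differential ideal maximal among those disjoint from \<open>T\<close> is radical by
  \<open>radical_deriv\<close>. For a radical differential ideal the colon ideals by single elements
  are again differential, and maximality applied to two of them gives primality.\<close>

theorem prime_differential_ideal_avoiding: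
  fixes S T :: "'a::comm_ring_1 set" and ds :: "('a \<Rightarrow> 'a) list"
  assumes S: "is_subring S" and der: "\<And>d. d \<in> set ds \<Longrightarrow> is_derivation UNIV d \<and> d ` S \<subseteq> S"
    and char0: "\<And>n. \<exists>u\<in>S. u * of_nat (Suc n) = 1"
    and T: "T \<subseteq> S" "1 \<in> T" "\<And>x y. x \<in> T \<Longrightarrow> y \<in> T \<Longrightarrow> x * y \<in> T" "0 \<notin> T"
  shows "\<exists>P. prime_ideal_in S P \<and> (\<forall>d\<in>set ds. d ` P \<subseteq> P) \<and> P \<inter> T = {}"
proof -
  define F where "F = {I. ideal_in S I \<and> (\<forall>d\<in>set ds. d ` I \<subseteq> I) \<and> I \<inter> T = {}}"
  have ch: "s \<in> I" if "ideal_in S I" "s \<in> S" "of_nat (Suc n) * s \<in> I" for I n s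
  proof -
    obtain u where u: "u \<in> S" "u * of_nat (Suc n) = 1" using char0 by blast
    have "u * (of_nat (Suc n) * s) \<in> I" by (rule ideal_inD(4)[OF that(1) u(1) that(3)])
    moreover have "u * (of_nat (Suc n) * s) = s" using u(2) by (simp only: mult.assoc[symmetric] mult_1)
    ultimately show ?thesis by simp
  qed
  have "\<exists>M\<in>F. \<forall>X\<in>F. M \<subseteq> X \<longrightarrow> X = M"
  proof (rule subset_Zorn_nonempty)
    have "{0} \<in> F" unfolding F_def ideal_in_def
      using is_subringD(2)[OF S] T(4) der d_simps(3) by auto
    then show "F \<noteq> {}" by blast
    fix \<C> assume ne: "\<C> \<noteq> {}" and ch: "subset.chain F \<C>"
    have CF: "\<And>I. I \<in> \<C> \<Longrightarrow> I \<in> F" using ch by (auto simp: subset.chain_def)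
    have lin: "I \<subseteq> J \<or> J \<subseteq> I" if "I \<in> \<C>" "J \<in> \<C>" for I J
      using ch that by (auto simp: subset.chain_def)
    have CI: "ideal_in S I" if "I \<in> \<C>" for I using CF[OF that] by (simp add: F_def)
    have "ideal_in S (\<Union>\<C>)" unfolding ideal_in_def
    proof (intro conjI ballI)
      show "\<Union>\<C> \<subseteq> S" using ideal_inD(1)[OF CI] by blast
      show "0 \<in> \<Union>\<C>" using ideal_inD(2)[OF CI] ne by blast
    next
      fix x y assume "x \<in> \<Union>\<C>" "y \<in> \<Union>\<C>"
      then obtain I J where IJ: "I \<in> \<C>" "x \<in> I" "J \<in> \<C>" "y \<in> J" by blast
      have "\<exists>L\<in>\<C>. x \<in> L \<and> y \<in> L" using lin[OF IJ(1,3)] IJ by blast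
      then obtain L where L: "L \<in> \<C>" "x \<in> L" "y \<in> L" by blast
      then show "x + y \<in> \<Union>\<C>" using ideal_inD(3)[OF CI[OF L(1)] L(2,3)] by blast
    next
      fix r x assume r: "r \<in> S" and "x \<in> \<Union>\<C>"
      then obtain L where L: "L \<in> \<C>" "x \<in> L" by blast
      then show "r * x \<in> \<Union>\<C>" using ideal_inD(4)[OF CI[OF L(1)] r L(2)] by blast
    qed
    moreover have "\<forall>d\<in>set ds. d ` \<Union>\<C> \<subseteq> \<Union>\<C>" using CF unfolding F_def by blast
    moreover have "\<Union>\<C> \<inter> T = {}" using CF unfolding F_def by blast
    ultimately show "\<Union>\<C> \<in> F" by (simp add: F_def)
  qed
  then obtain P where P: "P \<in> F" and max: "\<And>X. X \<in> F \<Longrightarrow> P \<subseteq> X \<Longrightarrow> X = P" by blast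
  have I: "ideal_in S P" and dP: "\<And>d. d \<in> set ds \<Longrightarrow> d ` P \<subseteq> P" and PT: "P \<inter> T = {}"
    using P by (auto simp: F_def)
  have Tpow: "x ^ n \<in> T" if "x \<in> T" for x n using that T(2,3) by (induction n) auto
  have "d ` radical_in S P \<subseteq> radical_in S P" if d: "d \<in> set ds" for d
    by (rule radical_deriv[OF S I conjunct1[OF der[OF d]] conjunct2[OF der[OF d]] dP[OF d]]) (rule ch[OF I])
  moreover have "radical_in S P \<inter> T = {}" using Tpow PT unfolding radical_in_def by blast
  ultimately have "radical_in S P \<in> F" using ideal_radical[OF S I] unfolding F_def by blast
  moreover have "P \<subseteq> radical_in S P" using ideal_inD(1)[OF I] by (auto simp: radical_in_def intro!: exI[of _ 1])
  ultimately have rad: "radical_in S P = P" by (rule max)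
  have rad2: "x \<in> P" if "x \<in> S" "x ^ 2 \<in> P" for x using that rad by (auto simp: radical_in_def)
  have colon: "{x \<in> S. x * a \<in> P} \<inter> T \<noteq> {}" if a: "a \<in> S" and b: "b \<in> S" "b * a \<in> P" "b \<notin> P" for a b
  proof (rule ccontr)
    let ?Q = "{x \<in> S. x * a \<in> P}"
    assume *: "\<not> ?Q \<inter> T \<noteq> {}"
    have "ideal_in S ?Q" unfolding ideal_in_def
    proof (intro conjI ballI)
      show "0 \<in> ?Q" using is_subringD(2)[OF S] ideal_inD(2)[OF I] by simp
      show "x + y \<in> ?Q" if "x \<in> ?Q" "y \<in> ?Q" for x y
        using that is_subringD(6)[OF S] ideal_inD(3)[OF I] by (simp add: distrib_right)
      show "r * x \<in> ?Q" if "r \<in> S" "x \<in> ?Q" for r x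
        using that is_subringD(4)[OF S] ideal_inD(4)[OF I] by (simp add: mult.assoc)
    qed auto
    moreover have "d ` ?Q \<subseteq> ?Q" if d: "d \<in> set ds" for d
    proof
      fix y assume "y \<in> d ` ?Q"
      then obtain x where x: "y = d x" "x \<in> S" "x * a \<in> P" by auto
      have y: "y \<in> S" and da: "d a \<in> S" using der[OF d] x a by auto
      have "d (x * a) \<in> P" using x dP[OF d] by blast
      \<comment> \<open>The derivative of \<open>x * a\<close> is multiplied by
        \<open>d x * a\<close>; the mixed term contains the factor \<open>x * a\<close>, so the
        square of \<open>d x * a\<close> lies in \<open>P\<close>, and \<open>P\<close> is
        radical.\<close>
      then have "(y * a + x * d a) * (y * a) \<in> P"
        unfolding d_simps(2)[OF conjunct1[OF der[OF d]]] x(1)[symmetric]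
        by (rule ideal_inD(5)[OF I is_subringD(4)[OF S y a]])
      moreover have "(x * a) * (d a * y) \<in> P" by (rule ideal_inD(5)[OF I is_subringD(4)[OF S da y] x(3)])
      ultimately have "(y * a + x * d a) * (y * a) - (x * a) * (d a * y) \<in> P" by (rule ideal_in_neg(2)[OF S I])
      moreover have "(y * a + x * d a) * (y * a) - (x * a) * (d a * y) = (y * a) ^ 2"
        by (simp add: algebra_simps power2_eq_square)
      ultimately have "y * a \<in> P" using rad2[of "y * a"] is_subringD(4)[OF S y a] by simp
      then show "y \<in> ?Q" using y by simp
    qed
    ultimately have "?Q \<in> F" using * by (auto simp: F_def)
    moreover have "P \<subseteq> ?Q" using ideal_inD(1,5)[OF I] a by auto
    ultimately have "?Q = P" by (rule max)
    then show False using b by blast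
  qed
  have "prime_ideal_in S P"
  proof
    show "is_subring S" "ideal_in S P" by fact+
    show "1 \<notin> P" using PT T(2) by blast
    fix x y assume xy: "x \<in> S" "y \<in> S" "x * y \<in> P"
    show "x \<in> P \<or> y \<in> P"
    proof (rule ccontr)
      assume n: "\<not> (x \<in> P \<or> y \<in> P)"
      \<comment> \<open>The colon ideal of \<open>y\<close> contains \<open>x\<close>, which is not
        in \<open>P\<close>, so it meets \<open>T\<close> in some \<open>t\<close>. The colon ideal
        of \<open>t\<close> then contains \<open>y\<close>, so it meets \<open>T\<close> in some
        \<open>s\<close>, and \<open>s * t\<close> lies in both \<open>T\<close> and
        \<open>P\<close>.\<close>
      obtain t where t: "t \<in> T" "t * y \<in> P" using colon[OF xy(2,1,3)] n by blast
      then have "y * t \<in> P" by (simp add: mult.commute)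
      moreover have "t \<in> S" using t(1) T(1) by blast
      ultimately obtain s where "s \<in> T" "s * t \<in> P" using colon[of t y] n xy(2) by blast
      then show False using T(3)[OF _ t(1)] PT by blast
    qed
  qed
  then show ?thesis using dP PT by blast
qed

section \<open>Linear independence over a subfield\<close>

definition lin_indep :: "'a::comm_ring_1 set \<Rightarrow> 'a set \<Rightarrow> bool" where
  "lin_indep C X \<longleftrightarrow> (\<forall>c. (\<forall>x\<in>X. c x \<in> C) \<longrightarrow> (\<Sum>x\<in>X. c x * x) = 0 \<longrightarrow> (\<forall>x\<in>X. c x = 0))"

definition is_subfield :: "'a::comm_ring_1 set \<Rightarrow> bool" where
  "is_subfield C \<longleftrightarrow> is_subring C \<and> (\<forall>x\<in>C. x \<noteq> 0 \<longrightarrow> (\<exists>y\<in>C. x * y = 1))"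

lemma basis_exists:
  assumes C: "is_subfield C" and "finite W"
  shows "\<exists>X\<subseteq>W. lin_indep C X \<and> (\<forall>w\<in>W. \<exists>c. (\<forall>x\<in>X. c x \<in> C) \<and> w = (\<Sum>x\<in>X. c x * x))"
  using assms(2)
proof (induction W rule: finite_induct)
  case empty
  then show ?case by (intro exI[of _ "{}"]) (auto simp: lin_indep_def)
next
  case (insert w W)
  note S = C[unfolded is_subfield_def, THEN conjunct1]
  obtain X where X: "X \<subseteq> W" "lin_indep C X" "\<And>w. w \<in> W \<Longrightarrow> \<exists>c. (\<forall>x\<in>X. c x \<in> C) \<and> w = (\<Sum>x\<in>X. c x * x)"
    using insert(3) by blast
  have fin: "finite X" using X(1) insert(1) finite_subset by blast
  show ?case
  proof (cases "\<exists>c. (\<forall>x\<in>X. c x \<in> C) \<and> w = (\<Sum>x\<in>X. c x * x)")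
    case True
    then show ?thesis using X by (intro exI[of _ X]) auto
  next
    case False
    have wX: "w \<notin> X" using X(1) insert(2) by blast
    have "lin_indep C (insert w X)" unfolding lin_indep_def
    proof (intro allI impI)
      fix c assume c: "\<forall>x\<in>insert w X. c x \<in> C" and z: "(\<Sum>x\<in>insert w X. c x * x) = 0"
      have eq: "c w * w + (\<Sum>x\<in>X. c x * x) = 0" using z fin wX by simp
      have "c w = 0"
      proof (rule ccontr)
        assume "c w \<noteq> 0"
        then obtain y where y: "y \<in> C" "c w * y = 1" using c C by (auto simp: is_subfield_def)
        have "w = y * (c w * w)" using y(2) by (metis mult.assoc mult.commute mult_1)
        also have "\<dots> = (\<Sum>x\<in>X. (- (y * c x)) * x)"
          using eq by (simp add: eq_neg_iff_add_eq_0[symmetric] sum_distrib_left sum_negf mult.assoc)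
        finally have "w = (\<Sum>x\<in>X. (- (y * c x)) * x)" .
        moreover have "\<forall>x\<in>X. - (y * c x) \<in> C" using c y(1) is_subringD(4,5)[OF S] by simp
        ultimately show False using False by (auto dest!: spec[of _ "\<lambda>x. - (y * c x)"])
      qed
      then show "\<forall>x\<in>insert w X. c x = 0" using eq c X(2) by (auto simp: lin_indep_def)
    qed
    moreover have "\<exists>c. (\<forall>x\<in>insert w X. c x \<in> C) \<and> v = (\<Sum>x\<in>insert w X. c x * x)" if "v \<in> insert w W" for v
    proof (cases "v = w")
      case True
      have "(\<Sum>x\<in>X. (if x = w then 1 else 0) * x) = 0" using wX by (intro sum.neutral) auto
      then show ?thesis using True fin wX is_subringD(1,2)[OF S]
        by (intro exI[of _ "\<lambda>x. if x = w then 1 else 0"]) auto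
    next
      case False
      then obtain c where c: "\<forall>x\<in>X. c x \<in> C" "v = (\<Sum>x\<in>X. c x * x)" using X(3) \<open>v \<in> insert w W\<close> by blast
      have "(\<Sum>x\<in>X. (c(w := 0)) x * x) = (\<Sum>x\<in>X. c x * x)" using wX by (intro sum.cong) auto
      then show ?thesis using c fin wX is_subringD(2)[OF S] by (intro exI[of _ "c(w := 0)"]) auto
    qed
    ultimately show ?thesis using X(1) by (intro exI[of _ "insert w X"]) blast
  qed
qed

text \<open>A basis over \<open>C\<close> of the span of the finitely many coefficients is selected
  among the coefficients themselves, so it stays inside \<open>L\<close>; expanding the coefficients
  in this basis groups \<open>p\<close> into polynomials over \<open>C\<close>.\<close>

lemma dpoly_decompose:
  fixes p :: "('v, 'a::comm_ring_1) dpoly"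
  assumes C: "is_subfield C" and p: "p \<in> dpolys m L V"
  shows "\<exists>X f. finite X \<and> X \<subseteq> L \<and> lin_indep C X \<and> (\<forall>x\<in>X. f x \<in> dpolys m C V) \<and>
    p = (\<Sum>x\<in>X. dconst x * f x)"
proof -
  define W where "W = (lkp p) ` kys p"
  have "finite W" by (simp add: W_def)
  from basis_exists[OF C this] obtain X where X: "X \<subseteq> W" "lin_indep C X"
    "\<forall>w\<in>W. \<exists>c. (\<forall>x\<in>X. c x \<in> C) \<and> w = (\<Sum>x\<in>X. c x * x)" by blast
  then obtain c where c: "\<And>w x. w \<in> W \<Longrightarrow> x \<in> X \<Longrightarrow> c w x \<in> C" "\<And>w. w \<in> W \<Longrightarrow> w = (\<Sum>x\<in>X. c w x * x)"
    by metis
  define f where "f x = (\<Sum>t\<in>kys p. sgl t (c (lkp p t) x))" for x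
  have S: "is_subring C" using C by (simp add: is_subfield_def)
  show ?thesis
  proof (intro exI conjI ballI)
    show "finite X" using X(1) \<open>finite W\<close> finite_subset by blast
    show "X \<subseteq> L" using X(1) p by (auto simp: W_def dpolys_iff)
    show "lin_indep C X" by fact
    show "f x \<in> dpolys m C V" if "x \<in> X" for x unfolding f_def
      using p c(1)[OF _ that] by (intro subring_sum[OF subring_dpolys[OF S]] dpolys_single) (auto simp: dpolys_iff W_def)
    have "p = (\<Sum>t\<in>kys p. sgl t (\<Sum>x\<in>X. c (lkp p t) x * x))"
      using c(2) sum_singles[of p] by (simp add: W_def)
    also have "\<dots> = (\<Sum>t\<in>kys p. \<Sum>x\<in>X. dconst x * sgl t (c (lkp p t) x))"
    proof (intro sum.cong refl)
      fix t :: "('v \<times> (nat \<Rightarrow>\<^sub>0 nat)) \<Rightarrow>\<^sub>0 nat"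
      have "sgl t (sum g X) = (\<Sum>x\<in>X. sgl t (g x))" for g :: "'a \<Rightarrow> 'a"
        by (induction X rule: infinite_finite_induct) (auto simp: single_add)
      then show "sgl t (\<Sum>x\<in>X. c (lkp p t) x * x) = (\<Sum>x\<in>X. dconst x * sgl t (c (lkp p t) x))"
        by (simp add: dconst_def mult_single mult.commute)
    qed
    also have "\<dots> = (\<Sum>x\<in>X. dconst x * f x)"
      unfolding f_def sum_distrib_left by (rule sum.swap)
    finally show "p = (\<Sum>x\<in>X. dconst x * f x)" .
  qed
qed

section \<open>Transfer of zeros to a differentially closed field\<close>

text \<open>The field \<open>E\<close> lives on the wrong type for \<^const>\<open>differentially_closed\<close>; it is copied along
  an arbitrary injection into the type of extension carriers.\<close>

definition copy :: "'a::comm_ring_1 \<Rightarrow> 'a ext_carrier" where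
  "copy x = {(sgl 0 x, 0)}"

definition uncopy :: "'a::comm_ring_1 ext_carrier \<Rightarrow> 'a" where
  "uncopy u = lkp (fst (the_elem u)) 0"

lemma uncopy_copy [simp]: "uncopy (copy x) = x"
  by (simp add: uncopy_def copy_def)

lemma copy_eq_iff [simp]: "copy x = copy y \<longleftrightarrow> x = y"
  by (metis uncopy_copy)

definition copy_ring :: "'a::comm_ring_1 set \<Rightarrow> 'a ext_carrier ring" where
  "copy_ring E = \<lparr>carrier = copy ` E, monoid.mult = (\<lambda>u v. copy (uncopy u * uncopy v)), one = copy 1,
     zero = copy 0, add = (\<lambda>u v. copy (uncopy u + uncopy v))\<rparr>"

lemma copy_ring_simps [simp]:
  "carrier (copy_ring E) = copy ` E" "copy x \<otimes>\<^bsub>copy_ring E\<^esub> copy y = copy (x * y)" "\<one>\<^bsub>copy_ring E\<^esub> = copy 1"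
  "\<zero>\<^bsub>copy_ring E\<^esub> = copy 0" "copy x \<oplus>\<^bsub>copy_ring E\<^esub> copy y = copy (x + y)"
  by (auto simp: copy_ring_def)

lemma field_copy_ring:
  assumes E: "is_subfield E" and one: "(1 :: 'a::comm_ring_1) \<noteq> 0"
  shows "Ring.field (copy_ring (E :: 'a set))"
proof -
  note S = is_subringD[OF conjunct1[OF E[unfolded is_subfield_def]]]
  have "cring (copy_ring E)"
  proof (rule cringI)
    show "abelian_group (copy_ring E)"
    proof (rule abelian_groupI)
      fix u assume "u \<in> carrier (copy_ring E)"
      then obtain x where x: "x \<in> E" "u = copy x" by auto
      show "\<exists>v\<in>carrier (copy_ring E). v \<oplus>\<^bsub>copy_ring E\<^esub> u = \<zero>\<^bsub>copy_ring E\<^esub>"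
        using x S(5)[OF x(1)] by (intro bexI[of _ "copy (- x)"]) auto
    qed (use S in \<open>auto simp: algebra_simps\<close>)
    show "comm_monoid (copy_ring E)"
      by (rule comm_monoidI) (use S in \<open>auto simp: algebra_simps\<close>)
  qed (auto simp: algebra_simps)
  then interpret cring "copy_ring E" .
  show ?thesis
  proof (rule cring_fieldI)
    show "Units (copy_ring E) = carrier (copy_ring E) - {\<zero>\<^bsub>copy_ring E\<^esub>}"
    proof
      show "Units (copy_ring E) \<subseteq> carrier (copy_ring E) - {\<zero>\<^bsub>copy_ring E\<^esub>}"
      proof
        fix u assume u: "u \<in> Units (copy_ring E)"
        then obtain v where v: "v \<in> carrier (copy_ring E)" "v \<otimes>\<^bsub>copy_ring E\<^esub> u = \<one>\<^bsub>copy_ring E\<^esub>" "u \<in> carrier (copy_ring E)"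
          by (auto simp: Units_def)
        then obtain x y where "u = copy x" "v = copy y" "y * x = 1" by auto
        then show "u \<in> carrier (copy_ring E) - {\<zero>\<^bsub>copy_ring E\<^esub>}" using v(3) one by auto
      qed
      show "carrier (copy_ring E) - {\<zero>\<^bsub>copy_ring E\<^esub>} \<subseteq> Units (copy_ring E)"
      proof
        fix u assume "u \<in> carrier (copy_ring E) - {\<zero>\<^bsub>copy_ring E\<^esub>}"
        then obtain x where x: "x \<in> E" "u = copy x" "x \<noteq> 0" by auto
        then obtain y where "y \<in> E" "x * y = 1" using E by (auto simp: is_subfield_def)
        then show "u \<in> Units (copy_ring E)" unfolding Units_def using x
          by (auto intro!: bexI[of _ "copy y"] simp: mult.commute)
      qed
    qed
  qed
qed

context
  fixes E :: "'a::comm_ring_1 set"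
  assumes E: "is_subfield E" and one: "(1::'a) \<noteq> 0"
begin

interpretation F: field "copy_ring E" by (rule field_copy_ring[OF E one])

lemma E_subring: "is_subring E" using E by (simp add: is_subfield_def)

lemma copy_nat_pow: "x \<in> E \<Longrightarrow> copy x [^]\<^bsub>copy_ring E\<^esub> (n::nat) = copy (x ^ n)"
  by (induction n) (auto simp: mult.commute)

lemma copy_finprod: "finite I \<Longrightarrow> (\<And>i. i \<in> I \<Longrightarrow> f i \<in> E) \<Longrightarrow> finprod (copy_ring E) (\<lambda>i. copy (f i)) I = copy (prod f I)"
proof (induction I rule: finite_induct)
  case empty
  show ?case by (simp only: F.finprod_empty prod.empty copy_ring_simps)
next
  case (insert i I)
  then have "finprod (copy_ring E) (\<lambda>i. copy (f i)) (insert i I)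
    = copy (f i) \<otimes>\<^bsub>copy_ring E\<^esub> finprod (copy_ring E) (\<lambda>i. copy (f i)) I"
    by (intro F.finprod_insert) auto
  then show ?case using insert by simp
qed

lemma copy_finsum: "finite I \<Longrightarrow> (\<And>i. i \<in> I \<Longrightarrow> f i \<in> E) \<Longrightarrow> finsum (copy_ring E) (\<lambda>i. copy (f i)) I = copy (sum f I)"
proof (induction I rule: finite_induct)
  case empty
  show ?case by (simp only: F.finsum_empty sum.empty copy_ring_simps)
next
  case (insert i I)
  then have "finsum (copy_ring E) (\<lambda>i. copy (f i)) (insert i I)
    = copy (f i) \<oplus>\<^bsub>copy_ring E\<^esub> finsum (copy_ring E) (\<lambda>i. copy (f i)) I"
    by (intro F.finsum_insert) auto
  then show ?case using insert by simp
qed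

lemma copy_derivative_op:
  fixes ds :: "('a \<Rightarrow> 'a) list"
  shows "derivative_op (map (\<lambda>d. copy \<circ> d \<circ> uncopy) ds) e (copy x) = copy (derivative_op ds e x)"
proof -
  let ?ds = "map (\<lambda>d. copy \<circ> d \<circ> uncopy) ds"
  have pow: "((copy \<circ> d \<circ> uncopy) ^^ k) (copy z) = copy ((d ^^ k) z)" for d :: "'a \<Rightarrow> 'a" and k z
    by (induction k) auto
  have "foldr (\<lambda>i f. (?ds ! i ^^ lkp e i) \<circ> f) l id (copy x) = copy (foldr (\<lambda>i f. (ds ! i ^^ lkp e i) \<circ> f) l id x)"
    if "set l \<subseteq> {..<length ds}" for l
    using that
  proof (induction l)
    case (Cons i l)
    then have "?ds ! i = copy \<circ> (ds ! i) \<circ> uncopy" by simp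
    then show ?case using Cons pow[where d = "ds ! i"] by (simp add: comp_def)
  qed simp
  from this[of "[0..<length ds]"] show ?thesis by (simp add: derivative_op_def lessThan_atLeast0)
qed

lemma copy_dpoly_eval:
  assumes ds: "\<And>d. d \<in> set ds \<Longrightarrow> d ` E \<subseteq> E" and a: "\<And>v. a v \<in> E" and CE: "C \<subseteq> E"
    and p: "p \<in> dpolys m C V"
  shows "dpoly_eval_ext (copy_ring E) (map (\<lambda>d. copy \<circ> d \<circ> uncopy) ds) copy (\<lambda>v. copy (a v)) p
    = copy (dpoly_eval ds a p)"
proof -
  have d: "derivative_op ds e (a v) \<in> E" for e v by (rule derivative_op_closed[OF ds a])
  then have dp: "derivative_op ds e (a v) ^ n \<in> E" for e v n by (rule subring_power[OF E_subring])
  have m: "mono_eval ds a t \<in> E" for t unfolding mono_eval_def by (rule subring_prod[OF E_subring dp])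
  have c: "lkp p t * mono_eval ds a t \<in> E" if "t \<in> kys p" for t
    using p that CE m by (intro is_subringD(4)[OF E_subring]) (auto simp: dpolys_iff)
  show ?thesis
    unfolding dpoly_eval_ext_def copy_derivative_op copy_nat_pow[OF d] copy_finprod[OF finite_keys dp] copy_ring_simps
      dpoly_eval_mono mono_eval_def[symmetric] by (rule copy_finsum[OF finite_keys c])
qed

text \<open>A solution in \<open>E\<close> becomes a solution in an isomorphic copy of
  \<open>E\<close>, which is one of the extension fields over which differential closedness
  quantifies.\<close>

theorem existentially_closed:
  assumes cl: "differentially_closed ds C" and CE: "C \<subseteq> E"
    and der: "\<And>d. d \<in> set ds \<Longrightarrow> is_derivation UNIV d" "\<And>d. d \<in> set ds \<Longrightarrow> d ` E \<subseteq> E"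
    and comm: "\<And>d d' x. d \<in> set ds \<Longrightarrow> d' \<in> set ds \<Longrightarrow> d (d' x) = d' (d x)"
    and Ps: "finite Ps" "Ps \<subseteq> dpolys (length ds) C {..<n::nat}" "Q \<in> dpolys (length ds) C {..<n}"
    and a: "\<And>v. a v \<in> E" "\<And>P. P \<in> Ps \<Longrightarrow> dpoly_eval ds a P = 0" "dpoly_eval ds a Q \<noteq> 0"
  shows "\<exists>a. a ` {..<n} \<subseteq> C \<and> (\<forall>P\<in>Ps. dpoly_eval ds a P = 0) \<and> dpoly_eval ds a Q \<noteq> 0"
proof -
  let ?es = "map (\<lambda>d. copy \<circ> d \<circ> uncopy) ds"
  have ext: "pi_field_extension ds C (copy_ring E) ?es copy"
    unfolding pi_field_extension_def
  proof (intro conjI ballI allI impI)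
    show "copy \<in> ring_hom (ring_on C) (copy_ring E)"
      using CE by (intro ring_hom_memI) (auto simp: ring_on_def)
  next
    fix d assume "d \<in> set ?es"
    then obtain d0 where d0: "d0 \<in> set ds" "d = copy \<circ> d0 \<circ> uncopy" by auto
    then show "d ` carrier (copy_ring E) \<subseteq> carrier (copy_ring E)" using der(2)[OF d0(1)] by auto
    fix x y assume "x \<in> carrier (copy_ring E)" "y \<in> carrier (copy_ring E)"
    then obtain x0 y0 where "x = copy x0" "y = copy y0" by auto
    then show "d (x \<oplus>\<^bsub>copy_ring E\<^esub> y) = d x \<oplus>\<^bsub>copy_ring E\<^esub> d y"
      "d (x \<otimes>\<^bsub>copy_ring E\<^esub> y) = (d x \<otimes>\<^bsub>copy_ring E\<^esub> y) \<oplus>\<^bsub>copy_ring E\<^esub> (x \<otimes>\<^bsub>copy_ring E\<^esub> d y)"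
      using d_simps(1,2)[OF der(1)[OF d0(1)]] by (simp_all add: d0(2))
  next
    fix d d' x assume "d \<in> set ?es" "d' \<in> set ?es" "x \<in> carrier (copy_ring E)"
    then show "d (d' x) = d' (d x)" using comm by auto
  qed (use field_copy_ring[OF E one] in auto)
  have PsE: "dpoly_eval_ext (copy_ring E) ?es copy (\<lambda>v. copy (a v)) P = \<zero>\<^bsub>copy_ring E\<^esub>" if "P \<in> Ps" for P
    using copy_dpoly_eval[OF der(2) a(1) CE subsetD[OF Ps(2) that]] a(2)[OF that] by simp
  have QE: "dpoly_eval_ext (copy_ring E) ?es copy (\<lambda>v. copy (a v)) Q \<noteq> \<zero>\<^bsub>copy_ring E\<^esub>"
    using copy_dpoly_eval[OF der(2) a(1) CE Ps(3)] a(3) by simp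
  have "\<exists>(E' :: 'a ext_carrier ring) es h a. pi_field_extension ds C E' es h \<and> a ` {..<n} \<subseteq> carrier E' \<and>
    (\<forall>P\<in>Ps. dpoly_eval_ext E' es h a P = \<zero>\<^bsub>E'\<^esub>) \<and> dpoly_eval_ext E' es h a Q \<noteq> \<zero>\<^bsub>E'\<^esub>"
    using ext PsE QE a(1)
    by (intro exI[of _ "copy_ring E"] exI[of _ ?es] exI[of _ copy] exI[of _ "\<lambda>v. copy (a v)"]) auto
  with Ps have "finite Ps \<and> Ps \<subseteq> dpolys (length ds) C {..<n} \<and> Q \<in> dpolys (length ds) C {..<n} \<and>
    (\<exists>(E' :: 'a ext_carrier ring) es h a. pi_field_extension ds C E' es h \<and> a ` {..<n} \<subseteq> carrier E' \<and>
    (\<forall>P\<in>Ps. dpoly_eval_ext E' es h a P = \<zero>\<^bsub>E'\<^esub>) \<and> dpoly_eval_ext E' es h a Q \<noteq> \<zero>\<^bsub>E'\<^esub>)" by simp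
  with cl[unfolded differentially_closed_def, rule_format, of Ps n Q] show ?thesis .
qed

end

section \<open>The constants of a Picard-Vessiot extension\<close>

locale pv_extension =
  fixes \<Sigma> \<Delta> :: "('a::{comm_ring_1,ring_char_0} \<Rightarrow> 'a) set"
    and ds :: "('a \<Rightarrow> 'a) list"
    and k R C :: "'a set"
    and A B :: "('a \<Rightarrow> 'a) \<Rightarrow> 'a ^ 'n::finite ^ 'n"
    and Z :: "'a ^ 'n ^ 'n"
  assumes K: "sdp_ring \<Sigma> \<Delta> ds (UNIV :: 'a set)"
    and k: "sdp_field \<Sigma> \<Delta> ds k"
    and C_def: "C = sd_constants \<Sigma> \<Delta> k"
    and C_closed: "differentially_closed ds C"
    and system: "sd_linear_system \<Sigma> \<Delta> k A B"
    and R: "pv_ring \<Sigma> \<Delta> ds k A B Z R"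
    and K_quot: "total_quotient_ring_of R"
begin

definition ops :: "('a \<Rightarrow> 'a) set" where "ops = \<Sigma> \<union> \<Delta> \<union> set ds"

definition E :: "'a set" where "E = sd_constants \<Sigma> \<Delta> UNIV"

lemma derU: "d \<in> \<Delta> \<union> set ds \<Longrightarrow> is_derivation UNIV d"
  using K by (simp add: sdp_ring_def)

lemma der_simps:
  assumes "d \<in> \<Delta> \<union> set ds"
  shows "d (x + y) = d x + d y" "d (x * y) = d x * y + x * d y" "d 0 = 0" "d 1 = 0" "d (x - y) = d x - d y"
  using d_simps[OF derU[OF assms]] derivation_minus[OF derU[OF assms], of x y] by (auto simp: is_subring_def)

lemma aut_simps:
  assumes "\<sigma> \<in> \<Sigma>"
  shows "\<sigma> (x + y) = \<sigma> x + \<sigma> y" "\<sigma> (x * y) = \<sigma> x * \<sigma> y" "\<sigma> 1 = 1" "\<sigma> 0 = 0" "\<sigma> (x - y) = \<sigma> x - \<sigma> y"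
proof -
  have "is_automorphism UNIV \<sigma>" using K assms by (simp add: sdp_ring_def)
  then show *: "\<sigma> (x + y) = \<sigma> x + \<sigma> y" and "\<sigma> (x * y) = \<sigma> x * \<sigma> y" "\<sigma> 1 = 1" for x y
    by (auto simp: is_automorphism_def)
  show "\<sigma> 0 = 0" using *[of 0 0] by simp
  show "\<sigma> (x - y) = \<sigma> x - \<sigma> y" using *[of "x - y" y] by simp
qed

lemma comm: "f \<in> ops \<Longrightarrow> g \<in> ops \<Longrightarrow> f (g x) = g (f x)"
  using K by (simp add: sdp_ring_def ops_def)

lemma op_closed:
  assumes "sdp_ring \<Sigma> \<Delta> ds X" "f \<in> ops" "x \<in> X"
  shows "f x \<in> X"
proof (cases "f \<in> \<Sigma>")
  case True
  then have "bij_betw f X X" using assms(1) by (simp add: sdp_ring_def is_automorphism_def)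
  then show ?thesis using assms(3) by (auto simp: bij_betw_def)
next
  case False
  then have "is_derivation X f" using assms(1,2) by (simp add: sdp_ring_def ops_def)
  then show ?thesis using assms(3) by (auto simp: is_derivation_def)
qed

lemma op_add:
  assumes "f \<in> ops" shows "f (x + y) = f x + f y" "f (x - y) = f x - f y" "f 0 = 0"
proof -
  from assms consider "f \<in> \<Sigma>" | "f \<in> \<Delta> \<union> set ds" by (auto simp: ops_def)
  then have "f (x + y) = f x + f y \<and> f (x - y) = f x - f y \<and> f 0 = 0"
    by cases (simp_all add: der_simps aut_simps)
  then show "f (x + y) = f x + f y" "f (x - y) = f x - f y" "f 0 = 0" by auto
qed

lemma op_one: "f \<in> ops \<Longrightarrow> f 1 = 0 \<or> f 1 = 1"
  by (auto simp: ops_def der_simps aut_simps)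

lemma k_ring: "sdp_ring \<Sigma> \<Delta> ds k" "is_subring k" "is_subfield k"
  using k by (simp_all add: sdp_field_def sdp_ring_def is_subfield_def)

lemma R_ring: "sdp_ring \<Sigma> \<Delta> ds R" "is_subring R" "k \<subseteq> R"
proof -
  have "simple_sdp_ring \<Sigma> \<Delta> ds R" and "k \<subseteq> R" using R unfolding pv_ring_def by blast+
  then show "sdp_ring \<Sigma> \<Delta> ds R" "is_subring R" "k \<subseteq> R"
    by (simp_all add: simple_sdp_ring_def sdp_ring_def)
qed

lemma simple: "sdp_ideal \<Sigma> \<Delta> ds R I \<Longrightarrow> 1 \<notin> I \<Longrightarrow> I = {0}"
proof -
  assume I: "sdp_ideal \<Sigma> \<Delta> ds R I" "1 \<notin> I"
  have "simple_sdp_ring \<Sigma> \<Delta> ds R" using R unfolding pv_ring_def by blast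
  then have "I = {0} \<or> I = R" using I(1) unfolding simple_sdp_ring_def by blast
  then show ?thesis using I(2) is_subringD(1)[OF R_ring(2)] by blast
qed

lemma sdp_idealI:
  assumes "ideal_in R I" "\<And>f x. f \<in> ops \<Longrightarrow> x \<in> I \<Longrightarrow> f x \<in> I"
  shows "sdp_ideal \<Sigma> \<Delta> ds R I"
  unfolding sdp_ideal_def
proof (intro conjI ballI)
  show "f ` I \<subseteq> I" if "f \<in> \<Sigma> \<union> \<Delta> \<union> set ds" for f
    using assms(2)[of f] that by (simp add: ops_def image_subset_iff)
qed (use ideal_inD(1-4)[OF assms(1)] in simp_all)

lemma nat_inverse: "\<exists>u\<in>k. u * of_nat (Suc n) = 1"
proof -
  have "of_nat (Suc n) \<in> k" "of_nat (Suc n) \<noteq> (0::'a)" using subring_of_nat[OF k_ring(2)] by (auto simp del: of_nat_Suc)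
  then show ?thesis using k_ring(3) by (metis is_subfield_def mult.commute)
qed

lemma nat_cancel:
  assumes "ideal_in S I" "k \<subseteq> S" "s \<in> S" "of_nat (Suc n) * s \<in> I"
  shows "s \<in> I"
proof -
  obtain u where u: "u \<in> k" "u * of_nat (Suc n) = 1" using nat_inverse by blast
  have "u * (of_nat (Suc n) * s) \<in> I" using ideal_inD(4)[OF assms(1) _ assms(4)] u(1) assms(2) by blast
  moreover have "u * (of_nat (Suc n) * s) = s" using u(2) by (simp only: mult.assoc[symmetric] mult_1)
  ultimately show ?thesis by simp
qed

text \<open>The nilradical is stable under the automorphisms and, in characteristic 0, under the
  derivations. It does not contain \<open>1\<close>, so simplicity makes it zero.\<close>

lemma R_reduced:
  assumes "x \<in> R" "x ^ n = 0"
  shows "x = 0"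
proof -
  have I: "ideal_in R {0}" using is_subringD(2)[OF R_ring(2)] by (auto simp: ideal_in_def)
  let ?N = "radical_in R {0}"
  have "sdp_ideal \<Sigma> \<Delta> ds R ?N"
  proof (rule sdp_idealI[OF ideal_radical[OF R_ring(2) I]])
    fix f y assume f: "f \<in> ops" and y: "y \<in> ?N"
    show "f y \<in> ?N"
    proof (cases "f \<in> \<Sigma>")
      case True
      obtain m where m: "y \<in> R" "y ^ m = 0" using y by (auto simp: radical_in_def)
      have "f (y ^ j) = f y ^ j" for j by (induction j) (auto simp: aut_simps[OF True])
      then have "f y ^ m = 0" using m(2) aut_simps(4)[OF True] by metis
      then show ?thesis using op_closed[OF R_ring(1) f m(1)] by (auto simp: radical_in_def)
    next
      case False
      then have d: "f \<in> \<Delta> \<union> set ds" using f by (simp add: ops_def)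
      have "f ` ?N \<subseteq> ?N"
      proof (rule radical_deriv[OF R_ring(2) I derU[OF d]])
        show "f ` R \<subseteq> R" using op_closed[OF R_ring(1) f] by blast
        show "f ` {0} \<subseteq> {0}" using op_add(3)[OF f] by simp
      qed (rule nat_cancel[OF I R_ring(3)])
      then show ?thesis using y by blast
    qed
  qed
  moreover have "1 \<notin> ?N" by (auto simp: radical_in_def)
  ultimately have "?N = {0}" by (rule simple)
  then show ?thesis using assms by (auto simp: radical_in_def)
qed

lemma quotient_form: obtains r s t where "r \<in> R" "s \<in> nonzerodivisors R" "x * s = r" "s * t = 1"
proof -
  obtain r s where "r \<in> R" "s \<in> nonzerodivisors R" "x * s = r" using K_quot unfolding total_quotient_ring_of_def by meson
  moreover then obtain t where "s * t = 1" using K_quot unfolding total_quotient_ring_of_def by (metis dvd_def)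
  ultimately show ?thesis by (rule that)
qed

lemma K_reduced:
  fixes x :: 'a
  assumes "x ^ 2 = 0"
  shows "x = 0"
proof -
  obtain r s t where *: "r \<in> R" "x * s = r" "s * t = 1" by (rule quotient_form)
  have "r ^ 2 = 0" using * assms by (metis mult_zero_left power_mult_distrib)
  then have "r = 0" by (rule R_reduced[OF *(1)])
  then show ?thesis using * by (metis mult.assoc mult_zero_left mult_1_right)
qed

section \<open>The field of constants of the total quotient ring\<close>

lemma E_iff: "x \<in> E \<longleftrightarrow> (\<forall>\<delta>\<in>\<Delta>. \<delta> x = 0) \<and> (\<forall>\<sigma>\<in>\<Sigma>. \<sigma> x = x)"
  by (simp add: E_def sd_constants_def)

lemma E_const: "x \<in> E \<Longrightarrow> \<delta> \<in> \<Delta> \<Longrightarrow> \<delta> x = 0" "x \<in> E \<Longrightarrow> \<sigma> \<in> \<Sigma> \<Longrightarrow> \<sigma> x = x"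
  by (simp_all add: E_iff)

lemma C_E: "C = k \<inter> E"
  unfolding C_def E_def sd_constants_def by blast

lemma E_subring: "is_subring E"
  unfolding is_subring_def
proof (intro conjI ballI)
  show "1 \<in> E" by (simp add: E_iff der_simps aut_simps)
  fix x y assume "x \<in> E" "y \<in> E"
  note c = E_const[OF this(1)] E_const[OF this(2)]
  show "x - y \<in> E" by (simp add: E_iff der_simps aut_simps c)
  show "x * y \<in> E" by (simp add: E_iff der_simps aut_simps c)
qed

lemma E_ds: "d \<in> set ds \<Longrightarrow> x \<in> E \<Longrightarrow> d x \<in> E"
proof -
  assume d: "d \<in> set ds" and x: "x \<in> E"
  have "\<delta> (d x) = 0" if "\<delta> \<in> \<Delta>" for \<delta>
    using comm[of \<delta> d x] that d der_simps(3)[of d] E_const(1)[OF x that] by (simp add: ops_def)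
  moreover have "\<sigma> (d x) = d x" if "\<sigma> \<in> \<Sigma>" for \<sigma>
    using comm[of \<sigma> d x] that d E_const(2)[OF x that] by (simp add: ops_def)
  ultimately show ?thesis by (simp add: E_iff)
qed

lemma E_inverse:
  assumes x: "x \<in> E" and y: "x * y = 1"
  shows "y \<in> E"
proof -
  have cancel: "z = 0" if "x * z = 0" for z
    using that y by (metis mult.assoc mult.commute mult_1 mult_zero_right)
  have "\<delta> y = 0" if d: "\<delta> \<in> \<Delta>" for \<delta>
  proof -
    have "\<delta> x * y + x * \<delta> y = 0" using der_simps(2)[of \<delta> x y] der_simps(4)[of \<delta>] d y by simp
    then show ?thesis using E_const(1)[OF x d] cancel by simp
  qed
  moreover have "\<sigma> y = y" if s: "\<sigma> \<in> \<Sigma>" for \<sigma>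
  proof -
    have "x * \<sigma> y = 1" using aut_simps(2)[OF s, of x y] aut_simps(3)[OF s] y E_const(2)[OF x s] by simp
    then have "x * (\<sigma> y - y) = 0" using y by (simp add: algebra_simps)
    from cancel[OF this] show ?thesis by simp
  qed
  ultimately show ?thesis by (simp add: E_iff)
qed

text \<open>The annihilator in \<open>R\<close> of a nonzero constant \<open>a\<close> is a
  \<Sigma>\<Delta>\<Pi>-ideal, hence zero; the numerator of \<open>a\<close> is then a
  nonzerodivisor and becomes invertible in \<open>K\<close>. Stability under \<Pi> rests on
  \<open>K_reduced\<close>, because the \<Pi>-derivatives of \<open>a\<close> need not vanish: only
  the square of \<open>f x * a\<close> is seen to be zero directly.\<close>

lemma E_field: "is_subfield E"
  unfolding is_subfield_def
proof (intro conjI ballI impI E_subring)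
  fix a assume a: "a \<in> E" "a \<noteq> 0"
  let ?I = "{x \<in> R. x * a = 0}"
  have "sdp_ideal \<Sigma> \<Delta> ds R ?I"
  proof (rule sdp_idealI)
    show "ideal_in R ?I"
      unfolding ideal_in_def using is_subringD[OF R_ring(2)] by (auto simp: distrib_right mult.assoc)
    fix f x assume f: "f \<in> ops" and x: "x \<in> ?I"
    have fx: "f x \<in> R" using op_closed[OF R_ring(1) f] x by simp
    have z: "f (x * a) = 0" using x op_add(3)[OF f] by simp
    consider "f \<in> \<Sigma>" | "f \<in> \<Delta>" | "f \<in> set ds" using f by (auto simp: ops_def)
    then have "f x * a = 0"
    proof cases
      case 1
      then show ?thesis using z aut_simps(2)[OF 1, of x a] E_const(2)[OF a(1) 1] by simp
    next
      case 2
      then show ?thesis using z der_simps(2)[of f x a] E_const(1)[OF a(1) 2] by simp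
    next
      case 3
      then have "f x * a + x * f a = 0" using z der_simps(2)[of f x a] by simp
      then have "(f x * a + x * f a) * (f x * a) = 0" by simp
      then have "(f x * a) ^ 2 + (x * a) * (f a * f x) = 0" by (simp add: algebra_simps power2_eq_square)
      then show ?thesis using x K_reduced by simp
    qed
    then show "f x \<in> ?I" using fx by simp
  qed
  moreover have "1 \<notin> ?I" using a(2) by simp
  ultimately have I: "?I = {0}" by (rule simple)
  obtain r s t where *: "r \<in> R" "a * s = r" "s \<in> nonzerodivisors R" "s * t = 1" by (rule quotient_form)
  have "r \<in> nonzerodivisors R" unfolding nonzerodivisors_def
  proof (intro CollectI conjI ballI impI *(1))
    fix u assume u: "u \<in> R" "r * u = 0"
    have "(u * a) * s = r * u" using *(2)[symmetric] by (simp add: mult_ac)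
    then have "(u * a) * s = 0" using u(2) by simp
    then have "u * a = 0" using *(4) by (metis mult.assoc mult_zero_left mult_1_right)
    then show "u = 0" using I u(1) by blast
  qed
  then obtain w where "r * w = 1" using K_quot unfolding total_quotient_ring_of_def by (metis dvd_def)
  then have "a * (s * w) = 1" using *(2) by (simp add: mult.assoc[symmetric])
  then show "\<exists>y\<in>E. a * y = 1" using E_inverse[OF a(1)] by blast
qed

lemma C_subfield: "is_subfield C"
proof -
  have "is_subring C" using k_ring(2) E_subring unfolding C_E is_subring_def by auto
  moreover have "\<exists>y\<in>C. x * y = 1" if "x \<in> C" "x \<noteq> 0" for x
    using that k_ring(3) E_inverse unfolding C_E is_subfield_def by blast
  ultimately show ?thesis by (simp add: is_subfield_def)
qed

lemma C_subring: "is_subring C" using C_subfield by (simp add: is_subfield_def)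

lemma C_ds: "d \<in> set ds \<Longrightarrow> d ` C \<subseteq> C"
  using E_ds[of d] op_closed[OF k_ring(1), of d] by (auto simp: C_E ops_def)

lemma derC: "d \<in> set ds \<Longrightarrow> is_derivation UNIV d" using derU by simp

lemma commC: "d \<in> set ds \<Longrightarrow> d' \<in> set ds \<Longrightarrow> d (d' x) = d' (d x)"
  using comm by (simp add: ops_def)

lemma transfer:
  fixes Q :: "(nat, 'a) dpoly"
  assumes "c \<in> E" "finite Ps" "Ps \<subseteq> dpolys (length ds) C {0::nat}" "Q \<in> dpolys (length ds) C {0}"
    "\<And>P. P \<in> Ps \<Longrightarrow> dpoly_eval ds (\<lambda>_. c) P = 0" "dpoly_eval ds (\<lambda>_. c) Q \<noteq> 0"
  shows "\<exists>a\<in>C. (\<forall>P\<in>Ps. dpoly_eval ds (\<lambda>_. a) P = 0) \<and> dpoly_eval ds (\<lambda>_. a) Q \<noteq> 0"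
proof -
  have [simp]: "{..<Suc 0} = {0::nat}" by auto
  have *: "dpoly_eval ds a P = dpoly_eval ds (\<lambda>_. a 0) P" if "P \<in> dpolys (length ds) C {0::nat}" for a and P :: "(nat, 'a) dpoly"
    using that unfolding dpoly_eval_mono mono_eval_def
    by (intro sum.cong prod.cong refl arg_cong2[where f = "(*)"] arg_cong2[where f = "(^)"]) (auto simp: dpolys_iff)
  have "\<exists>a. a ` {..<1} \<subseteq> C \<and> (\<forall>P\<in>Ps. dpoly_eval ds a P = 0) \<and> dpoly_eval ds a Q \<noteq> 0"
  proof (rule existentially_closed[OF E_field _ C_closed])
    show "C \<subseteq> E" by (simp add: C_E)
    show "d ` E \<subseteq> E" if "d \<in> set ds" for d using E_ds[OF that] by blast
    show "d (d' x) = d' (d x)" if "d \<in> set ds" "d' \<in> set ds" for d d' x using commC[OF that] .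
  qed (use assms derC in auto)
  then obtain a where a: "a 0 \<in> C" "\<forall>P\<in>Ps. dpoly_eval ds a P = 0" "dpoly_eval ds a Q \<noteq> 0" by auto
  have "dpoly_eval ds (\<lambda>_. a 0) P = 0" if "P \<in> Ps" for P
    using a(2) that *[OF subsetD[OF assms(3) that], of a] by simp
  then show ?thesis using *[OF assms(4), of a] a by (intro bexI[of _ "a 0"]) auto
qed

text \<open>Shortest-relation argument. One coefficient is normalised to \<open>1\<close>; constants
  pass through the operators, so applying some \<open>\<delta>\<close> or
  \<open>\<sigma> - 1\<close> to the coefficients gives another relation in which this one is zero.
  Either a shorter nontrivial relation results, or all normalised coefficients are constants in
  \<open>k\<close>.\<close>

lemma dependent_over_C:
  assumes "finite I" "\<And>i. i \<in> I \<Longrightarrow> x i \<in> k" "\<And>i. i \<in> I \<Longrightarrow> e i \<in> E" "(\<Sum>i\<in>I. x i * e i) = 0" "\<exists>i\<in>I. x i \<noteq> 0"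
  shows "\<exists>c. (\<forall>i\<in>I. c i \<in> C) \<and> (\<exists>i\<in>I. c i \<noteq> 0) \<and> (\<Sum>i\<in>I. c i * e i) = 0"
  using assms
proof (induction "card I" arbitrary: I x rule: less_induct)
  case less
  obtain i0 where i0: "i0 \<in> I" "x i0 \<noteq> 0" using less(6) by blast
  then obtain u where u: "u \<in> k" "x i0 * u = 1" using less(3) k_ring(3) by (auto simp: is_subfield_def)
  define x' where "x' i = u * x i" for i
  have x': "x' i \<in> k" if "i \<in> I" for i using that less(3) u is_subringD(4)[OF k_ring(2)] by (simp add: x'_def)
  have x'1: "x' i0 = 1" using u by (simp add: x'_def mult.commute)
  have sum: "(\<Sum>i\<in>I. x' i * e i) = 0" using less(5) by (simp add: x'_def mult.assoc sum_distrib_left[symmetric])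
  have step: ?case if y: "\<And>i. i \<in> I \<Longrightarrow> y i \<in> k" "y i0 = 0" "(\<Sum>i\<in>I. y i * e i) = 0" "\<exists>i\<in>I. y i \<noteq> 0" for y
  proof -
    let ?J = "I - {i0}"
    have "(\<Sum>i\<in>?J. y i * e i) = 0" using y(2,3) sum.remove[OF less(2) i0(1), of "\<lambda>i. y i * e i"] by simp
    moreover have "card ?J < card I" using less(2) i0(1) by (rule card_Diff1_less)
    moreover have "\<exists>i\<in>?J. y i \<noteq> 0" using y(2,4) by auto
    ultimately obtain c where c: "\<forall>i\<in>?J. c i \<in> C" "\<exists>i\<in>?J. c i \<noteq> 0" "(\<Sum>i\<in>?J. c i * e i) = 0"
      using less(1)[of ?J y] less(2,4) y(1) by auto
    let ?c = "c(i0 := 0)"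
    have "(\<Sum>i\<in>I. ?c i * e i) = (\<Sum>i\<in>?J. c i * e i)"
      using sum.remove[OF less(2) i0(1), of "\<lambda>i. ?c i * e i"] by (simp cong: sum.cong) (intro sum.cong, auto)
    then show ?case using c is_subringD(2)[OF C_subring] by (intro exI[of _ ?c]) auto
  qed
  show ?case
  proof (cases "\<forall>i\<in>I. x' i \<in> E")
    case True
    moreover have "\<exists>i\<in>I. x' i \<noteq> 0" using i0(1) x'1 by (intro bexI[of _ i0]) auto
    ultimately show ?thesis using x' sum by (intro exI[of _ x']) (auto simp: C_E)
  next
    case False
    then obtain i where i: "i \<in> I" "x' i \<notin> E" by blast
    then consider \<delta> where "\<delta> \<in> \<Delta>" "\<delta> (x' i) \<noteq> 0" | \<sigma> where "\<sigma> \<in> \<Sigma>" "\<sigma> (x' i) \<noteq> x' i" by (auto simp: E_iff)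
    then show ?thesis
    proof cases
      case 1
      then have op: "\<delta> \<in> ops" "\<delta> \<in> \<Delta> \<union> set ds" by (auto simp: ops_def)
      have "\<delta> (\<Sum>i\<in>I. x' i * e i) = (\<Sum>i\<in>I. \<delta> (x' i) * e i)"
        unfolding d_sum[OF derU[OF op(2)]] using less(4) 1(1) by (intro sum.cong) (simp_all add: der_simps[OF op(2)] E_const(1))
      then show ?thesis using 1 i(1) sum x' op_closed[OF k_ring(1) op(1)] der_simps(3,4)[OF op(2)] x'1
        by (intro step[of "\<lambda>i. \<delta> (x' i)"]) auto
    next
      case 2
      then have op: "\<sigma> \<in> ops" by (auto simp: ops_def)
      have "\<sigma> (sum g J) = (\<Sum>i\<in>J. \<sigma> (g i))" for g and J :: "'b set"
        by (induction J rule: infinite_finite_induct) (auto simp: aut_simps[OF 2(1)])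
      then have "\<sigma> (\<Sum>i\<in>I. x' i * e i) = (\<Sum>i\<in>I. \<sigma> (x' i) * e i)"
        using less(4) 2(1) by (simp add: aut_simps[OF 2(1)] E_const(2))
      then have "(\<Sum>i\<in>I. (\<sigma> (x' i) - x' i) * e i) = 0"
        using sum aut_simps(4)[OF 2(1)] by (simp add: left_diff_distrib sum_subtractf)
      then show ?thesis using 2 i(1) x' op_closed[OF k_ring(1) op] is_subringD(3)[OF k_ring(2)] aut_simps(3)[OF 2(1)] x'1
        by (intro step[of "\<lambda>i. \<sigma> (x' i) - x' i"]) auto
    qed
  qed
qed

text \<open>The same dependence read on the side of \<open>k\<close>. A relation over
  \<open>C\<close> among the \<open>e i\<close> expresses one of them by the others; substituting it
  shortens the sum and replaces \<open>x i\<close> by \<open>x i + b i * x i0\<close>, with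
  \<open>b i\<close> in \<open>C\<close>.\<close>

lemma dependent_over_C_coefficients:
  assumes "finite I" "\<And>i. i \<in> I \<Longrightarrow> x i \<in> k" "\<And>i. i \<in> I \<Longrightarrow> e i \<in> E" "(\<Sum>i\<in>I. x i * e i) = 0"
    "\<exists>i\<in>I. e i \<noteq> 0"
  shows "\<exists>c. (\<forall>i\<in>I. c i \<in> C) \<and> (\<exists>i\<in>I. c i \<noteq> 0) \<and> (\<Sum>i\<in>I. c i * x i) = 0"
  using assms
proof (induction "card I" arbitrary: I x e rule: less_induct)
  case less
  show ?case
  proof (cases "\<exists>i\<in>I. x i \<noteq> 0")
    case False
    then show ?thesis using less(6) is_subringD(1)[OF C_subring] by (intro exI[of _ "\<lambda>_. 1"]) auto
  next
    case True
    from dependent_over_C[OF less(2,3,4,5) this] obtain c i0 where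
      c: "\<And>i. i \<in> I \<Longrightarrow> c i \<in> C" "i0 \<in> I" "c i0 \<noteq> 0" "(\<Sum>i\<in>I. c i * e i) = 0" by blast
    let ?J = "I - {i0}"
    obtain u where u: "u \<in> C" "c i0 * u = 1" using c C_subfield by (auto simp: is_subfield_def)
    define b where "b i = - (u * c i)" for i
    have b: "b i \<in> C" if "i \<in> I" for i using u c(1)[OF that] is_subringD(4,5)[OF C_subring] by (simp add: b_def)
    have CI: "C \<subseteq> k" by (simp add: C_E)
    have "c i0 * e i0 + (\<Sum>i\<in>?J. c i * e i) = 0" using c(4) sum.remove[OF less(2) c(2), of "\<lambda>i. c i * e i"] by simp
    then have "u * (c i0 * e i0) + u * (\<Sum>i\<in>?J. c i * e i) = 0" by (simp add: distrib_left[symmetric])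
    then have e0: "e i0 = (\<Sum>i\<in>?J. b i * e i)"
      using u(2) by (simp add: b_def sum_distrib_left sum_negf mult.assoc[symmetric] mult.commute[of u "c i0"] eq_neg_iff_add_eq_0)
    have "x i0 * e i0 + (\<Sum>i\<in>?J. x i * e i) = 0" using less(5) sum.remove[OF less(2) c(2), of "\<lambda>i. x i * e i"] by simp
    then have s: "(\<Sum>i\<in>?J. (x i + b i * x i0) * e i) = 0"
      unfolding e0 by (simp add: sum_distrib_left sum.distrib algebra_simps)
    have ne: "\<exists>i\<in>?J. e i \<noteq> 0"
    proof (rule ccontr)
      assume n: "\<not> ?thesis"
      then have "e i0 = 0" unfolding e0 by (intro sum.neutral) auto
      then show False using less(6) n by auto
    qed
    have "card ?J < card I" using less(2) c(2) by (rule card_Diff1_less)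
    moreover have "x i + b i * x i0 \<in> k" if "i \<in> ?J" for i
      using that less(3) b CI c(2) by (intro is_subringD(4,6)[OF k_ring(2)]) auto
    ultimately obtain d where d: "\<forall>i\<in>?J. d i \<in> C" "\<exists>i\<in>?J. d i \<noteq> 0" "(\<Sum>i\<in>?J. d i * (x i + b i * x i0)) = 0"
      using less(1)[of ?J "\<lambda>i. x i + b i * x i0" e] less(2,4) s ne by auto
    \<comment> \<open>The relation found for the elements \<open>x i + b i * x i0\<close> is
      rewritten for the original \<open>x i\<close>; the coefficient of \<open>x i0\<close> collects
      all its occurrences.\<close>
    let ?d = "d(i0 := (\<Sum>i\<in>?J. d i * b i))"
    have "(\<Sum>i\<in>I. ?d i * x i) = (\<Sum>i\<in>?J. d i * b i) * x i0 + (\<Sum>i\<in>?J. ?d i * x i)"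
      using sum.remove[OF less(2) c(2), of "\<lambda>i. ?d i * x i"] by simp
    also have "(\<Sum>i\<in>?J. ?d i * x i) = (\<Sum>i\<in>?J. d i * x i)" by (intro sum.cong) auto
    also have "(\<Sum>i\<in>?J. d i * b i) * x i0 + (\<Sum>i\<in>?J. d i * x i) = 0"
      using d(3) unfolding distrib_left sum.distrib sum_distrib_right by (simp add: mult.assoc add.commute)
    finally have "(\<Sum>i\<in>I. ?d i * x i) = 0" .
    moreover have "(\<Sum>i\<in>?J. d i * b i) \<in> C"
      using d(1) b by (intro subring_sum[OF C_subring] is_subringD(4)[OF C_subring]) auto
    ultimately show ?thesis using d(1,2) by (intro exI[of _ ?d]) auto
  qed
qed

lemma linearly_disjoint:
  assumes X: "finite X" "X \<subseteq> k" "lin_indep C X" and e: "\<And>x. x \<in> X \<Longrightarrow> e x \<in> E" "(\<Sum>x\<in>X. x * e x) = 0" and x: "x \<in> X"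
  shows "e x = 0"
proof (rule ccontr)
  assume "e x \<noteq> 0"
  then have "\<exists>i\<in>X. e i \<noteq> 0" using x by blast
  from dependent_over_C_coefficients[OF X(1) subsetD[OF X(2)] e(1,2) this] obtain c
    where "\<forall>i\<in>X. c i \<in> C" "\<exists>i\<in>X. c i \<noteq> 0" "(\<Sum>i\<in>X. c i * i) = 0" by auto
  then show False using X(3) unfolding lin_indep_def by blast
qed

end

lemma dpoly_eval_of_nat: "dpoly_eval ds a (of_nat n) = of_nat n"
  by (induction n) (auto simp: dpoly_eval_add)

lemma dpoly_eval_closed:
  assumes X: "is_subring X" and p: "p \<in> dpolys m L V" and L: "L \<subseteq> X"
    and a: "\<And>v e. v \<in> V \<Longrightarrow> kys e \<subseteq> {..<m} \<Longrightarrow> derivative_op ds e (a v) \<in> X"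
  shows "dpoly_eval ds a p \<in> X"
  unfolding dpoly_eval_mono mono_eval_def
proof (intro subring_sum[OF X] is_subringD(4)[OF X] subring_prod[OF X] subring_power[OF X])
  fix t assume t: "t \<in> kys p"
  then show "lkp p t \<in> X" using p L by (auto simp: dpolys_iff)
  fix z assume "z \<in> kys t"
  then show "derivative_op ds (snd z) (a (fst z)) \<in> X" using p t a by (auto simp: dpolys_iff)
qed

lemma dvars_one: "{z. fst z \<in> {0::nat} \<and> kys (snd z) \<subseteq> {..<m}} = dvars m 1"
  by (auto simp: dvars_def)

section \<open>Specialisation of a constant of \<open>K\<close> to an element of
  \<open>C\<close>\<close>

context pv_extension
begin

abbreviation "ev c \<equiv> dpoly_eval ds (\<lambda>_::nat. c)"
abbreviation "polyC \<equiv> dpolys (length ds) C {0::nat}"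
abbreviation "polyk \<equiv> dpolys (length ds) k {0::nat}"

lemma E_derivative_op: "x \<in> E \<Longrightarrow> derivative_op ds e x \<in> E"
  by (rule derivative_op_closed) (use E_ds in auto)

lemma C_le: "C \<subseteq> E" "C \<subseteq> k"
  by (auto simp: C_E)

lemma C_derivative_op: "x \<in> C \<Longrightarrow> derivative_op ds e x \<in> C"
  by (rule derivative_op_closed[OF C_ds])

lemma ev_E: "c \<in> E \<Longrightarrow> p \<in> polyC \<Longrightarrow> ev c p \<in> E"
  using C_le E_derivative_op by (intro dpoly_eval_closed[OF E_subring]) auto

lemma ev_k:
  assumes "a \<in> C" "p \<in> polyk"
  shows "ev a p \<in> k"
  using C_derivative_op[OF assms(1)] C_le(2) by (intro dpoly_eval_closed[OF k_ring(2) assms(2)]) auto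

lemma polyC_k: "polyC \<subseteq> polyk"
  by (rule dpolys_mono) (use C_le in auto)

lemma ev_deriv: "j < length ds \<Longrightarrow> ev c (dpoly_deriv (ds ! j) j p) = (ds ! j) (ev c p)"
  by (rule dpoly_eval_deriv) (auto intro: derC commC)

lemma E_no_zero_divisors: "x \<in> E \<Longrightarrow> y \<in> E \<Longrightarrow> x * y = 0 \<Longrightarrow> x = 0 \<or> y = 0"
  using E_field unfolding is_subfield_def by (metis mult.assoc mult.commute mult_1 mult_zero_right)

lemma k_no_zero_divisors: "x \<in> k \<Longrightarrow> y \<in> k \<Longrightarrow> x * y = 0 \<Longrightarrow> x = 0 \<or> y = 0"
  using k_ring(3) unfolding is_subfield_def by (metis mult.assoc mult.commute mult_1 mult_zero_right)

lemma prime_ev_kernel: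
  assumes c: "c \<in> E"
  shows "prime_ideal_in polyC {p \<in> polyC. ev c p = 0}"
proof
  note S = subring_dpolys[OF C_subring, of "length ds" "{0::nat}"]
  show "is_subring polyC" by (rule S)
  show "ideal_in polyC {p \<in> polyC. ev c p = 0}"
    unfolding ideal_in_def using is_subringD[OF S] by (auto simp: dpoly_eval_add dpoly_eval_mult)
  show "1 \<notin> {p \<in> polyC. ev c p = 0}" by simp
  fix p q assume pq: "p \<in> polyC" "q \<in> polyC" "p * q \<in> {p \<in> polyC. ev c p = 0}"
  then have "ev c p * ev c q = 0" by (simp add: dpoly_eval_mult)
  then show "p \<in> {p \<in> polyC. ev c p = 0} \<or> q \<in> {p \<in> polyC. ev c p = 0}"
    using E_no_zero_divisors[OF ev_E[OF c pq(1)] ev_E[OF c pq(2)]] pq by auto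
qed

text \<open>The relations of \<open>c\<close> over \<open>C\<close> form a prime differential ideal,
  to which \<open>ritt\<close> is applied. For \<open>a\<close> in \<open>C\<close> the kernel of
  evaluation at \<open>a\<close> is again a prime differential ideal, so finitely many conditions on
  \<open>a\<close> force it to satisfy every relation of \<open>c\<close>.\<close>

lemma finite_presentation:
  assumes c: "c \<in> E"
  shows "\<exists>Ps h. finite Ps \<and> Ps \<subseteq> polyC \<and> h \<in> polyC \<and> (\<forall>p\<in>Ps. ev c p = 0) \<and> ev c h \<noteq> 0 \<and>
    (\<forall>a\<in>C. (\<forall>p\<in>Ps. ev a p = 0) \<longrightarrow> ev a h \<noteq> 0 \<longrightarrow> (\<forall>p\<in>polyC. ev c p = 0 \<longrightarrow> ev a p = 0))"
proof -
  let ?P = "\<lambda>c. {p \<in> polyC. ev c p = 0}"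
  let ?ds = "map (\<lambda>j. dpoly_deriv (ds ! j) j) [0..<length ds]"
  have len: "length ?ds = length ds" by simp
  have ker_der: "d ` ?P c \<subseteq> ?P c" if d: "d \<in> set ?ds" for c d
  proof -
    obtain j where j: "j < length ds" "d = dpoly_deriv (ds ! j) j" using d by auto
    have "is_derivation polyC d"
      unfolding j(2) by (rule derivation_dpoly_deriv[OF derC[OF nth_mem[OF j(1)]] C_subring C_ds[OF nth_mem[OF j(1)]] j(1)])
    then have "d ` polyC \<subseteq> polyC" by (simp add: is_derivation_def)
    moreover have "d' 0 = 0" if "d' \<in> set ds" for d' using der_simps(3) that by simp
    ultimately show ?thesis using ev_deriv[OF j(1)] j nth_mem[OF j(1)] by auto
  qed
  interpret P: prime_ideal_in polyC "?P c" by (rule prime_ev_kernel[OF c])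
  interpret diff_generated polyC "?P c" "dconst ` C" ?ds 1 dvar
  proof
    show "is_subring (dconst ` C :: (nat, 'a) dpoly set)"
    proof -
      have "dconst x - dconst y = (dconst (x - y) :: (nat, 'a) dpoly)" "dconst x * dconst y = (dconst (x * y) :: (nat, 'a) dpoly)" for x y :: 'a
        by (simp_all add: dconst_def single_diff mult_single)
      moreover have "(1 :: (nat, 'a) dpoly) = dconst 1" by (simp add: dconst_def)
      ultimately show ?thesis using is_subringD[OF C_subring] unfolding is_subring_def by auto
    qed
    show "dconst ` C \<subseteq> polyC" using dconst_dpolys by blast
    show "polyC = rgen (dconst ` C \<union> dvar ` dvars (length ?ds) 1)"
      unfolding len dvars_one[symmetric] by (rule dpolys_rgen[OF C_subring])
    show "d ` ?P c \<subseteq> ?P c" if "d \<in> set ?ds" for d by (rule ker_der[OF that])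
    show "is_derivation polyC d" "d ` dconst ` C \<subseteq> dconst ` C" if "d \<in> set ?ds" for d
    proof -
      obtain j where j: "j < length ds" "d = dpoly_deriv (ds ! j) j" using \<open>d \<in> set ?ds\<close> by auto
      show "is_derivation polyC d"
        unfolding j(2) by (rule derivation_dpoly_deriv[OF derC[OF nth_mem[OF j(1)]] C_subring C_ds[OF nth_mem[OF j(1)]] j(1)])
      show "d ` dconst ` C \<subseteq> dconst ` C"
        using C_ds[OF nth_mem[OF j(1)]] unfolding j(2) by (auto simp: dpoly_deriv_dconst[OF derC[OF nth_mem[OF j(1)]]])
    qed
    show "(?ds ! j) (dvar z) = dvar (shift z (sgl j 1))" if "z \<in> dvars (length ?ds) 1" "j < length ?ds" for z j
      using that dpoly_deriv_dvar[OF derC[OF nth_mem[of j ds]], of j z] by (simp add: shift_def)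
    fix s n assume s: "s \<in> polyC" "of_nat (Suc n) * s \<in> ?P c"
    obtain u where u: "u * of_nat (Suc n) = (1::'a)" using nat_inverse by blast
    have "of_nat (Suc n) * ev c s = 0" using s(2) by (simp add: dpoly_eval_mult dpoly_eval_of_nat del: of_nat_Suc)
    then have "ev c s = 0" using u by (metis mult.assoc mult_1 mult_zero_right)
    then show "s \<in> ?P c" using s(1) by simp
  qed
  have D0: "dconst ` C \<inter> ?P c \<subseteq> {0}" by (auto simp: dconst_def[of 0])
  show ?thesis
  proof (rule ritt[OF D0])
    fix Ps h assume Ps: "finite Ps" "Ps \<subseteq> ?P c" "h \<in> polyC - ?P c"
      and least: "\<And>Q. prime_ideal_in polyC Q \<Longrightarrow> (\<And>d. d \<in> set ?ds \<Longrightarrow> d ` Q \<subseteq> Q) \<Longrightarrow> Ps \<subseteq> Q \<Longrightarrow> h \<notin> Q \<Longrightarrow> ?P c \<subseteq> Q"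
    show ?thesis
    proof (intro exI conjI ballI impI)
      show "finite Ps" "Ps \<subseteq> polyC" "h \<in> polyC" "ev c h \<noteq> 0" "\<And>p. p \<in> Ps \<Longrightarrow> ev c p = 0" using Ps by auto
      fix a p assume a: "a \<in> C" "\<forall>p\<in>Ps. ev a p = 0" "ev a h \<noteq> 0" and p: "p \<in> polyC" "ev c p = 0"
      have aE: "a \<in> E" using a(1) C_le by blast
      have "?P c \<subseteq> ?P a"
      proof (rule least[OF prime_ev_kernel[OF aE]])
        show "d ` ?P a \<subseteq> ?P a" if "d \<in> set ?ds" for d by (rule ker_der[OF that])
        show "Ps \<subseteq> ?P a" "h \<notin> ?P a" using a(2,3) Ps(2) by auto
      qed
      then show "ev a p = 0" using p by blast
    qed
  qed
qed

text \<open>Linear disjointness splits an equation over \<open>k\<close> satisfied by a constant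
  into equations over \<open>C\<close>. Only in this form can it be transferred to points of
  \<open>C\<close>.\<close>

lemma components:
  assumes p: "p \<in> polyk"
  shows "\<exists>X f. finite X \<and> X \<subseteq> k \<and> (\<forall>x\<in>X. f x \<in> polyC) \<and> (\<forall>c. ev c p = (\<Sum>x\<in>X. x * ev c (f x))) \<and>
    (\<forall>c\<in>E. ev c p = 0 \<longrightarrow> (\<forall>x\<in>X. ev c (f x) = 0))"
proof -
  obtain X f where *: "finite X" "X \<subseteq> k" "lin_indep C X" "\<forall>x\<in>X. f x \<in> polyC" "p = (\<Sum>x\<in>X. dconst x * f x)"
    using dpoly_decompose[OF C_subfield p] by blast
  have e: "ev c p = (\<Sum>x\<in>X. x * ev c (f x))" for c
    unfolding *(5) by (simp add: dpoly_eval_sum dpoly_eval_mult)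
  have "ev c (f x) = 0" if "c \<in> E" "ev c p = 0" "x \<in> X" for c x
  proof (rule linearly_disjoint[OF *(1-3) _ _ that(3), of "\<lambda>x. ev c (f x)"])
    show "ev c (f x) \<in> E" if "x \<in> X" for x using ev_E[OF \<open>c \<in> E\<close>] *(4) that by blast
    show "(\<Sum>x\<in>X. x * ev c (f x)) = 0" using that(2) e by simp
  qed
  with * e show ?thesis by (intro exI[of _ X] exI[of _ f]) simp
qed

text \<open>\<open>K\<close> may have zero divisors, so the absence of zero divisors in
  \<open>k{c}\<close> needs an argument. If \<open>g * h\<close> vanished at \<open>c\<close>, the
  vanishing of its components, together with the nonvanishing of one component of each factor, could
  be transferred to some \<open>a\<close> in \<open>C\<close>, where the values lie in the field
  \<open>k\<close>.\<close>

lemma polyk_domain: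
  assumes c: "c \<in> E" and g: "g \<in> polyk" "ev c g \<noteq> 0" and h: "h \<in> polyk" "ev c h \<noteq> 0"
  shows "ev c g * ev c h \<noteq> 0"
proof
  assume z: "ev c g * ev c h = 0"
  have gh: "g * h \<in> polyk" using is_subringD(4)[OF subring_dpolys[OF k_ring(2)] g(1) h(1)] .
  obtain X f where X: "finite X" "\<forall>x\<in>X. f x \<in> polyC" "\<forall>c. ev c g = (\<Sum>x\<in>X. x * ev c (f x))"
    "\<forall>c\<in>E. ev c g = 0 \<longrightarrow> (\<forall>x\<in>X. ev c (f x) = 0)" using components[OF g(1)] by blast
  obtain Y f' where Y: "finite Y" "\<forall>x\<in>Y. f' x \<in> polyC" "\<forall>c. ev c h = (\<Sum>x\<in>Y. x * ev c (f' x))"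
    "\<forall>c\<in>E. ev c h = 0 \<longrightarrow> (\<forall>x\<in>Y. ev c (f' x) = 0)" using components[OF h(1)] by blast
  obtain W f'' where W: "finite W" "\<forall>x\<in>W. f'' x \<in> polyC" "\<forall>c. ev c (g * h) = (\<Sum>x\<in>W. x * ev c (f'' x))"
    "\<forall>c\<in>E. ev c (g * h) = 0 \<longrightarrow> (\<forall>x\<in>W. ev c (f'' x) = 0)" using components[OF gh] by blast
  have "\<exists>x\<in>X. ev c (f x) \<noteq> 0" using g(2) X(3) by (metis (no_types, lifting) mult_zero_right sum.neutral)
  then obtain x where x: "x \<in> X" "ev c (f x) \<noteq> 0" by blast
  have "\<exists>x\<in>Y. ev c (f' x) \<noteq> 0" using h(2) Y(3) by (metis (no_types, lifting) mult_zero_right sum.neutral)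
  then obtain y where y: "y \<in> Y" "ev c (f' y) \<noteq> 0" by blast
  have Q: "f x * f' y \<in> polyC" using is_subringD(4)[OF subring_dpolys[OF C_subring] bspec[OF X(2) x(1)] bspec[OF Y(2) y(1)]] .
  have "ev c (f x * f' y) \<noteq> 0"
    using E_no_zero_divisors[OF ev_E[OF c bspec[OF X(2) x(1)]] ev_E[OF c bspec[OF Y(2) y(1)]]] x(2) y(2) by (auto simp: dpoly_eval_mult)
  moreover have "ev c P = 0" if "P \<in> f'' ` W" for P
    using that W(4) c z by (auto simp: dpoly_eval_mult)
  moreover have "f'' ` W \<subseteq> polyC" using W(2) by blast
  ultimately obtain a where a: "a \<in> C" "\<forall>P\<in>f'' ` W. ev a P = 0" "ev a (f x * f' y) \<noteq> 0"
    using transfer[OF c, of "f'' ` W" "f x * f' y"] W(1) Q by blast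
  have aE: "a \<in> E" using a(1) C_le by blast
  have "ev a (g * h) = 0" using W(3) a(2) by simp
  then have "ev a g = 0 \<or> ev a h = 0"
    using k_no_zero_divisors[OF ev_k[OF a(1) g(1)] ev_k[OF a(1) h(1)]] by (simp add: dpoly_eval_mult)
  then show False using X(4) Y(4) aE x(1) y(1) a(3) by (auto simp: dpoly_eval_mult)
qed

section \<open>Absence of new constants\<close>

lemma generators:
  obtains N g where "g ` {..<N::nat} = {Z $ i $ j | i j. True} \<union> {w. w * det Z = 1}"
proof -
  have "finite {w. w * det Z = 1}"
  proof (cases "\<exists>w. w * det Z = 1")
    case True
    then obtain w where w: "w * det Z = 1" by blast
    have "v = w" if "v * det Z = 1" for v
    proof -
      have "v = v * (w * det Z)" using w by simp
      also have "\<dots> = w * (v * det Z)" by (simp add: mult_ac)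
      finally show ?thesis using that by simp
    qed
    then have "{w. w * det Z = 1} \<subseteq> {w}" by blast
    then show ?thesis by (rule finite_subset) simp
  qed simp
  moreover have "{Z $ i $ j | i j. True} = (\<lambda>(i, j). Z $ i $ j) ` UNIV" by auto
  ultimately have "finite ({Z $ i $ j | i j. True} \<union> {w. w * det Z = 1})" by simp
  then obtain N g where "{Z $ i $ j | i j. True} \<union> {w. w * det Z = 1} = g ` {i. i < (N::nat)}"
    unfolding finite_conv_nat_seg_image by blast
  then show ?thesis using that[of g N] by (simp add: lessThan_def)
qed

lemma R_least:
  assumes "is_subring X" "\<And>d x. d \<in> set ds \<Longrightarrow> x \<in> X \<Longrightarrow> d x \<in> X" "k \<subseteq> X" "\<And>i j. Z $ i $ j \<in> X" "\<And>w. w * det Z = 1 \<Longrightarrow> w \<in> X"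
  shows "R \<subseteq> X"
proof -
  have "R = pi_ring_generated ds (k \<union> {Z $ i $ j | i j. True} \<union> {w. w * det Z = 1})" using R by (simp add: pv_ring_def)
  also have "\<dots> \<subseteq> X" unfolding pi_ring_generated_def using assms by (intro Inter_lower) auto
  finally show ?thesis .
qed

lemma R_generators: "Z $ i $ j \<in> R" "w * det Z = 1 \<Longrightarrow> w \<in> R"
proof -
  have "R = pi_ring_generated ds (k \<union> {Z $ i $ j | i j. True} \<union> {w. w * det Z = 1})" using R by (simp add: pv_ring_def)
  moreover have "S \<subseteq> pi_ring_generated ds S" for S unfolding pi_ring_generated_def by blast
  ultimately have "k \<union> {Z $ i $ j | i j. True} \<union> {w. w * det Z = 1} \<subseteq> R" by simp
  then show "Z $ i $ j \<in> R" "w * det Z = 1 \<Longrightarrow> w \<in> R" by blast+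
qed

lemma subring_preimage:
  assumes X: "is_subring X" and f: "f \<in> ops"
  shows "is_subring {x \<in> X. f x \<in> X}"
proof -
  note X' = is_subringD[OF X]
  have "f (x * y) \<in> X" if "x \<in> X" "y \<in> X" "f x \<in> X" "f y \<in> X" for x y
  proof (cases "f \<in> \<Sigma>")
    case True
    then show ?thesis using that X' by (simp add: aut_simps)
  next
    case False
    then show ?thesis using that X' f by (simp add: ops_def der_simps)
  qed
  moreover have "f 1 \<in> X" using op_one[OF f] X' by auto
  ultimately show ?thesis unfolding is_subring_def using X' op_add(2)[OF f] by simp
qed

theorem constants:
  assumes c: "c \<in> E"
  shows "c \<in> C"
proof -
  let ?m = "length ds"
  obtain N g where g: "g ` {..<N::nat} = {Z $ i $ j | i j. True} \<union> {w. w * det Z = 1}" by (rule generators)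
  define y where "y z = derivative_op ds (snd z) (g (fst z))" for z :: dvar
  define cs where "cs = {derivative_op ds e c | e. kys e \<subseteq> {..<?m}}"
  define kc where "kc = rgen (k \<union> cs)"
  define R' where "R' = rgen (kc \<union> y ` dvars ?m N)"
  have kc: "is_subring kc" "k \<subseteq> kc" "cs \<subseteq> kc" using rgen_base[of "k \<union> cs"] by (auto simp: kc_def subring_rgen)
  have R': "is_subring R'" "kc \<subseteq> R'" "y ` dvars ?m N \<subseteq> R'"
    using rgen_base[of "kc \<union> y ` dvars ?m N"] by (auto simp: R'_def subring_rgen)
  have csE: "cs \<subseteq> E" using E_derivative_op[OF c] by (auto simp: cs_def)
  have kc_ev: "\<exists>p\<in>polyk. x = ev c p" if "x \<in> kc" for x
  proof -
    have "is_subring (ev c ` polyk)"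
      using is_subringD[OF subring_dpolys[OF k_ring(2), of ?m "{0::nat}"]] unfolding is_subring_def
      by (auto simp: dpoly_eval_diff[symmetric] dpoly_eval_mult[symmetric] image_iff intro: bexI[of _ 1])
    moreover have "k \<union> cs \<subseteq> ev c ` polyk"
    proof
      fix x assume "x \<in> k \<union> cs"
      then show "x \<in> ev c ` polyk"
      proof
        assume "x \<in> k"
        then show ?thesis using dconst_dpolys[of x k ?m "{0::nat}"] by (intro image_eqI[of _ _ "dconst x"]) auto
      next
        assume "x \<in> cs"
        then obtain e where "kys e \<subseteq> {..<?m}" "x = derivative_op ds e c" by (auto simp: cs_def)
        then show ?thesis using dvar_dpolys[OF k_ring(2), of "(0, e)" "{0::nat}"] by (intro image_eqI[of _ _ "dvar (0, e)"]) auto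
      qed
    qed
    ultimately have "kc \<subseteq> ev c ` polyk" unfolding kc_def by (rule rgen_least)
    with that show ?thesis by blast
  qed
  have ev_kc: "ev c p \<in> kc" if "p \<in> polyk" for p
    using that kc by (intro dpoly_eval_closed[OF kc(1) that]) (auto simp: cs_def)
  have kc_op: "f x \<in> kc" if f: "f \<in> ops" and x: "x \<in> kc" for f x
  proof -
    have "cs \<subseteq> {x \<in> kc. f x \<in> kc}"
    proof
      fix x assume x: "x \<in> cs"
      then obtain e where e: "kys e \<subseteq> {..<?m}" "x = derivative_op ds e c" by (auto simp: cs_def)
      have "f x \<in> kc"
      proof (cases "f \<in> set ds")
        case True
        then obtain j where j: "j < ?m" "f = ds ! j" by (auto simp: in_set_conv_nth)
        have "f x = derivative_op ds (e + sgl j 1) c"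
          unfolding e(2) j(2) by (rule derivative_op_add_single[symmetric]) (use j commC in auto)
        moreover have "kys (e + sgl j 1) \<subseteq> {..<?m}" using e(1) j(1) by (simp add: keys_plus_nat)
        ultimately show ?thesis using kc(3) by (auto simp: cs_def)
      next
        case False
        then have "f x = 0 \<or> f x = x" using f x csE E_const[of x f] unfolding ops_def by blast
        then show ?thesis using x kc(3) is_subringD(2)[OF kc(1)] by auto
      qed
      then show "x \<in> {x \<in> kc. f x \<in> kc}" using x kc(3) by blast
    qed
    moreover have "k \<subseteq> {x \<in> kc. f x \<in> kc}" using kc(2) op_closed[OF k_ring(1) f] by blast
    ultimately have "kc \<subseteq> {x \<in> kc. f x \<in> kc}" unfolding kc_def
      by (intro rgen_least subring_preimage[OF subring_rgen f]) simp
    with x show ?thesis by blast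
  qed
  have yR: "y z \<in> R" if "z \<in> dvars ?m N" for z
  proof -
    have "g (fst z) \<in> g ` {..<N}" using that by (auto simp: dvars_def)
    then have "g (fst z) \<in> R" unfolding g using R_generators by auto
    then show ?thesis unfolding y_def by (intro derivative_op_closed) (use op_closed[OF R_ring(1)] in \<open>auto simp: ops_def\<close>)
  qed
  have y_ds: "(ds ! j) (y z) = y (shift z (sgl j 1))" if "j < ?m" for j z
    unfolding y_def shift_def fst_conv snd_conv
    by (rule derivative_op_add_single[symmetric]) (use that commC in auto)
  have dsR': "d x \<in> R'" if d: "d \<in> set ds" and x: "x \<in> R'" for d x
  proof -
    have dop: "d \<in> ops" using d by (simp add: ops_def)
    obtain j where j: "j < ?m" "d = ds ! j" using d by (auto simp: in_set_conv_nth)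
    have "y ` dvars ?m N \<subseteq> {x \<in> R'. d x \<in> R'}"
    proof clarify
      fix z assume z: "z \<in> dvars ?m N"
      then have "shift z (sgl j 1) \<in> dvars ?m N" using j(1) by (simp add: shift_dvars)
      then show "y z \<in> R' \<and> d (y z) \<in> R'" using z R'(3) y_ds[OF j(1)] j(2) by auto
    qed
    moreover have "kc \<subseteq> {x \<in> R'. d x \<in> R'}" using R'(2) kc_op[OF dop] by blast
    ultimately have "R' \<subseteq> {x \<in> R'. d x \<in> R'}" unfolding R'_def
      by (intro rgen_least subring_preimage[OF subring_rgen dop]) simp
    with x show ?thesis by blast
  qed
  have RR': "R \<subseteq> R'"
  proof (rule R_least[OF R'(1)])
    show "d x \<in> R'" if "d \<in> set ds" "x \<in> R'" for d x using dsR'[OF that] .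
    show "k \<subseteq> R'" using kc R' by blast
    have "g i \<in> R'" if "i < N" for i
    proof -
      have "(i, 0) \<in> dvars ?m N" using that by (simp add: dvars_def)
      then have "y (i, 0) \<in> R'" using R'(3) by blast
      then show ?thesis by (simp add: y_def)
    qed
    then have "g ` {..<N} \<subseteq> R'" by auto
    then show "Z $ i $ j \<in> R'" "w * det Z = 1 \<Longrightarrow> w \<in> R'" for i j w unfolding g by auto
  qed
  have opR': "f x \<in> R'" if f: "f \<in> ops" and x: "x \<in> R'" for f x
  proof -
    have "y ` dvars ?m N \<subseteq> {x \<in> R'. f x \<in> R'}" using yR op_closed[OF R_ring(1) f] RR' by blast
    moreover have "kc \<subseteq> {x \<in> R'. f x \<in> R'}" using R'(2) kc_op[OF f] by blast
    ultimately have "R' \<subseteq> {x \<in> R'. f x \<in> R'}" unfolding R'_def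
      by (intro rgen_least subring_preimage[OF subring_rgen f]) simp
    with x show ?thesis by blast
  qed
  \<comment> \<open>\<open>R'\<close> need not be a domain, and generic freeness is only available modulo a prime ideal.\<close>
  have "\<exists>P. prime_ideal_in R' P \<and> (\<forall>d\<in>set ds. d ` P \<subseteq> P) \<and> P \<inter> (kc - {0}) = {}"
  proof (rule prime_differential_ideal_avoiding[OF R'(1)])
    show "is_derivation UNIV d \<and> d ` R' \<subseteq> R'" if "d \<in> set ds" for d using derC dsR' that by blast
    show "\<exists>u\<in>R'. u * of_nat (Suc n) = 1" for n using nat_inverse kc(2) R'(2) by blast
    show "kc - {0} \<subseteq> R'" using R'(2) by blast
    show "1 \<in> kc - {0}" using is_subringD(1)[OF kc(1)] by simp
    show "x * y \<in> kc - {0}" if "x \<in> kc - {0}" "y \<in> kc - {0}" for x y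
    proof -
      obtain p q where "p \<in> polyk" "x = ev c p" "q \<in> polyk" "y = ev c q" using kc_ev \<open>x \<in> _\<close> \<open>y \<in> _\<close> by blast
      then show ?thesis using polyk_domain[OF c] that is_subringD(4)[OF kc(1)] by auto
    qed
  qed simp
  then obtain P where PP: "prime_ideal_in R' P" "\<forall>d\<in>set ds. d ` P \<subseteq> P" "P \<inter> (kc - {0}) = {}"
    by (elim exE conjE) (rule that)
  interpret prime_ideal_in R' P by (rule PP(1))
  note PI = ideal_inD[OF P]
  \<comment> \<open>\<open>generic_fibre\<close> needs a coefficient ring containing
    \<open>P\<close>. This one represents the image of \<open>k{c}\<close> in \<open>R'/P\<close>,
    and \<open>P\<close> meets \<open>kc\<close> only in zero, so nothing of \<open>k{c}\<close> is
    lost.\<close>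
  define D where "D = {x + p | x p. x \<in> kc \<and> p \<in> P}"
  have DI: "x + p \<in> D" if "x \<in> kc" "p \<in> P" for x p
    unfolding D_def using that by (intro CollectI exI[of _ x] exI[of _ p]) simp
  have kcD: "kc \<subseteq> D"
  proof
    fix x assume "x \<in> kc" then show "x \<in> D" using DI[OF _ PI(2), of x] by simp
  qed
  have PD: "P \<subseteq> D"
  proof
    fix p assume "p \<in> P" then show "p \<in> D" using DI[OF is_subringD(2)[OF kc(1)], of p] by simp
  qed
  have Dsub: "is_subring D" unfolding is_subring_def
  proof (intro conjI ballI)
    show "1 \<in> D" using kcD is_subringD(1)[OF kc(1)] by blast
    fix u v assume "u \<in> D" "v \<in> D"
    then obtain x p x' p' where *: "u = x + p" "v = x' + p'" "x \<in> kc" "x' \<in> kc" "p \<in> P" "p' \<in> P" unfolding D_def by blast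
    have "u - v = (x - x') + (p - p')" using * by simp
    then show "u - v \<in> D" using DI[OF is_subringD(3)[OF kc(1) *(3,4)] ideal_in_neg(2)[OF S P *(5,6)]] by simp
    have "x \<in> R'" "x' \<in> R'" "p \<in> R'" using * R'(2) PI(1) by blast+
    then have pp: "x * p' + (p * x' + p * p') \<in> P"
      using * by (intro PI(3) PI(4)[of x] PI(5)[of x' p] PI(4)[of p])
    have "u * v = x * x' + (x * p' + (p * x' + p * p'))" using * by (simp add: algebra_simps)
    then show "u * v \<in> D" using DI[OF is_subringD(4)[OF kc(1) *(3,4)] pp] by simp
  qed
  have DR': "D \<subseteq> R'"
  proof
    fix u assume "u \<in> D"
    then obtain x p where "u = x + p" "x \<in> kc" "p \<in> P" unfolding D_def by blast
    then show "u \<in> R'" using subsetD[OF R'(2), of x] subsetD[OF PI(1), of p] is_subringD(6)[OF R'(1), of x p] by simp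
  qed
  interpret diff_generated R' P D ds N y
  proof
    show "is_subring D" "D \<subseteq> R'" by fact+
    show "R' = rgen (D \<union> y ` dvars ?m N)"
    proof
      show "R' \<subseteq> rgen (D \<union> y ` dvars ?m N)" unfolding R'_def
        using kcD rgen_base[of "D \<union> y ` dvars ?m N"] by (intro rgen_mono) blast
      show "rgen (D \<union> y ` dvars ?m N) \<subseteq> R'" using DR' R'(3) by (intro rgen_least[OF R'(1)]) blast
    qed
    show "is_derivation R' d" if "d \<in> set ds" for d
      using derC[OF that] dsR'[OF that] by (auto simp: is_derivation_def)
    show "d ` D \<subseteq> D" if d: "d \<in> set ds" for d
    proof
      fix u assume "u \<in> d ` D"
      then obtain x p where "u = d (x + p)" "x \<in> kc" "p \<in> P" unfolding D_def by blast
      then show "u \<in> D" using DI[of "d x" "d p"] kc_op[of d x] bspec[OF PP(2) d] d op_add(1)[of d x p] by (auto simp: ops_def)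
    qed
    show "d ` P \<subseteq> P" if "d \<in> set ds" for d using bspec[OF PP(2) that] .
    show "(ds ! j) (y z) = y (shift z (sgl j 1))" if "z \<in> dvars ?m N" "j < ?m" for z j by (rule y_ds[OF that(2)])
    show "s \<in> P" if "s \<in> R'" "of_nat (Suc n) * s \<in> P" for s n
      using kc R' by (intro nat_cancel[OF _ _ that] P) blast
  qed
  obtain v where v: "v \<in> D - P" "\<forall>q. ideal_in D q \<and> P \<subseteq> q \<and> (\<forall>n. v ^ n \<notin> q) \<longrightarrow> 1 \<notin> iext q R'"
    using generic_fibre[OF PD] by (rule bexE)
  \<comment> \<open>The specialisation has to stay inside the open set given by \<open>v\<close>.
    Modulo \<open>P\<close>, \<open>v\<close> is the value at \<open>c\<close> of a polynomial
    \<open>pv\<close> over \<open>k\<close>; a component \<open>f x0\<close> of it that does not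
    vanish at \<open>c\<close> is multiplied into the inequation for \<open>a\<close>.\<close>
  obtain v0 p0 where v0: "v = v0 + p0" "v0 \<in> kc" "p0 \<in> P" using v(1) unfolding D_def by blast
  have "v0 \<noteq> 0" using v(1) v0 by auto
  obtain pv where pv: "pv \<in> polyk" "v0 = ev c pv" using kc_ev[OF v0(2)] by blast
  obtain X f where X: "finite X" "\<forall>x\<in>X. f x \<in> polyC" "\<forall>c. ev c pv = (\<Sum>x\<in>X. x * ev c (f x))"
    "\<forall>c\<in>E. ev c pv = 0 \<longrightarrow> (\<forall>x\<in>X. ev c (f x) = 0)" using components[OF pv(1)] by (elim exE conjE) (rule that)
  have "\<exists>x\<in>X. ev c (f x) \<noteq> 0"
    using \<open>v0 \<noteq> 0\<close> pv(2) X(3) by (metis (no_types, lifting) mult_zero_right sum.neutral)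
  then obtain x0 where x0: "x0 \<in> X" "ev c (f x0) \<noteq> 0" by blast
  obtain Ps h where Ps: "finite Ps" "Ps \<subseteq> polyC" "h \<in> polyC" "\<forall>p\<in>Ps. ev c p = 0" "ev c h \<noteq> 0"
    "\<forall>a\<in>C. (\<forall>p\<in>Ps. ev a p = 0) \<longrightarrow> ev a h \<noteq> 0 \<longrightarrow> (\<forall>p\<in>polyC. ev c p = 0 \<longrightarrow> ev a p = 0)"
    using finite_presentation[OF c] by (elim exE conjE) (rule that)
  have hf: "h * f x0 \<in> polyC" using is_subringD(4)[OF subring_dpolys[OF C_subring] Ps(3) bspec[OF X(2) x0(1)]] .
  have "ev c (h * f x0) \<noteq> 0"
    using E_no_zero_divisors[OF ev_E[OF c Ps(3)] ev_E[OF c bspec[OF X(2) x0(1)]]] Ps(5) x0(2) by (auto simp: dpoly_eval_mult)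
  with transfer[OF c Ps(1,2) hf] Ps(4) obtain a where a: "a \<in> C" "\<forall>p\<in>Ps. ev a p = 0" "ev a (h * f x0) \<noteq> 0"
    by blast
  have aE: "a \<in> E" using a(1) C_le by blast
  have ah: "ev a h \<noteq> 0" "ev a (f x0) \<noteq> 0" using a(3) by (auto simp: dpoly_eval_mult)
  \<comment> \<open>This makes \<open>p(c) \<mapsto> p(a)\<close> well defined on
    \<open>k{c}\<close>: the components of a relation over \<open>k\<close> are relations over
    \<open>C\<close>, and those are inherited by \<open>a\<close>.\<close>
  have spec: "ev a p = 0" if p: "p \<in> polyk" "ev c p = 0" for p
  proof -
    obtain Y f' where Y: "\<forall>x\<in>Y. f' x \<in> polyC" "\<forall>c. ev c p = (\<Sum>x\<in>Y. x * ev c (f' x))"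
      "\<forall>c\<in>E. ev c p = 0 \<longrightarrow> (\<forall>x\<in>Y. ev c (f' x) = 0)" using components[OF p(1)] by (elim exE conjE) (rule that)
    have "ev a (f' x) = 0" if "x \<in> Y" for x
      using Ps(6) a(1,2) ah(1) Y(1,3) c p(2) that by blast
    then show ?thesis using Y(2) by simp
  qed
  have pva: "ev a pv \<noteq> 0" using X(4) aE x0(1) ah(2) by blast
  \<comment> \<open>The preimage in \<open>D\<close> of the kernel of the specialisation from
    \<open>k{c}\<close> to \<open>k\<close>.\<close>
  define q where "q = {ev c p + r | p r. p \<in> polyk \<and> ev a p = 0 \<and> r \<in> P}"
  have qI: "ev c p + r \<in> q" if "p \<in> polyk" "ev a p = 0" "r \<in> P" for p r
    unfolding q_def using that by (intro CollectI exI[of _ p] exI[of _ r]) simp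
  note polyk_ring = is_subringD[OF subring_dpolys[OF k_ring(2), of ?m "{0::nat}"]]
  have q: "ideal_in D q" unfolding ideal_in_def
  proof (intro conjI ballI)
    show "q \<subseteq> D" using DI[OF ev_kc] unfolding q_def by blast
    show "0 \<in> q" using qI[OF polyk_ring(2) _ PI(2)] by simp
    fix u assume "u \<in> q"
    then obtain p r where u: "u = ev c p + r" "p \<in> polyk" "ev a p = 0" "r \<in> P" unfolding q_def by blast
    { fix u' assume "u' \<in> q"
      then obtain p' r' where u': "u' = ev c p' + r'" "p' \<in> polyk" "ev a p' = 0" "r' \<in> P" unfolding q_def by blast
      have "u + u' = ev c (p + p') + (r + r')" using u u' by (simp add: dpoly_eval_add)
      then show "u + u' \<in> q" using qI[OF polyk_ring(6)[OF u(2) u'(2)] _ PI(3)[OF u(4) u'(4)]] u(3) u'(3)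
        by (simp add: dpoly_eval_add) }
    have uR': "u \<in> R'"
      unfolding u(1) by (rule is_subringD(6)[OF R'(1) subsetD[OF R'(2) ev_kc[OF u(2)]] subsetD[OF PI(1) u(4)]])
    { fix w assume "w \<in> D"
      then obtain x s where w: "w = x + s" "x \<in> kc" "s \<in> P" unfolding D_def by blast
      obtain p' where p': "p' \<in> polyk" "x = ev c p'" using kc_ev[OF w(2)] by blast
      have "w * u = ev c (p' * p) + (x * r + s * u)" using w u p' by (simp add: dpoly_eval_mult algebra_simps)
      moreover have "x * r + s * u \<in> P"
        using PI(3)[OF PI(4)[OF subsetD[OF R'(2) w(2)] u(4)] PI(5)[OF uR' w(3)]] .
      ultimately show "w * u \<in> q"
        using qI[OF polyk_ring(4)[OF p'(1) u(2)]] u(3) by (simp add: dpoly_eval_mult) }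
  qed
  have Pq: "P \<subseteq> q"
  proof
    fix r assume "r \<in> P" then show "r \<in> q" using qI[OF polyk_ring(2), of r] by simp
  qed
  \<comment> \<open>If \<open>v ^ n\<close> were in \<open>q\<close>, then \<open>pv ^ n\<close> and
    some \<open>p\<close> vanishing at \<open>a\<close> would have values at \<open>c\<close> that
    differ by an element of \<open>P\<close> in \<open>kc\<close>, that is, not at all. By
    \<open>spec\<close> they would agree at \<open>a\<close>, where \<open>pv\<close> is a nonzero
    element of the field \<open>k\<close>.\<close>
  have "v ^ n \<notin> q" for n
  proof
    assume "v ^ n \<in> q"
    then obtain p r where u: "v ^ n = ev c p + r" "p \<in> polyk" "ev a p = 0" "r \<in> P" unfolding q_def by blast
    have pn: "pv ^ n - p \<in> polyk" using polyk_ring(3)[OF subring_power[OF subring_dpolys[OF k_ring(2)] pv(1)] u(2)] .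
    have "v - v0 \<in> P" using v0 by simp
    then have "v ^ n - v0 ^ n \<in> P"
      using ideal_in_power_diff[OF S P, of v v0 n] v(1) DR' v0(2) R'(2) by blast
    from ideal_in_neg(2)[OF S P u(4) this] have "r - (v ^ n - v0 ^ n) \<in> P" .
    moreover have "r - (v ^ n - v0 ^ n) = ev c (pv ^ n - p)"
      using u(1) pv(2) by (simp add: dpoly_eval_diff dpoly_eval_power)
    ultimately have "ev c (pv ^ n - p) = 0" using PP(3) ev_kc[OF pn] by auto
    from spec[OF pn this] have "ev a pv ^ n = 0" using u(3) by (simp add: dpoly_eval_diff dpoly_eval_power)
    moreover have "ev a pv ^ i \<noteq> 0" for i
    proof (induction i)
      case (Suc i)
      then show ?case
        using k_no_zero_divisors[OF ev_k[OF a(1) pv(1)] subring_power[OF k_ring(2) ev_k[OF a(1) pv(1)]]] pva by auto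
    qed simp
    ultimately show False by blast
  qed
  with v(2) q Pq have one: "1 \<notin> iext q R'" by simp
  \<comment> \<open>Unlike \<open>q\<close>, the set \<open>q0\<close> consists of \<open>\<Sigma>\<Delta>\<close>-constants, so the ideal it generates is \<open>\<Sigma>\<Delta>\<Pi>\<close>-stable.\<close>
  define q0 where "q0 = {ev c p | p. p \<in> polyC \<and> ev a p = 0}"
  have q0E: "q0 \<subseteq> E" using ev_E[OF c] by (auto simp: q0_def)
  have q0q: "q0 \<subseteq> q" using qI[OF _ _ PI(2)] polyC_k by (force simp: q0_def)
  have q0R': "q0 \<subseteq> R'" using q0q ideal_inD(1)[OF q] DR' by blast
  have q0d: "d x \<in> q0" if d: "d \<in> set ds" and x: "x \<in> q0" for d x
  proof -
    obtain j where j: "j < ?m" "d = ds ! j" using d by (auto simp: in_set_conv_nth)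
    obtain p where p: "p \<in> polyC" "x = ev c p" "ev a p = 0" using x unfolding q0_def by blast
    have "is_derivation polyC (dpoly_deriv d j)"
      using derivation_dpoly_deriv[OF derC[OF d] C_subring C_ds[OF d] j(1)] .
    then have "dpoly_deriv d j p \<in> polyC" using p(1) by (auto simp: is_derivation_def)
    moreover have "ev c (dpoly_deriv d j p) = d x" "ev a (dpoly_deriv d j p) = 0"
      using ev_deriv[OF j(1)] p j(2) der_simps(3)[of d] d by auto
    ultimately show ?thesis unfolding q0_def by force
  qed
  have I': "ideal_in R' (iext q0 R')" by (rule ideal_iext[OF R'(1) q0R'])
  have opI: "f x \<in> iext q0 R'" if f: "f \<in> ops" and x: "x \<in> iext q0 R'" for f x
    using x
  proof induction
    case zero
    then show ?case using op_add(3)[OF f] iext.zero by simp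
  next
    case (step x t u)
    have t: "f t \<in> R'" by (rule opR'[OF f step(2)])
    have x: "x \<in> E" using step(1) q0E by blast
    consider "f \<in> \<Sigma>" | "f \<in> \<Delta>" | "f \<in> set ds" using f by (auto simp: ops_def)
    then show ?case
    proof cases
      case 1
      then have "f (x * t + u) = x * f t + f u" using aut_simps[OF 1] E_const(2)[OF x 1] by simp
      then show ?thesis using iext.step[OF step(1) t step(4)] by simp
    next
      case 2
      then have "f (x * t + u) = x * f t + f u" using der_simps[of f] E_const(1)[OF x 2] by simp
      then show ?thesis using iext.step[OF step(1) t step(4)] by simp
    next
      case 3
      then have "f (x * t + u) = f x * t + (x * f t + f u)" using der_simps[of f] by (simp add: add.assoc)
      then show ?thesis using iext.step[OF q0d[OF 3 step(1)] step(2) iext.step[OF step(1) t step(4)]] by simp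
    qed
  qed
  let ?I = "iext q0 R' \<inter> R"
  have "sdp_ideal \<Sigma> \<Delta> ds R ?I"
  proof (rule sdp_idealI)
    show "ideal_in R ?I" unfolding ideal_in_def
      using ideal_inD[OF I'] is_subringD[OF R_ring(2)] RR' by auto
    show "f x \<in> ?I" if "f \<in> ops" "x \<in> ?I" for f x
      using that opI op_closed[OF R_ring(1) that(1)] by auto
  qed
  moreover have "1 \<notin> ?I" using one iext_mono[OF q0q order.refl] by blast
  ultimately have I0: "?I = {0}" by (rule simple)
  obtain r s t where r: "r \<in> R" "s \<in> nonzerodivisors R" "c * s = r" "s * t = 1" by (rule quotient_form)
  have s: "s \<in> R" using r(2) by (simp add: nonzerodivisors_def)
  have "c - a \<in> q0"
  proof -
    let ?p = "dvar (0, 0) - dconst a :: (nat, 'a) dpoly"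
    have "?p \<in> polyC"
      using dvar_dpolys[OF C_subring, of "(0, 0)" "{0::nat}" ?m] dconst_dpolys[OF a(1)]
      by (intro is_subringD(3)[OF subring_dpolys[OF C_subring]]) auto
    moreover have "ev c ?p = c - a" "ev a ?p = 0" by (simp_all add: dpoly_eval_diff)
    ultimately show ?thesis unfolding q0_def by force
  qed
  then have "(c - a) * s + 0 \<in> iext q0 R'" using s RR' by (intro iext.step iext.zero) auto
  \<comment> \<open>The denominator \<open>s\<close> brings the element into \<open>R\<close>:
    \<open>c * s\<close> is the numerator \<open>r\<close>, and \<open>a * s\<close> lies in
    \<open>R\<close> because \<open>a\<close> is in \<open>k\<close>.\<close>
  moreover have "(c - a) * s \<in> R"
    using r s a(1) C_le R_ring(3) is_subringD[OF R_ring(2)] by (auto simp: left_diff_distrib)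
  ultimately have "(c - a) * s = 0" using I0 by auto
  then have "c - a = 0" using r(4) by (metis mult.assoc mult_1_right mult_zero_left)
  then show ?thesis using a(1) by simp
qed

end

section \<open>Automorphisms and their matrices\<close>

lemma map_matrix_mult:
  fixes M N :: "'a::comm_ring_1 ^ 'n::finite ^ 'n" and f :: "'a \<Rightarrow> 'a"
  assumes add: "\<And>x y. f (x + y) = f x + f y" and mult: "\<And>x y. f (x * y) = f x * f y"
  shows "map_matrix f (M ** N) = map_matrix f M ** map_matrix f N"
proof -
  have z: "f 0 = 0" using add[of 0 0] by simp
  have "f (sum g I) = (\<Sum>i\<in>I. f (g i))" for g :: "'n \<Rightarrow> 'a" and I
    by (induction I rule: infinite_finite_induct) (auto simp: z add)
  then show ?thesis by (simp add: map_matrix_def matrix_matrix_mult_def vec_eq_iff mult)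
qed

lemma map_matrix_deriv_mult:
  fixes M N :: "'a::comm_ring_1 ^ 'n::finite ^ 'n" and f :: "'a \<Rightarrow> 'a"
  assumes add: "\<And>x y. f (x + y) = f x + f y" and mult: "\<And>x y. f (x * y) = f x * y + x * f y"
  shows "map_matrix f (M ** N) = map_matrix f M ** N + M ** map_matrix f N"
proof -
  have z: "f 0 = 0" using add[of 0 0] by simp
  have "f (sum g I) = (\<Sum>i\<in>I. f (g i))" for g :: "'n \<Rightarrow> 'a" and I
    by (induction I rule: infinite_finite_induct) (auto simp: z add)
  then show ?thesis by (simp add: map_matrix_def matrix_matrix_mult_def vec_eq_iff mult sum.distrib)
qed

lemma map_matrix_nth [simp]: "map_matrix f M $ i $ j = f (M $ i $ j)"
  by (simp add: map_matrix_def)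

lemma mats_mult: "is_subring X \<Longrightarrow> M \<in> mats X \<Longrightarrow> N \<in> mats X \<Longrightarrow> M ** N \<in> mats X"
  by (auto simp: mats_def matrix_matrix_mult_def intro!: subring_sum is_subringD)

lemma det_in_subring:
  assumes X: "is_subring X" and M: "M \<in> mats X"
  shows "det M \<in> X"
  unfolding det_def
proof (intro subring_sum[OF X] is_subringD(4)[OF X] subring_prod[OF X])
  fix p :: "'b \<Rightarrow> 'b"
  show "of_int (sign p) \<in> X" using is_subringD(1,5)[OF X] by (auto simp: sign_def)
  show "M $ i $ p i \<in> X" for i using M by (simp add: mats_def)
qed

lemma mat_one_mats: "is_subring X \<Longrightarrow> mat 1 \<in> mats X"
  by (auto simp: mats_def mat_def intro: is_subringD)

lemma group_GL:
  assumes X: "is_subring X"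
  shows "group (GL X :: ('a::comm_ring_1 ^ 'n::finite ^ 'n) monoid)"
proof (rule groupI)
  fix M N assume "M \<in> carrier (GL X :: ('a ^ 'n ^ 'n) monoid)" "N \<in> carrier (GL X :: ('a ^ 'n ^ 'n) monoid)"
  then obtain M' N' where *: "M \<in> mats X" "N \<in> mats X" "M' \<in> mats X" "N' \<in> mats X"
    "M ** M' = mat 1" "M' ** M = mat 1" "N ** N' = mat 1" "N' ** N = mat 1" by (auto simp: GL_def)
  have "(M ** N) ** (N' ** M') = M ** (N ** N') ** M'" "(N' ** M') ** (M ** N) = N' ** (M' ** M) ** N"
    by (simp_all add: matrix_mul_assoc)
  then have "(M ** N) ** (N' ** M') = mat 1" "(N' ** M') ** (M ** N) = mat 1"
    using * by simp_all
  then show "M \<otimes>\<^bsub>GL X\<^esub> N \<in> carrier (GL X)" using * mats_mult[OF X]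
    by (auto simp: GL_def intro!: bexI[of _ "N' ** M'"])
next
  show "\<one>\<^bsub>GL X\<^esub> \<in> carrier (GL X)" using mat_one_mats[OF X] by (auto simp: GL_def intro!: bexI[of _ "mat 1"])
next
  fix M assume "M \<in> carrier (GL X :: ('a ^ 'n ^ 'n) monoid)"
  then show "\<exists>N\<in>carrier (GL X). N \<otimes>\<^bsub>GL X\<^esub> M = \<one>\<^bsub>GL X\<^esub>" by (auto simp: GL_def)
qed (auto simp: GL_def matrix_mul_assoc)

lemma dpoly_eval_prod: "dpoly_eval ds a (prod f I) = (\<Prod>i\<in>I. dpoly_eval ds a (f i))"
  by (induction I rule: infinite_finite_induct) (auto simp: dpoly_eval_mult)

section \<open>Extension of homomorphisms to localisations\<close>

context pv_extension
begin

definition op_hom :: "'a set \<Rightarrow> ('a \<Rightarrow> 'a) \<Rightarrow> bool" where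
  "op_hom X \<phi> \<longleftrightarrow> \<phi> 1 = 1 \<and> (\<forall>x\<in>X. \<forall>y\<in>X. \<phi> (x + y) = \<phi> x + \<phi> y \<and> \<phi> (x * y) = \<phi> x * \<phi> y) \<and>
     (\<forall>f\<in>ops. \<forall>x\<in>X. \<phi> (f x) = f (\<phi> x))"

lemma op_homD:
  assumes "op_hom X \<phi>"
  shows "\<phi> 1 = 1" "\<And>x y. x \<in> X \<Longrightarrow> y \<in> X \<Longrightarrow> \<phi> (x + y) = \<phi> x + \<phi> y"
    "\<And>x y. x \<in> X \<Longrightarrow> y \<in> X \<Longrightarrow> \<phi> (x * y) = \<phi> x * \<phi> y"
    "\<And>f x. f \<in> ops \<Longrightarrow> x \<in> X \<Longrightarrow> \<phi> (f x) = f (\<phi> x)"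
  using assms by (simp_all add: op_hom_def)

lemma op_hom_diff:
  assumes h: "op_hom X \<phi>" and X: "is_subring X"
  shows "\<phi> 0 = 0" "\<And>x y. x \<in> X \<Longrightarrow> y \<in> X \<Longrightarrow> \<phi> (x - y) = \<phi> x - \<phi> y"
proof -
  note X' = is_subringD[OF X]
  show 0: "\<phi> 0 = 0" using op_homD(2)[OF h X'(2) X'(2)] by simp
  show "\<phi> (x - y) = \<phi> x - \<phi> y" if "x \<in> X" "y \<in> X" for x y
    using op_homD(2)[OF h X'(3)[OF that] that(2)] by simp
qed

lemma unit_cancel: "(u::'a) * v = 1 \<Longrightarrow> x * u = y * u \<Longrightarrow> x = y"
  by (metis mult.assoc mult_1_right)

text \<open>Serves both to adjoin the inverse of \<open>det Z\<close> and to pass from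
  \<open>R\<close> to \<open>K\<close>. The value at \<open>y\<close> must satisfy
  \<open>\<psi> y * \<phi> t = \<phi> (y * t)\<close> for a denominator \<open>t\<close> that stays
  invertible under \<open>\<phi>\<close>; such an equation determines \<open>\<psi> y\<close>, and
  cross multiplication shows that all admissible denominators give the same value.\<close>

theorem extend_to_localization:
  assumes X: "is_subring X" "\<And>f x. f \<in> ops \<Longrightarrow> x \<in> X \<Longrightarrow> f x \<in> X" and h: "op_hom X \<phi>"
    and Y: "\<And>f x. f \<in> ops \<Longrightarrow> x \<in> Y \<Longrightarrow> f x \<in> Y" "is_subring Y"
    and den: "\<And>y. y \<in> Y \<Longrightarrow> \<exists>t\<in>X. y * t \<in> X \<and> t dvd 1 \<and> \<phi> t dvd 1"
  shows "\<exists>\<psi>. op_hom Y \<psi> \<and> (\<forall>x\<in>X \<inter> Y. \<psi> x = \<phi> x)"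
proof -
  note X' = is_subringD[OF X(1)] and h' = op_homD[OF h]
  define T where "T = {t \<in> X. t dvd 1 \<and> \<phi> t dvd 1}"
  define \<psi> where "\<psi> y = (SOME z. \<exists>t\<in>T. y * t \<in> X \<and> z * \<phi> t = \<phi> (y * t))" for y
  have Tmult: "s * t \<in> T" if "s \<in> T" "t \<in> T" for s t
    using that X'(4) h'(3) mult_dvd_mono[of s 1 t 1] mult_dvd_mono[of "\<phi> s" 1 "\<phi> t" 1] by (auto simp: T_def)
  have Tcancel: "x = y" if t: "t \<in> T" and e: "x * \<phi> t = y * \<phi> t" for x y t
  proof -
    obtain v where "\<phi> t * v = 1" using t by (auto simp: T_def dvd_def)
    then show ?thesis using unit_cancel e by blast
  qed
  have key0: "\<exists>t\<in>T. y * t \<in> X \<and> \<psi> y * \<phi> t = \<phi> (y * t)" if y: "y \<in> Y" for y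
  proof -
    obtain t where t: "t \<in> X" "y * t \<in> X" "t dvd 1" "\<phi> t dvd 1" using den[OF y] by blast
    then obtain v where v: "\<phi> t * v = 1" by (auto simp: dvd_def)
    have "(\<phi> (y * t) * v) * \<phi> t = \<phi> (y * t) * (\<phi> t * v)" by (simp only: mult_ac)
    then have "(\<phi> (y * t) * v) * \<phi> t = \<phi> (y * t)" using v by simp
    moreover have "t \<in> T" using t by (simp add: T_def)
    ultimately have "\<exists>z. \<exists>t\<in>T. y * t \<in> X \<and> z * \<phi> t = \<phi> (y * t)" using t(2) by blast
    then show ?thesis unfolding \<psi>_def by (rule someI_ex)
  qed
  have key: "\<psi> y * \<phi> t = \<phi> (y * t)" if y: "y \<in> Y" and t: "t \<in> T" "y * t \<in> X" for y t
  proof -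
    obtain s where s: "s \<in> T" "y * s \<in> X" "\<psi> y * \<phi> s = \<phi> (y * s)" using key0[OF y] by blast
    have st: "s \<in> X" "t \<in> X" using s(1) t(1) by (auto simp: T_def)
    have "(\<psi> y * \<phi> t) * \<phi> s = \<phi> (y * s) * \<phi> t" unfolding s(3)[symmetric] by (simp only: mult_ac)
    also have "\<dots> = \<phi> ((y * s) * t)" using h'(3)[OF s(2) st(2)] by simp
    also have "(y * s) * t = (y * t) * s" by (simp add: mult_ac)
    also have "\<phi> ((y * t) * s) = \<phi> (y * t) * \<phi> s" by (rule h'(3)[OF t(2) st(1)])
    finally show ?thesis by (rule Tcancel[OF s(1)])
  qed
  have oneT: "1 \<in> T" using X'(1) h'(1) by (simp add: T_def)
  have agree: "\<psi> x = \<phi> x" if "x \<in> X" "x \<in> Y" for x using key[OF that(2) oneT] that(1) h'(1) by simp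
  have "op_hom Y \<psi>" unfolding op_hom_def
  proof (intro conjI ballI)
    show "\<psi> 1 = 1" using agree[OF X'(1) is_subringD(1)[OF Y(2)]] h'(1) by simp
  next
    fix x y assume xy: "x \<in> Y" "y \<in> Y"
    obtain s where s: "s \<in> T" "x * s \<in> X" "\<psi> x * \<phi> s = \<phi> (x * s)" using key0[OF xy(1)] by blast
    obtain t where t: "t \<in> T" "y * t \<in> X" "\<psi> y * \<phi> t = \<phi> (y * t)" using key0[OF xy(2)] by blast
    have st: "s \<in> X" "t \<in> X" using s(1) t(1) by (auto simp: T_def)
    have e1: "(x + y) * (s * t) = (x * s) * t + (y * t) * s" "(x * y) * (s * t) = (x * s) * (y * t)"
      by (simp_all add: algebra_simps)
    have in1: "(x * s) * t \<in> X" "(y * t) * s \<in> X" "(x * s) * (y * t) \<in> X" using s t st X'(4) by auto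
    have p: "\<phi> (s * t) = \<phi> s * \<phi> t" by (rule h'(3)[OF st])
    have "\<psi> (x + y) * \<phi> (s * t) = \<phi> ((x + y) * (s * t))"
      using in1 by (intro key is_subringD(6)[OF Y(2)] xy Tmult s t) (simp add: e1 X'(6))
    also have "\<dots> = \<phi> (x * s) * \<phi> t + \<phi> (y * t) * \<phi> s"
      unfolding e1 using h'(2)[OF in1(1,2)] h'(3)[OF s(2) st(2)] h'(3)[OF t(2) st(1)] by simp
    also have "\<dots> = (\<psi> x + \<psi> y) * \<phi> (s * t)" unfolding p s(3)[symmetric] t(3)[symmetric] by (simp add: algebra_simps)
    finally show "\<psi> (x + y) = \<psi> x + \<psi> y" by (rule Tcancel[OF Tmult[OF s(1) t(1)]])
    have "\<psi> (x * y) * \<phi> (s * t) = \<phi> ((x * y) * (s * t))"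
      using in1 by (intro key is_subringD(4)[OF Y(2)] xy Tmult s t) (simp add: e1)
    also have "\<dots> = \<phi> (x * s) * \<phi> (y * t)" unfolding e1 using h'(3)[OF s(2) t(2)] .
    also have "\<dots> = (\<psi> x * \<psi> y) * \<phi> (s * t)" unfolding p s(3)[symmetric] t(3)[symmetric] by (simp add: algebra_simps)
    finally show "\<psi> (x * y) = \<psi> x * \<psi> y" by (rule Tcancel[OF Tmult[OF s(1) t(1)]])
  next
    fix f y assume f: "f \<in> ops" and y: "y \<in> Y"
    obtain t where t: "t \<in> T" "y * t \<in> X" "\<psi> y * \<phi> t = \<phi> (y * t)" using key0[OF y] by blast
    have tX: "t \<in> X" using t(1) by (simp add: T_def)
    have fy: "f y \<in> Y" by (rule Y(1)[OF f y])
    show "\<psi> (f y) = f (\<psi> y)"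
    proof (cases "f \<in> \<Sigma>")
      case True
      note a = aut_simps[OF True]
      obtain u v where "t * u = 1" "\<phi> t * v = 1" using t(1) by (auto simp: T_def dvd_def)
      then have "f t * f u = 1" "f (\<phi> t) * f v = 1" using a(2)[of t u] a(2)[of "\<phi> t" v] a(3) by simp_all
      then have "f t dvd 1" "\<phi> (f t) dvd 1" using h'(4)[OF f tX] unfolding dvd_def by metis+
      then have ft: "f t \<in> T" using X(2)[OF f tX] by (simp add: T_def)
      have "\<psi> (f y) * \<phi> (f t) = \<phi> (f y * f t)"
        by (rule key[OF fy ft]) (use X(2)[OF f t(2)] a(2)[of y t] in simp)
      also have "\<dots> = f (\<phi> (y * t))" using h'(4)[OF f t(2)] a(2)[of y t] by simp
      also have "\<dots> = f (\<psi> y) * \<phi> (f t)" unfolding t(3)[symmetric] a(2) h'(4)[OF f tX] ..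
      finally show ?thesis by (rule Tcancel[OF ft])
    next
      case False
      then have d: "f \<in> \<Delta> \<union> set ds" using f by (simp add: ops_def)
      note a = der_simps[OF d]
      \<comment> \<open>Quotient rule with the denominator \<open>t * t\<close>, written without
        division.\<close>
      have e: "f y * (t * t) = f (y * t) * t - (y * t) * f t" by (simp add: a algebra_simps)
      have in1: "f (y * t) * t \<in> X" "(y * t) * f t \<in> X" "f (y * t) \<in> X" "f t \<in> X"
        using X(2)[OF f] t(2) tX X'(4) by auto
      have p: "\<phi> (t * t) = \<phi> t * \<phi> t" by (rule h'(3)[OF tX tX])
      have "\<psi> (f y) * \<phi> (t * t) = \<phi> (f y * (t * t))"
        using in1 by (intro key fy Tmult t) (simp add: e X'(3))
      also have "\<dots> = f (\<phi> (y * t)) * \<phi> t - \<phi> (y * t) * f (\<phi> t)"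
        unfolding e using op_hom_diff(2)[OF h X(1) in1(1,2)] h'(3)[OF in1(3) tX] h'(3)[OF t(2) in1(4)]
          h'(4)[OF f t(2)] h'(4)[OF f tX] by simp
      also have "\<dots> = f (\<psi> y) * \<phi> (t * t)" unfolding p t(3)[symmetric] by (simp add: a algebra_simps)
      finally show ?thesis by (rule Tcancel[OF Tmult[OF t(1) t(1)]])
    qed
  qed
  then show ?thesis using agree by blast
qed

section \<open>The matrix of an automorphism\<close>

definition Zi :: "'a ^ 'n ^ 'n" where
  "Zi = (SOME N. N \<in> mats R \<and> Z ** N = mat 1 \<and> N ** Z = mat 1)"

lemma Zi: "Zi \<in> mats R" "Z ** Zi = mat 1" "Zi ** Z = mat 1" "Z \<in> mats R"
proof -
  have Z: "Z \<in> carrier (GL R)" using R unfolding pv_ring_def by blast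
  then have "\<exists>N. N \<in> mats R \<and> Z ** N = mat 1 \<and> N ** Z = mat 1" by (auto simp: GL_def)
  from someI_ex[OF this] show "Zi \<in> mats R" "Z ** Zi = mat 1" "Zi ** Z = mat 1" by (simp_all add: Zi_def)
  show "Z \<in> mats R" using Z by (simp add: GL_def)
qed

lemma Z_ops: "\<sigma> \<in> \<Sigma> \<Longrightarrow> map_matrix \<sigma> Z = A \<sigma> ** Z" "\<delta> \<in> \<Delta> \<Longrightarrow> map_matrix \<delta> Z = B \<delta> ** Z"
  using R unfolding pv_ring_def by blast+

lemma Z_cancel: "Z ** M = Z ** N \<Longrightarrow> M = N"
  by (metis Zi(3) matrix_mul_assoc matrix_mul_lid)

abbreviation "Aut \<equiv> carrier (aut_group \<Sigma> \<Delta> ds k)"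

lemma AutD:
  assumes "\<phi> \<in> Aut"
  shows "bij \<phi>" "op_hom UNIV \<phi>" "\<And>x. x \<in> k \<Longrightarrow> \<phi> x = x"
  using assms by (auto simp: aut_group_def is_automorphism_def op_hom_def ops_def)

lemma AutI: "bij \<phi> \<Longrightarrow> op_hom UNIV \<phi> \<Longrightarrow> (\<And>x. x \<in> k \<Longrightarrow> \<phi> x = x) \<Longrightarrow> \<phi> \<in> Aut"
  by (auto simp: aut_group_def is_automorphism_def op_hom_def ops_def)

lemma map_fixed: "(\<And>x. x \<in> X \<Longrightarrow> f x = x) \<Longrightarrow> M \<in> mats X \<Longrightarrow> map_matrix f M = M"
  by (simp add: vec_eq_iff mats_def)

lemma A_B: "\<sigma> \<in> \<Sigma> \<Longrightarrow> A \<sigma> \<in> mats k" "\<sigma> \<in> \<Sigma> \<Longrightarrow> \<exists>N. N ** A \<sigma> = mat 1" "\<delta> \<in> \<Delta> \<Longrightarrow> B \<delta> \<in> mats k"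
  using system by (auto simp: sd_linear_system_def GL_def)

definition \<mu> :: "('a \<Rightarrow> 'a) \<Rightarrow> 'a ^ 'n ^ 'n" where "\<mu> \<phi> = Zi ** map_matrix \<phi> Z"

lemma Z_mu: "map_matrix \<phi> Z = Z ** \<mu> \<phi>"
  by (simp add: \<mu>_def matrix_mul_assoc Zi(2))

lemma mats_E: "M \<in> mats E \<longleftrightarrow> (\<forall>\<sigma>\<in>\<Sigma>. map_matrix \<sigma> M = M) \<and> (\<forall>\<delta>\<in>\<Delta>. map_matrix \<delta> M = 0)"
  by (auto simp: mats_def E_iff vec_eq_iff)

lemma mats_C_E: "mats C = mats E"
  using constants C_le by (auto simp: mats_def)

text \<open>\<open>\<phi>\<close> fixes the matrices \<open>A\<close> and \<open>B\<close> of the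
  system and commutes with the operators, so \<open>\<phi>\<close> applied to \<open>Z\<close>
  solves the same system as \<open>Z\<close>. Comparison shows that \<open>\<mu> \<phi>\<close> is
  fixed by \<Sigma> and killed by \<Delta>, and \<open>constants\<close> moves its entries into
  \<open>C\<close>.\<close>

lemma mu_mats:
  assumes \<phi>: "\<phi> \<in> Aut"
  shows "\<mu> \<phi> \<in> mats C"
  unfolding mats_C_E mats_E
proof (intro conjI ballI)
  let ?M = "\<mu> \<phi>"
  note h = op_homD[OF AutD(2)[OF \<phi>], simplified]
  have fixk: "map_matrix \<phi> N = N" if "N \<in> mats k" for N using map_fixed[OF _ that] AutD(3)[OF \<phi>] by blast
  fix \<sigma> assume s: "\<sigma> \<in> \<Sigma>"
  then have op: "\<sigma> \<in> ops" by (simp add: ops_def)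
  have "map_matrix \<phi> (map_matrix \<sigma> Z) = map_matrix \<sigma> (map_matrix \<phi> Z)" using h(4)[OF op] by (simp add: vec_eq_iff)
  moreover have "map_matrix \<phi> (map_matrix \<sigma> Z) = A \<sigma> ** (Z ** ?M)"
    unfolding Z_ops(1)[OF s] map_matrix_mult[of \<phi>, OF h(2,3)] fixk[OF A_B(1)[OF s]] Z_mu[of \<phi>] ..
  moreover have "map_matrix \<sigma> (map_matrix \<phi> Z) = A \<sigma> ** (Z ** map_matrix \<sigma> ?M)"
    unfolding Z_mu[of \<phi>] map_matrix_mult[of \<sigma>, OF aut_simps(1,2)[OF s]] Z_ops(1)[OF s] by (simp add: matrix_mul_assoc)
  ultimately have eq: "A \<sigma> ** (Z ** ?M) = A \<sigma> ** (Z ** map_matrix \<sigma> ?M)" by simp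
  obtain N where "N ** A \<sigma> = mat 1" using A_B(2)[OF s] by blast
  then have "Z ** ?M = Z ** map_matrix \<sigma> ?M" using arg_cong[OF eq, of "\<lambda>W. N ** W"] by (simp add: matrix_mul_assoc)
  then show "map_matrix \<sigma> ?M = ?M" using Z_cancel by metis
next
  let ?M = "\<mu> \<phi>"
  note h = op_homD[OF AutD(2)[OF \<phi>], simplified]
  have fixk: "map_matrix \<phi> N = N" if "N \<in> mats k" for N using map_fixed[OF _ that] AutD(3)[OF \<phi>] by blast
  fix \<delta> assume s: "\<delta> \<in> \<Delta>"
  then have op: "\<delta> \<in> ops" "\<delta> \<in> \<Delta> \<union> set ds" by (simp_all add: ops_def)
  have "map_matrix \<phi> (map_matrix \<delta> Z) = map_matrix \<delta> (map_matrix \<phi> Z)" using h(4)[OF op(1)] by (simp add: vec_eq_iff)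
  moreover have "map_matrix \<phi> (map_matrix \<delta> Z) = B \<delta> ** (Z ** ?M)"
    unfolding Z_ops(2)[OF s] map_matrix_mult[of \<phi>, OF h(2,3)] fixk[OF A_B(3)[OF s]] Z_mu[of \<phi>] ..
  moreover have "map_matrix \<delta> (map_matrix \<phi> Z) = B \<delta> ** (Z ** ?M) + Z ** map_matrix \<delta> ?M"
    unfolding Z_mu[of \<phi>] map_matrix_deriv_mult[of \<delta>, OF der_simps(1,2)[OF op(2)]] Z_ops(2)[OF s] by (simp add: matrix_mul_assoc)
  ultimately have "Z ** map_matrix \<delta> ?M = Z ** 0" by simp
  then show "map_matrix \<delta> ?M = 0" by (rule Z_cancel)
qed

lemma Aut_id: "id \<in> Aut"
  by (rule AutI) (auto simp: op_hom_def)

lemma Aut_comp: "\<phi> \<in> Aut \<Longrightarrow> \<psi> \<in> Aut \<Longrightarrow> \<phi> \<circ> \<psi> \<in> Aut"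
  using AutD[of \<phi>] AutD[of \<psi>] by (intro AutI) (auto simp: op_hom_def bij_comp)

lemma Aut_inv:
  assumes "\<phi> \<in> Aut"
  shows "inv_into UNIV \<phi> \<in> Aut" "inv_into UNIV \<phi> \<circ> \<phi> = id" "\<phi> \<circ> inv_into UNIV \<phi> = id"
proof -
  note b = AutD(1)[OF assms] and h = op_homD[OF AutD(2)[OF assms], simplified]
  have i: "inv_into UNIV \<phi> x = y \<longleftrightarrow> x = \<phi> y" for x y using b by (metis bij_inv_eq_iff)
  have s: "\<phi> (inv_into UNIV \<phi> x) = x" for x using i[of x "inv_into UNIV \<phi> x"] by simp
  show "inv_into UNIV \<phi> \<in> Aut"
  proof (rule AutI)
    show "bij (inv_into UNIV \<phi>)" by (rule bij_imp_bij_inv[OF b])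
    show "op_hom UNIV (inv_into UNIV \<phi>)" unfolding op_hom_def by (auto simp: i h s)
    show "inv_into UNIV \<phi> x = x" if "x \<in> k" for x using AutD(3)[OF assms that] i by simp
  qed
  show "inv_into UNIV \<phi> \<circ> \<phi> = id" "\<phi> \<circ> inv_into UNIV \<phi> = id" using b by (auto simp: fun_eq_iff i s)
qed

text \<open>The entries of \<open>\<mu> \<psi>\<close> lie in \<open>k\<close> and are fixed by
  \<open>\<phi>\<close>. Acting by right multiplication on \<open>Z\<close> therefore gives a
  homomorphism, not an antihomomorphism.\<close>

lemma mu_comp:
  assumes "\<phi> \<in> Aut" "\<psi> \<in> Aut"
  shows "\<mu> (\<phi> \<circ> \<psi>) = \<mu> \<phi> ** \<mu> \<psi>"
proof -
  note h = op_homD[OF AutD(2)[OF assms(1)], simplified]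
  have C: "\<mu> \<psi> \<in> mats k" using mu_mats[OF assms(2)] C_le by (auto simp: mats_def)
  have fixk: "map_matrix \<phi> (\<mu> \<psi>) = \<mu> \<psi>" using map_fixed[OF _ C] AutD(3)[OF assms(1)] by blast
  have "Z ** \<mu> (\<phi> \<circ> \<psi>) = map_matrix (\<phi> \<circ> \<psi>) Z" by (simp add: Z_mu)
  also have "\<dots> = map_matrix \<phi> (Z ** \<mu> \<psi>)" by (simp add: Z_mu[symmetric] vec_eq_iff)
  also have "\<dots> = (Z ** \<mu> \<phi>) ** \<mu> \<psi>"
    unfolding map_matrix_mult[of \<phi>, OF h(2,3)] fixk Z_mu[of \<phi>] ..
  finally have "Z ** \<mu> (\<phi> \<circ> \<psi>) = Z ** (\<mu> \<phi> ** \<mu> \<psi>)" by (simp add: matrix_mul_assoc)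
  then show ?thesis by (rule Z_cancel)
qed

lemma mu_id: "\<mu> id = mat 1"
proof -
  have "map_matrix id Z = Z" by (simp add: vec_eq_iff)
  then show ?thesis by (simp add: \<mu>_def Zi(3))
qed

lemma mu_GL:
  assumes "\<phi> \<in> Aut"
  shows "\<mu> \<phi> \<in> carrier (GL C)"
proof -
  have "\<mu> \<phi> ** \<mu> (inv_into UNIV \<phi>) = mat 1" "\<mu> (inv_into UNIV \<phi>) ** \<mu> \<phi> = mat 1"
    using mu_comp[OF assms Aut_inv(1)[OF assms]] mu_comp[OF Aut_inv(1)[OF assms] assms] Aut_inv(2,3)[OF assms] mu_id by simp_all
  then show ?thesis using mu_mats[OF assms] mu_mats[OF Aut_inv(1)[OF assms]] by (auto simp: GL_def)
qed

lemma det_unit: obtains w where "w \<in> R" "w * det Z = 1"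
proof -
  have "det Zi * det Z = 1" using arg_cong[OF Zi(3), of det] by (simp add: det_mul)
  then show ?thesis using that[of "det Zi"] det_in_subring[OF R_ring(2) Zi(1)] by simp
qed

lemma mu_inj:
  assumes "\<phi> \<in> Aut" "\<psi> \<in> Aut" "\<mu> \<phi> = \<mu> \<psi>"
  shows "\<phi> = \<psi>"
proof
  fix x
  let ?X = "{x. \<phi> x = \<psi> x}"
  note p = AutD[OF assms(1)] AutD[OF assms(2)]
  have U: "is_subring (UNIV :: 'a set)" by (simp add: is_subring_def)
  note h1 = op_homD[OF p(2), simplified] op_hom_diff(2)[OF p(2) U, simplified]
    and h2 = op_homD[OF p(5), simplified] op_hom_diff(2)[OF p(5) U, simplified]
  have Z: "\<phi> (Z $ i $ j) = \<psi> (Z $ i $ j)" for i j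
    using assms(3) Z_mu[of \<phi>] Z_mu[of \<psi>] by (metis map_matrix_nth)
  have sub: "is_subring ?X" unfolding is_subring_def by (simp add: h1 h2)
  have "R \<subseteq> ?X"
  proof (rule R_least[OF sub])
    show "d x \<in> ?X" if "d \<in> set ds" "x \<in> ?X" for d x using that h1(4)[of d x] h2(4)[of d x] by (simp add: ops_def)
    show "k \<subseteq> ?X" using p(3,6) by auto
    show "Z $ i $ j \<in> ?X" for i j using Z by simp
    fix w assume w: "w * det Z = 1"
    have "det Z \<in> ?X" using Z by (intro det_in_subring[OF sub]) (simp add: mats_def)
    then have "\<phi> w * \<phi> (det Z) = 1" "\<psi> w * \<phi> (det Z) = 1" using h1(1) h1(3)[of w "det Z"] h2(1) h2(3)[of w "det Z"] w by simp_all
    then have "\<phi> w = \<psi> w" by (metis mult.assoc mult.commute mult_1)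
    then show "w \<in> ?X" by simp
  qed
  obtain r s t where *: "r \<in> R" "s \<in> nonzerodivisors R" "x * s = r" "s * t = 1" by (rule quotient_form)
  have s: "\<phi> s = \<psi> s" "\<phi> r = \<psi> r" using * \<open>R \<subseteq> ?X\<close> by (auto simp: nonzerodivisors_def)
  have "\<phi> x * \<phi> s = \<psi> x * \<phi> s" using s h1(3)[of x s] h2(3)[of x s] *(3) by simp
  moreover have "\<phi> s * \<phi> t = 1" using h1(1) h1(3)[of s t] *(4) by simp
  ultimately show "\<phi> x = \<psi> x" using unit_cancel by blast
qed

lemma group_Aut: "group (aut_group \<Sigma> \<Delta> ds k)"
proof (rule groupI)
  fix \<phi> \<psi> \<chi> assume "\<phi> \<in> Aut"
  then show "\<exists>\<psi>\<in>Aut. \<psi> \<otimes>\<^bsub>aut_group \<Sigma> \<Delta> ds k\<^esub> \<phi> = \<one>\<^bsub>aut_group \<Sigma> \<Delta> ds k\<^esub>"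
    using Aut_inv by (intro bexI[of _ "inv_into UNIV \<phi>"]) (auto simp: aut_group_def)
qed (use Aut_id Aut_comp in \<open>auto simp: aut_group_def comp_assoc\<close>)

lemma mu_hom: "\<mu> \<in> hom (aut_group \<Sigma> \<Delta> ds k) (GL C)"
  using mu_GL mu_comp by (auto simp: hom_def aut_group_def GL_def)

end

section \<open>Differential polynomials in the matrix entries\<close>

lemma derivative_op_commute:
  assumes "\<And>d x. d \<in> set ds \<Longrightarrow> \<phi> (d x) = d (\<phi> x)"
  shows "\<phi> (derivative_op ds e x) = derivative_op ds e (\<phi> x)"
proof -
  have pow: "\<phi> ((d ^^ n) z) = (d ^^ n) (\<phi> z)" if "d \<in> set ds" for d n z
    using assms[OF that] by (induction n) auto
  have "\<phi> (foldr (\<lambda>i f. (ds ! i ^^ lkp e i) \<circ> f) l id x) = foldr (\<lambda>i f. (ds ! i ^^ lkp e i) \<circ> f) l id (\<phi> x)"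
    if "set l \<subseteq> {..<length ds}" for l
    using that
  proof (induction l)
    case (Cons i l)
    then show ?case using pow[of "ds ! i"] by simp
  qed simp
  from this[of "[0..<length ds]"] show ?thesis by (simp add: derivative_op_def lessThan_atLeast0)
qed

lemma dpoly_eval_derivative_op:
  assumes der: "\<And>d. d \<in> set ds \<Longrightarrow> is_derivation UNIV d"
    and comm: "\<And>d d' x. d \<in> set ds \<Longrightarrow> d' \<in> set ds \<Longrightarrow> d (d' x) = d' (d x)"
  shows "dpoly_eval ds a (derivative_op (map (\<lambda>j. dpoly_deriv (ds ! j) j) [0..<length ds]) e p) = derivative_op ds e (dpoly_eval ds a p)"
proof -
  let ?ds = "map (\<lambda>j. dpoly_deriv (ds ! j) j) [0..<length ds]"
  have one: "dpoly_eval ds a (dpoly_deriv (ds ! j) j q) = (ds ! j) (dpoly_eval ds a q)" if "j < length ds" for j q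
  proof (rule dpoly_eval_deriv[OF der _ that])
    show "d (d' x) = d' (d x)" if "d \<in> set ds" "d' \<in> set ds" for d d' x by (rule comm[OF that])
  qed
  have pow: "dpoly_eval ds a ((dpoly_deriv (ds ! j) j ^^ n) q) = (ds ! j ^^ n) (dpoly_eval ds a q)" if "j < length ds" for j n q
    using one[OF that] by (induction n) auto
  have "dpoly_eval ds a (foldr (\<lambda>i f. (?ds ! i ^^ lkp e i) \<circ> f) l id p) = foldr (\<lambda>i f. (ds ! i ^^ lkp e i) \<circ> f) l id (dpoly_eval ds a p)"
    if "set l \<subseteq> {..<length ds}" for l
    using that
  proof (induction l)
    case (Cons i l)
    then have "?ds ! i = dpoly_deriv (ds ! i) i" by simp
    then show ?case using Cons pow[of i] by simp
  qed simp
  from this[of "[0..<length ds]"] show ?thesis by (simp add: derivative_op_def[of ?ds] derivative_op_def[of ds] lessThan_atLeast0)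
qed

definition hom_on :: "'a::comm_ring_1 set \<Rightarrow> ('a \<Rightarrow> 'a) \<Rightarrow> bool" where
  "hom_on X \<phi> \<longleftrightarrow> is_subring X \<and> \<phi> 1 = 1 \<and> (\<forall>x\<in>X. \<forall>y\<in>X. \<phi> (x + y) = \<phi> x + \<phi> y \<and> \<phi> (x * y) = \<phi> x * \<phi> y)"

context
  fixes X :: "'a::comm_ring_1 set" and \<phi> :: "'a \<Rightarrow> 'a"
  assumes h: "hom_on X \<phi>"
begin

lemma hom_on_simps:
  "is_subring X" "\<phi> 1 = 1" "x \<in> X \<Longrightarrow> y \<in> X \<Longrightarrow> \<phi> (x + y) = \<phi> x + \<phi> y" "x \<in> X \<Longrightarrow> y \<in> X \<Longrightarrow> \<phi> (x * y) = \<phi> x * \<phi> y"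
  using h by (simp_all add: hom_on_def)

lemma hom_on_0: "\<phi> 0 = 0"
  using hom_on_simps(3)[of 0 0] is_subringD(2)[OF hom_on_simps(1)] by simp

lemma hom_on_diff: "x \<in> X \<Longrightarrow> y \<in> X \<Longrightarrow> \<phi> (x - y) = \<phi> x - \<phi> y"
  using hom_on_simps(3)[of "x - y" y] is_subringD(3)[OF hom_on_simps(1)] by simp

lemma hom_on_sum: "(\<And>i. i \<in> I \<Longrightarrow> g i \<in> X) \<Longrightarrow> \<phi> (sum g I) = (\<Sum>i\<in>I. \<phi> (g i))"
  by (induction I rule: infinite_finite_induct) (auto simp: hom_on_0 hom_on_simps(3) subring_sum[OF hom_on_simps(1)])

lemma hom_on_prod: "(\<And>i. i \<in> I \<Longrightarrow> g i \<in> X) \<Longrightarrow> \<phi> (prod g I) = (\<Prod>i\<in>I. \<phi> (g i))"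
  by (induction I rule: infinite_finite_induct) (auto simp: hom_on_simps(2,4) subring_prod[OF hom_on_simps(1)])

lemma hom_on_power: "x \<in> X \<Longrightarrow> \<phi> (x ^ n) = \<phi> x ^ n"
  by (induction n) (auto simp: hom_on_simps(2,4) subring_power[OF hom_on_simps(1)])

lemma hom_on_matrix_mult:
  fixes M N :: "'a ^ 'n::finite ^ 'n"
  assumes "M \<in> mats X" "N \<in> mats X"
  shows "map_matrix \<phi> (M ** N) = map_matrix \<phi> M ** map_matrix \<phi> N"
  using assms is_subringD(4)[OF hom_on_simps(1)]
  by (simp add: vec_eq_iff matrix_matrix_mult_def mats_def hom_on_sum hom_on_simps(4))

lemma hom_on_det:
  fixes M :: "'a ^ 'n::finite ^ 'n"
  assumes "M \<in> mats X"
  shows "\<phi> (det M) = det (map_matrix \<phi> M)"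
proof -
  note X = hom_on_simps(1)
  have s: "of_int (sign p) \<in> X \<and> \<phi> (of_int (sign p)) = of_int (sign p)" for p :: "'n \<Rightarrow> 'n"
    using is_subringD(1,2,5)[OF X] hom_on_diff[of 0 1] by (auto simp: sign_def hom_on_simps(2) hom_on_0)
  have p: "(\<Prod>i\<in>UNIV. M $ i $ p i) \<in> X" for p using assms by (intro subring_prod[OF X]) (simp add: mats_def)
  have "\<phi> (det M) = (\<Sum>p | p permutes UNIV. \<phi> (of_int (sign p) * (\<Prod>i\<in>UNIV. M $ i $ p i)))"
    unfolding det_def using s p by (intro hom_on_sum is_subringD(4)[OF X]) auto
  also have "\<dots> = (\<Sum>p | p permutes UNIV. of_int (sign p) * (\<Prod>i\<in>UNIV. \<phi> (M $ i $ p i)))"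
  proof (intro sum.cong refl)
    fix q :: "'n \<Rightarrow> 'n"
    have "\<phi> (\<Prod>i\<in>UNIV. M $ i $ q i) = (\<Prod>i\<in>UNIV. \<phi> (M $ i $ q i))" using assms by (intro hom_on_prod) (simp add: mats_def)
    then show "\<phi> (of_int (sign q) * (\<Prod>i\<in>UNIV. M $ i $ q i)) = of_int (sign q) * (\<Prod>i\<in>UNIV. \<phi> (M $ i $ q i))"
      using s[of q] p[of q] hom_on_simps(4) by simp
  qed
  finally show ?thesis by (simp add: det_def)
qed

end

context pv_extension
begin

lemma op_hom_on: "op_hom X \<phi> \<Longrightarrow> is_subring X \<Longrightarrow> hom_on X \<phi>"
  by (simp add: op_hom_def hom_on_def)

abbreviation "evm N \<equiv> dpoly_eval ds (\<lambda>(i :: 'n, j :: 'n). N $ i $ j)"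
abbreviation "polyM L \<equiv> dpolys (length ds) L (UNIV :: ('n \<times> 'n) set)"

lemma Aut_evm:
  assumes \<phi>: "\<phi> \<in> Aut" and p: "p \<in> polyM k"
  shows "\<phi> (evm N p) = evm (map_matrix \<phi> N) p"
proof -
  note ph = AutD[OF \<phi>]
  have h: "hom_on UNIV \<phi>" by (rule op_hom_on[OF ph(2)]) (simp add: is_subring_def)
  note hs = hom_on_simps(4)[OF h] hom_on_sum[OF h] hom_on_prod[OF h] hom_on_power[OF h]
  have d: "\<phi> (derivative_op ds e x) = derivative_op ds e (\<phi> x)" for e x
    by (rule derivative_op_commute) (use op_homD(4)[OF ph(2)] in \<open>simp add: ops_def\<close>)
  have m: "\<phi> (mono_eval ds (\<lambda>(i, j). N $ i $ j) t) = mono_eval ds (\<lambda>(i, j). map_matrix \<phi> N $ i $ j) t" for t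
    unfolding mono_eval_def by (simp add: hs d case_prod_beta)
  have "\<phi> (lkp p t) = lkp p t" if "t \<in> kys p" for t using p that ph(3) by (auto simp: dpolys_iff)
  then have "\<phi> (lkp p t * mono_eval ds (\<lambda>(i, j). N $ i $ j) t) = lkp p t * mono_eval ds (\<lambda>(i, j). map_matrix \<phi> N $ i $ j) t"
    if "t \<in> kys p" for t using that unfolding hom_on_simps(4)[OF h UNIV_I UNIV_I] m by (simp only:)
  then show ?thesis unfolding dpoly_eval_mono hom_on_sum[OF h UNIV_I] by (rule sum.cong[OF refl])
qed

text \<open>\<open>q\<close> is \<open>p\<close> with the unknown matrix \<open>Y\<close> replaced
  by \<open>Z Y\<close>; the required derivatives of the entries \<open>ent v\<close> are taken
  inside the polynomial ring. The coefficients of \<open>q\<close> involve the entries of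
  \<open>Z\<close> and their derivatives, so they lie in \<open>K\<close> and no longer in
  \<open>k\<close>.\<close>

lemma evm_substitute:
  assumes p: "p \<in> polyM UNIV"
  shows "\<exists>q\<in>polyM UNIV. \<forall>N. evm N q = evm (Z ** N) p"
proof -
  let ?ds = "map (\<lambda>j. dpoly_deriv (ds ! j) j) [0..<length ds]"
  have U: "is_subring (UNIV :: 'a set)" by (simp add: is_subring_def)
  note S = subring_dpolys[OF U, of "length ds" "UNIV :: ('n \<times> 'n) set"]
  define ent where "ent v = (\<Sum>l\<in>UNIV. dconst (Z $ fst v $ l) * dvar ((l, snd v), 0))" for v :: "'n \<times> 'n"
  define q where "q = (\<Sum>t\<in>kys p. dconst (lkp p t) * (\<Prod>x\<in>kys t. derivative_op ?ds (snd x) (ent (fst x)) ^ lkp t x))"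
  have ent: "ent v \<in> polyM UNIV" for v unfolding ent_def
    by (intro subring_sum[OF S] is_subringD(4)[OF S] dconst_dpolys dvar_dpolys[OF U]) auto
  have ds: "d ` polyM UNIV \<subseteq> polyM UNIV" if d: "d \<in> set ?ds" for d
  proof -
    obtain j where j: "j < length ds" "d = dpoly_deriv (ds ! j) j" using d by auto
    show ?thesis using derivation_dpoly_deriv[OF derC[OF nth_mem[OF j(1)]] U _ j(1), where V = "UNIV :: ('n \<times> 'n) set"]
      unfolding j(2) is_derivation_def by simp
  qed
  have "q \<in> polyM UNIV" unfolding q_def
    by (intro subring_sum[OF S] is_subringD(4)[OF S] dconst_dpolys subring_prod[OF S] subring_power[OF S]
        derivative_op_closed[OF ds ent]) auto
  moreover have "evm N q = evm (Z ** N) p" for N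
  proof -
    have e: "evm N (ent v) = (case v of (i, j) \<Rightarrow> (Z ** N) $ i $ j)" for v
      by (simp add: ent_def dpoly_eval_sum dpoly_eval_mult matrix_matrix_mult_def case_prod_beta)
    have d: "evm N (derivative_op ?ds e r) = derivative_op ds e (evm N r)" for e r
    proof (rule dpoly_eval_derivative_op)
      show "d (d' x) = d' (d x)" if "d \<in> set ds" "d' \<in> set ds" for d d' x by (rule commC[OF that])
    qed (rule derC)
    have "evm N q = (\<Sum>t\<in>kys p. lkp p t * (\<Prod>x\<in>kys t. derivative_op ds (snd x) (case fst x of (i, j) \<Rightarrow> (Z ** N) $ i $ j) ^ lkp t x))"
      unfolding q_def dpoly_eval_sum dpoly_eval_mult dpoly_eval_prod dpoly_eval_power dpoly_eval_dconst d e ..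
    also have "\<dots> = evm (Z ** N) p" unfolding dpoly_eval_mono mono_eval_def ..
    finally show ?thesis .
  qed
  ultimately show ?thesis by blast
qed

text \<open>The ideal over \<open>C\<close> of the set of matrices of automorphisms. Its zeros form
  the Kolchin closure of that set, so the image of the group is closed as soon as each zero in
  \<open>GL C\<close> is again the matrix of an automorphism.\<close>

definition vanishing :: "('n \<times> 'n, 'a) dpoly set" where
  "vanishing = {f \<in> polyM C. \<forall>\<phi>\<in>Aut. evm (\<mu> \<phi>) f = 0}"

lemma evm_C: "N \<in> mats C \<Longrightarrow> f \<in> polyM C \<Longrightarrow> evm N f \<in> C"
  using C_derivative_op by (intro dpoly_eval_closed[OF C_subring]) (auto simp: mats_def)

text \<open>Expanded along a \<open>C\<close>-linearly independent set, \<open>p (Z Y)\<close> becomes a family of differential polynomials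
  in \<open>Y\<close> over \<open>C\<close>; each of them vanishes on all matrices of automorphisms.\<close>

lemma relation_preserved:
  assumes M: "\<And>f. f \<in> vanishing \<Longrightarrow> evm M f = 0" and p: "p \<in> polyM k" "evm Z p = 0"
  shows "evm (Z ** M) p = 0"
proof -
  have pU: "p \<in> polyM UNIV" using p(1) dpolys_mono[of k UNIV] by blast
  obtain q where q: "q \<in> polyM UNIV" "\<And>N. evm N q = evm (Z ** N) p" using evm_substitute[OF pU] by blast
  obtain X f where X: "finite X" "lin_indep C X" "\<forall>x\<in>X. f x \<in> polyM C" "q = (\<Sum>x\<in>X. dconst x * f x)"
    using dpoly_decompose[OF C_subfield q(1)] by (elim exE conjE) (rule that)
  have e: "evm N q = (\<Sum>x\<in>X. evm N (f x) * x)" for N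
    unfolding X(4) by (simp add: dpoly_eval_sum dpoly_eval_mult mult.commute)
  have "f x \<in> vanishing" if x: "x \<in> X" for x
  proof -
    have "evm (\<mu> \<phi>) (f x) = 0" if \<phi>: "\<phi> \<in> Aut" for \<phi>
    proof -
      have "evm (\<mu> \<phi>) q = \<phi> (evm Z p)" unfolding q(2) Aut_evm[OF \<phi> p(1)] Z_mu ..
      also have "\<dots> = 0" using p(2) op_hom_diff(1)[OF AutD(2)[OF \<phi>]] by (simp add: is_subring_def)
      finally have "(\<Sum>x\<in>X. evm (\<mu> \<phi>) (f x) * x) = 0" unfolding e .
      moreover have "\<forall>x\<in>X. evm (\<mu> \<phi>) (f x) \<in> C" using evm_C[OF mu_mats[OF \<phi>]] X(3) by blast
      ultimately show ?thesis using X(2) x unfolding lin_indep_def by (auto dest!: spec[of _ "\<lambda>x. evm (\<mu> \<phi>) (f x)"])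
    qed
    then show ?thesis using X(3) x by (simp add: vanishing_def)
  qed
  then have "evm M q = 0" unfolding e using M by (intro sum.neutral) simp
  then show ?thesis using q(2) by simp
qed

text \<open>The \<Pi>-ring \<open>k{Z}\<close>, without the inverse of the determinant: its elements
  are values of differential polynomials at \<open>Z\<close>, so a map on it can be given on
  representatives.\<close>

definition R1 :: "'a set" where "R1 = evm Z ` polyM k"

lemma R1_least:
  assumes X: "is_subring X" "\<And>d x. d \<in> set ds \<Longrightarrow> x \<in> X \<Longrightarrow> d x \<in> X" "k \<subseteq> X" "Z \<in> mats X"
  shows "R1 \<subseteq> X"
proof -
  have "derivative_op ds e x \<in> X" if "x \<in> X" for e x
    by (rule derivative_op_closed[OF _ that]) (use X(2) in auto)
  then show ?thesis unfolding R1_def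
    using X(3,4) by (auto simp: mats_def intro!: dpoly_eval_closed[OF X(1)])
qed

lemma evm_deriv: "j < length ds \<Longrightarrow> evm N (dpoly_deriv (ds ! j) j p) = (ds ! j) (evm N p)"
  by (rule dpoly_eval_deriv) (auto intro: derC commC)

lemma deriv_polyM:
  assumes j: "j < length ds" and p: "p \<in> polyM k"
  shows "dpoly_deriv (ds ! j) j p \<in> polyM k"
proof -
  have "(ds ! j) ` k \<subseteq> k" using op_closed[OF k_ring(1), of "ds ! j"] nth_mem[OF j] by (auto simp: ops_def)
  from derivation_dpoly_deriv[OF derC[OF nth_mem[OF j]] k_ring(2) this j, where V = "UNIV :: ('n \<times> 'n) set"] p
  show ?thesis by (auto simp: is_derivation_def)
qed

lemma R1_facts:
  shows "is_subring R1" "k \<subseteq> R1" "Z \<in> mats R1" "R1 \<subseteq> R" "\<And>f x. f \<in> ops \<Longrightarrow> x \<in> R1 \<Longrightarrow> f x \<in> R1"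
proof -
  note S = is_subringD[OF subring_dpolys[OF k_ring(2), of "length ds" "UNIV :: ('n \<times> 'n) set"]]
  show sub: "is_subring R1" unfolding is_subring_def R1_def
    using S by (auto simp: dpoly_eval_diff[symmetric] dpoly_eval_mult[symmetric] image_iff intro: bexI[of _ 1])
  show kR: "k \<subseteq> R1"
  proof
    fix x assume "x \<in> k"
    then show "x \<in> R1" unfolding R1_def using dconst_dpolys[of x k "length ds" "UNIV :: ('n \<times> 'n) set"]
      by (intro image_eqI[of _ _ "dconst x"]) auto
  qed
  show ZR: "Z \<in> mats R1"
  proof -
    have "Z $ i $ j \<in> R1" for i j
      unfolding R1_def using dvar_dpolys[OF k_ring(2), of "((i, j), 0)" "UNIV :: ('n \<times> 'n) set" "length ds"]
      by (intro image_eqI[of _ _ "dvar ((i, j), 0)"]) auto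
    then show ?thesis by (simp add: mats_def)
  qed
  have ds: "d x \<in> R1" if d: "d \<in> set ds" and x: "x \<in> R1" for d x
  proof -
    obtain j where j: "j < length ds" "d = ds ! j" using d by (auto simp: in_set_conv_nth)
    obtain p where p: "p \<in> polyM k" "x = evm Z p" using x unfolding R1_def by blast
    have "d x = evm Z (dpoly_deriv (ds ! j) j p)" using evm_deriv[OF j(1)] p(2) j(2) by simp
    then show ?thesis using deriv_polyM[OF j(1) p(1)] unfolding R1_def by blast
  qed
  show "R1 \<subseteq> R"
    by (rule R1_least[OF R_ring(2) _ R_ring(3) Zi(4)]) (use op_closed[OF R_ring(1)] in \<open>simp add: ops_def\<close>)
  fix f x assume f: "f \<in> ops" and x: "x \<in> R1"
  have fk: "f y \<in> k" if "y \<in> k" for y by (rule op_closed[OF k_ring(1) f that])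
  have "R1 \<subseteq> {x \<in> R1. f x \<in> R1}"
  proof (rule R1_least[OF subring_preimage[OF sub f]])
    show "d y \<in> {x \<in> R1. f x \<in> R1}" if "d \<in> set ds" "y \<in> {x \<in> R1. f x \<in> R1}" for d y
      using that ds comm[OF f, of d y] by (simp add: ops_def)
    show "k \<subseteq> {x \<in> R1. f x \<in> R1}" using kR fk by blast
    have "map_matrix f Z \<in> mats R1"
    proof -
      consider "f \<in> \<Sigma>" | "f \<in> \<Delta>" | "f \<in> set ds" using f by (auto simp: ops_def)
      then show ?thesis
      proof cases
        case 1
        then have "A f \<in> mats R1" using A_B(1)[OF 1] kR by (auto simp: mats_def)
        then show ?thesis unfolding Z_ops(1)[OF 1] by (rule mats_mult[OF sub _ ZR])
      next
        case 2
        then have "B f \<in> mats R1" using A_B(3)[OF 2] kR by (auto simp: mats_def)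
        then show ?thesis unfolding Z_ops(2)[OF 2] by (rule mats_mult[OF sub _ ZR])
      next
        case 3
        then show ?thesis using ds[OF 3] ZR by (simp add: mats_def)
      qed
    qed
    then show "Z \<in> mats {x \<in> R1. f x \<in> R1}" using ZR by (simp add: mats_def)
  qed
  then show "f x \<in> R1" using x by blast
qed

theorem matrix_of_automorphism:
  assumes M: "M \<in> carrier (GL C)" and van: "\<And>f. f \<in> vanishing \<Longrightarrow> evm M f = 0"
  shows "\<exists>\<phi>\<in>Aut. \<mu> \<phi> = M"
proof -
  obtain N where N: "N \<in> mats C" "M ** N = mat 1" "N ** M = mat 1" and MC: "M \<in> mats C" using M by (auto simp: GL_def)
  \<comment> \<open>An arbitrary representative is chosen; \<open>relation_preserved\<close>,
    applied to the difference of two representatives, shows that the value does not depend on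
    it.\<close>
  define \<phi>1 where "\<phi>1 x = evm (Z ** M) (SOME p. p \<in> polyM k \<and> evm Z p = x)" for x
  note S = is_subringD[OF subring_dpolys[OF k_ring(2), of "length ds" "UNIV :: ('n \<times> 'n) set"]]
  have \<phi>1: "\<phi>1 (evm Z p) = evm (Z ** M) p" if p: "p \<in> polyM k" for p
  proof -
    let ?q = "SOME q. q \<in> polyM k \<and> evm Z q = evm Z p"
    have q: "?q \<in> polyM k \<and> evm Z ?q = evm Z p" by (rule someI[of _ p]) (simp add: p)
    then have "evm (Z ** M) (?q - p) = 0"
      using van by (intro relation_preserved S(3) p) (simp_all add: dpoly_eval_diff)
    then show ?thesis by (simp add: \<phi>1_def dpoly_eval_diff)
  qed
  have hom1: "hom_on R1 \<phi>1" unfolding hom_on_def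
  proof (intro conjI ballI R1_facts(1))
    show "\<phi>1 1 = 1" using \<phi>1[OF S(1)] by simp
    fix x y assume "x \<in> R1" "y \<in> R1"
    then obtain p q where pq: "p \<in> polyM k" "x = evm Z p" "q \<in> polyM k" "y = evm Z q" unfolding R1_def by blast
    show "\<phi>1 (x + y) = \<phi>1 x + \<phi>1 y" "\<phi>1 (x * y) = \<phi>1 x * \<phi>1 y"
      using \<phi>1[OF S(6)[OF pq(1,3)]] \<phi>1[OF S(4)[OF pq(1,3)]] \<phi>1[OF pq(1)] \<phi>1[OF pq(3)]
      by (simp_all add: pq(2,4) dpoly_eval_add dpoly_eval_mult)
  qed
  note h1 = hom_on_simps[OF hom1]
  have k1: "\<phi>1 x = x" if "x \<in> k" for x
    using \<phi>1[OF dconst_dpolys[OF that]] by simp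
  have Z1: "map_matrix \<phi>1 Z = Z ** M"
  proof -
    have "\<phi>1 (Z $ i $ j) = (Z ** M) $ i $ j" for i j
      using \<phi>1[OF dvar_dpolys[OF k_ring(2), of "((i, j), 0)"]] by simp
    then show ?thesis by (simp add: vec_eq_iff)
  qed
  have ds1: "\<phi>1 (d x) = d (\<phi>1 x)" if d: "d \<in> set ds" and x: "x \<in> R1" for d x
  proof -
    obtain j where j: "j < length ds" "d = ds ! j" using d by (auto simp: in_set_conv_nth)
    obtain p where p: "p \<in> polyM k" "x = evm Z p" using x unfolding R1_def by blast
    show ?thesis using \<phi>1[OF deriv_polyM[OF j(1) p(1)]] \<phi>1[OF p(1)] by (simp add: evm_deriv[OF j(1)] p(2) j(2))
  qed
  have ops1: "\<phi>1 (f x) = f (\<phi>1 x)" if f: "f \<in> ops" and x: "x \<in> R1" for f x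
  proof (cases "f \<in> set ds")
    case True
    then show ?thesis using ds1 x by blast
  next
    case False
    \<comment> \<open>The set where \<open>\<phi>1\<close> commutes with \<open>f\<close> is closed
      under \<Pi>, since \<open>f\<close> and \<open>\<phi>1\<close> both commute with \<Pi>. It
      remains to test \<open>k\<close> and the entries of \<open>Z\<close>; there the entries of
      \<open>M\<close> must be constants under \<open>f\<close>.\<close>
    let ?X = "{x \<in> R1. \<phi>1 (f x) = f (\<phi>1 x)}"
    have fR: "f y \<in> R1" if "y \<in> R1" for y by (rule R1_facts(5)[OF f that])
    note R1' = is_subringD[OF R1_facts(1)]
    have sub: "is_subring ?X" unfolding is_subring_def
    proof (intro conjI ballI)
      have "\<phi>1 (f 1) = f 1" using op_one[OF f] h1(2) hom_on_0[OF hom1] by auto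
      then show "1 \<in> ?X" using R1'(1) h1(2) by simp
      fix a b assume ab: "a \<in> ?X" "b \<in> ?X"
      show "a - b \<in> ?X" using ab R1'(3) fR by (simp add: op_add(2)[OF f] hom_on_diff[OF hom1])
      show "a * b \<in> ?X"
      proof (cases "f \<in> \<Sigma>")
        case True
        then show ?thesis using ab R1'(4) fR by (simp add: aut_simps[OF True] h1(4))
      next
        case False
        then have d: "f \<in> \<Delta> \<union> set ds" using f by (simp add: ops_def)
        show ?thesis using ab R1'(4) fR by (simp add: der_simps[OF d] h1(3,4))
      qed
    qed
    have "R1 \<subseteq> ?X"
    proof (rule R1_least[OF sub])
      fix d y assume d: "d \<in> set ds" and y: "y \<in> ?X"
      have dop: "d \<in> ops" using d by (simp add: ops_def)
      have yR: "y \<in> R1" using y by simp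
      have "\<phi>1 (f (d y)) = \<phi>1 (d (f y))" using comm[OF f dop] by simp
      also have "\<dots> = d (f (\<phi>1 y))" using ds1[OF d fR[OF yR]] y by simp
      also have "\<dots> = f (\<phi>1 (d y))" using ds1[OF d yR] comm[OF f dop] by simp
      finally show "d y \<in> ?X" using R1_facts(5)[OF dop yR] by simp
    next
      show "k \<subseteq> ?X" using R1_facts(2) k1 op_closed[OF k_ring(1) f] by auto
      have "map_matrix \<phi>1 (map_matrix f Z) = map_matrix f (Z ** M)"
      proof -
        consider "f \<in> \<Sigma>" | "f \<in> \<Delta>" using f False by (auto simp: ops_def)
        then show ?thesis
        proof cases
          case 1
          have a: "A f \<in> mats k" by (rule A_B(1)[OF 1])
          have fa: "map_matrix \<phi>1 (A f) = A f" using a k1 by (auto simp: vec_eq_iff mats_def)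
          from a have a1: "A f \<in> mats R1" using R1_facts(2) by (auto simp: mats_def)
          have fM: "map_matrix f M = M" using MC 1 unfolding mats_C_E mats_E by blast
          have "map_matrix \<phi>1 (map_matrix f Z) = A f ** (Z ** M)"
            unfolding Z_ops(1)[OF 1] hom_on_matrix_mult[OF hom1 a1 R1_facts(3)] Z1 fa ..
          also have "\<dots> = map_matrix f (Z ** M)"
            unfolding map_matrix_mult[of f, OF aut_simps(1,2)[OF 1]] Z_ops(1)[OF 1] fM by (simp add: matrix_mul_assoc)
          finally show ?thesis .
        next
          case 2
          then have d: "f \<in> \<Delta> \<union> set ds" by simp
          have a: "B f \<in> mats k" by (rule A_B(3)[OF 2])
          have fa: "map_matrix \<phi>1 (B f) = B f" using a k1 by (auto simp: vec_eq_iff mats_def)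
          from a have a1: "B f \<in> mats R1" using R1_facts(2) by (auto simp: mats_def)
          have fM: "map_matrix f M = 0" using MC 2 unfolding mats_C_E mats_E by blast
          have "map_matrix \<phi>1 (map_matrix f Z) = B f ** (Z ** M)"
            unfolding Z_ops(2)[OF 2] hom_on_matrix_mult[OF hom1 a1 R1_facts(3)] Z1 fa ..
          also have "\<dots> = map_matrix f (Z ** M)"
            unfolding map_matrix_deriv_mult[of f, OF der_simps(1,2)[OF d]] Z_ops(2)[OF 2] fM by (simp add: matrix_mul_assoc)
          finally show ?thesis .
        qed
      qed
      then have "map_matrix \<phi>1 (map_matrix f Z) = map_matrix f (map_matrix \<phi>1 Z)" unfolding Z1 .
      then show "Z \<in> mats ?X" using R1_facts(3) by (simp add: mats_def vec_eq_iff)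
    qed
    then show ?thesis using x by blast
  qed
  have op1: "op_hom R1 \<phi>1" using h1 ops1 by (simp add: op_hom_def)
  obtain w where w: "w \<in> R" "w * det Z = 1" by (rule det_unit)
  have detZ: "det Z \<in> R1" by (rule det_in_subring[OF R1_facts(1,3)])
  have \<phi>det: "\<phi>1 (det Z) = det Z * det M" using hom_on_det[OF hom1 R1_facts(3)] by (simp add: Z1 det_mul)
  have MN: "det M * det N = 1" using arg_cong[OF N(2), of det] by (simp add: det_mul)
  have \<phi>unit: "\<phi>1 (det Z) * (w * det N) = 1"
  proof -
    have "\<phi>1 (det Z) * (w * det N) = (w * det Z) * (det M * det N)" unfolding \<phi>det by (simp only: mult_ac)
    then show ?thesis using w MN by simp
  qed
  have den0: "\<exists>n. y * det Z ^ n \<in> R1" if "y \<in> R" for y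
  proof -
    let ?X = "{y. \<exists>n. y * det Z ^ n \<in> R1}"
    note R1' = is_subringD[OF R1_facts(1)]
    have up: "y * det Z ^ (n + m) \<in> R1" if "y * det Z ^ n \<in> R1" for y n m
      using R1'(4)[OF that subring_power[OF R1_facts(1) detZ, of m]] by (simp add: power_add mult.assoc)
    have "R \<subseteq> ?X"
    proof (rule R_least)
      show "is_subring ?X" unfolding is_subring_def
      proof (intro conjI ballI)
        show "1 \<in> ?X" using R1'(1) by (auto intro: exI[of _ 0])
        fix a b assume "a \<in> ?X" "b \<in> ?X"
        then obtain n m where nm: "a * det Z ^ n \<in> R1" "b * det Z ^ m \<in> R1" by blast
        have "(a - b) * det Z ^ (n + m) \<in> R1"
          using R1'(3)[OF up[OF nm(1), of m] up[OF nm(2), of n]] by (simp add: left_diff_distrib add.commute)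
        then show "a - b \<in> ?X" by blast
        have "(a * b) * det Z ^ (n + m) = (a * det Z ^ n) * (b * det Z ^ m)" by (simp add: power_add mult_ac)
        then show "a * b \<in> ?X" using R1'(4)[OF nm] by (metis (mono_tags, lifting) mem_Collect_eq)
      qed
      fix d y assume d: "d \<in> set ds" and "y \<in> ?X"
      then obtain n where n: "y * det Z ^ n \<in> R1" by blast
      have dd: "d \<in> \<Delta> \<union> set ds" "d \<in> ops" using d by (auto simp: ops_def)
      have "d (det Z ^ n) * det Z = of_nat n * det Z ^ n * d (det Z)"
      proof (cases n)
        case 0
        then show ?thesis by (simp add: der_simps(4)[OF dd(1)])
      next
        case (Suc m)
        then show ?thesis using derivation_power[OF derU[OF dd(1)], of "det Z" m] by (simp add: mult_ac del: of_nat_Suc)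
      qed
      then have "y * (d (det Z ^ n) * det Z) = of_nat n * d (det Z) * (y * det Z ^ n)" by (simp add: mult_ac)
      \<comment> \<open>A derivation raises the required power of \<open>det Z\<close> by one, as in
        the quotient rule.\<close>
      moreover have "d y * det Z ^ Suc n = d (y * det Z ^ n) * det Z - y * (d (det Z ^ n) * det Z)"
        by (simp add: der_simps(2)[OF dd(1)] algebra_simps)
      ultimately have "d y * det Z ^ Suc n = d (y * det Z ^ n) * det Z - of_nat n * d (det Z) * (y * det Z ^ n)" by simp
      also have "\<dots> \<in> R1"
        using R1'(3)[OF R1'(4)[OF R1_facts(5)[OF dd(2) n] detZ]
            R1'(4)[OF R1'(4)[OF subring_of_nat[OF R1_facts(1)] R1_facts(5)[OF dd(2) detZ]] n]] .
      finally show "d y \<in> ?X" by blast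
    next
      have R1X: "R1 \<subseteq> ?X" by (auto intro: exI[of _ 0])
      then show "k \<subseteq> ?X" using R1_facts(2) by blast
      show "Z $ i $ j \<in> ?X" for i j using R1X R1_facts(3) by (auto simp: mats_def)
      show "v \<in> ?X" if "v * det Z = 1" for v using that R1'(1) by (auto intro: exI[of _ 1])
    qed
    then show ?thesis using that by blast
  qed
  have den1: "\<exists>t\<in>R1. y * t \<in> R1 \<and> t dvd 1 \<and> \<phi>1 t dvd 1" if "y \<in> R" for y
  proof -
    obtain n where n: "y * det Z ^ n \<in> R1" using den0[OF \<open>y \<in> R\<close>] by (elim exE)
    have "det Z dvd 1" using w(2) by (metis dvd_triv_right)
    then have "det Z ^ n dvd 1" by (metis dvd_power_same power_one)
    moreover have "\<phi>1 (det Z ^ n) dvd 1"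
      using \<phi>unit unfolding hom_on_power[OF hom1 detZ] by (metis dvd_power_same dvd_triv_left power_one)
    ultimately show ?thesis using n subring_power[OF R1_facts(1) detZ] by blast
  qed
  have opR: "f x \<in> R" if "f \<in> ops" "x \<in> R" for f x by (rule op_closed[OF R_ring(1) that])
  have "\<exists>\<psi>. op_hom R \<psi> \<and> (\<forall>x\<in>R1 \<inter> R. \<psi> x = \<phi>1 x)"
    by (rule extend_to_localization; fact R1_facts(1,5) op1 opR R_ring(2) den1)
  then obtain \<phi>2 where op2: "op_hom R \<phi>2" and ext2: "\<forall>x\<in>R1 \<inter> R. \<phi>2 x = \<phi>1 x" by blast
  have hom2: "hom_on R \<phi>2" by (rule op_hom_on[OF op2 R_ring(2)])
  note h2 = hom_on_simps[OF hom2] and R' = is_subringD[OF R_ring(2)]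
  have eq2: "\<phi>2 x = \<phi>1 x" if "x \<in> R1" for x using ext2 that R1_facts(4) by blast
  have k2: "\<phi>2 x = x" if "x \<in> k" for x using eq2 k1 R1_facts(2) that by auto
  have Z2: "map_matrix \<phi>2 Z = Z ** M" using eq2 R1_facts(3) Z1 by (auto simp: vec_eq_iff mats_def)
  have CR: "C \<subseteq> R" using C_le R_ring(3) by blast
  have MR: "M \<in> mats R" "N \<in> mats R" using MC N(1) CR by (auto simp: mats_def)
  have detC: "det M \<in> C" "det N \<in> C" using det_in_subring[OF C_subring] MC N(1) by auto
  have w2: "\<phi>2 v = v * det N" if v: "v * det Z = 1" for v
  proof -
    have vR: "v \<in> R" by (rule R_generators(2)[OF v])
    have dR: "det Z \<in> R" using detZ R1_facts(4) by blast
    have "\<phi>2 v * (det Z * det M) = 1" using h2(4)[OF vR dR] v h2(2) eq2[OF detZ] \<phi>det by simp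
    moreover have "(v * det N) * (det Z * det M) = (v * det Z) * (det M * det N)" by (simp only: mult_ac)
    ultimately have "\<phi>2 v * (det Z * det M) = (v * det N) * (det Z * det M)" using v MN by simp
    moreover have "(det Z * det M) * (w * det N) = 1" using \<phi>unit \<phi>det by simp
    ultimately show ?thesis using unit_cancel by blast
  qed
  have into: "\<phi>2 x \<in> R" if "x \<in> R" for x
  proof -
    have "R \<subseteq> {x \<in> R. \<phi>2 x \<in> R}"
    proof (rule R_least)
      show "is_subring {x \<in> R. \<phi>2 x \<in> R}" unfolding is_subring_def
        using R' h2 by (simp add: hom_on_diff[OF hom2])
      show "d x \<in> {x \<in> R. \<phi>2 x \<in> R}" if "d \<in> set ds" "x \<in> {x \<in> R. \<phi>2 x \<in> R}" for d x
        using that opR[of d] op_homD(4)[OF op2, of d x] by (simp add: ops_def)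
      show "k \<subseteq> {x \<in> R. \<phi>2 x \<in> R}" using k2 R_ring(3) by auto
      have "Z ** M \<in> mats R" by (rule mats_mult[OF R_ring(2) Zi(4) MR(1)])
      then have "map_matrix \<phi>2 Z \<in> mats R" using Z2 by simp
      then show "Z $ i $ j \<in> {x \<in> R. \<phi>2 x \<in> R}" for i j using Zi(4) by (simp add: mats_def)
      show "v \<in> {x \<in> R. \<phi>2 x \<in> R}" if v: "v * det Z = 1" for v
        using R_generators(2)[OF v] w2[OF v] R'(4) detC(2) CR by auto
    qed
    then show ?thesis using that by blast
  qed
  have onto: "\<exists>y\<in>R. \<phi>2 y = x" if "x \<in> R" for x
  proof -
    have "R \<subseteq> \<phi>2 ` R"
    proof (rule R_least)
      show "is_subring (\<phi>2 ` R)" unfolding is_subring_def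
      proof (intro conjI ballI)
        show "1 \<in> \<phi>2 ` R" using h2(2) R'(1) by (metis imageI)
        fix a b assume "a \<in> \<phi>2 ` R" "b \<in> \<phi>2 ` R"
        then obtain x y where xy: "x \<in> R" "y \<in> R" "a = \<phi>2 x" "b = \<phi>2 y" by blast
        show "a - b \<in> \<phi>2 ` R" "a * b \<in> \<phi>2 ` R"
          using xy R'(3,4) hom_on_diff[OF hom2 xy(1,2), symmetric] h2(4)[OF xy(1,2), symmetric] by simp_all
      qed
      show "d x \<in> \<phi>2 ` R" if d: "d \<in> set ds" and x: "x \<in> \<phi>2 ` R" for d x
      proof -
        obtain y where y: "y \<in> R" "x = \<phi>2 y" using x by blast
        have "d \<in> ops" using d by (simp add: ops_def)
        then show ?thesis using y op_homD(4)[OF op2, of d y] opR[of d y] by (metis imageI)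
      qed
      show "k \<subseteq> \<phi>2 ` R" using k2 R_ring(3) by (metis image_eqI subsetD subsetI)
      \<comment> \<open>The preimage of \<open>Z\<close> is \<open>Z ** N\<close>, with
        \<open>N\<close> the inverse of \<open>M\<close>; its entries lie in \<open>C\<close> and
        are fixed by \<open>\<phi>2\<close>.\<close>
      have "map_matrix \<phi>2 (Z ** N) = Z"
      proof -
        have "\<phi>2 (N $ i $ j) = N $ i $ j" for i j
          by (rule k2) (use N(1) C_le in \<open>auto simp: mats_def\<close>)
        then have "map_matrix \<phi>2 N = N" by (simp add: vec_eq_iff)
        then have "map_matrix \<phi>2 (Z ** N) = Z ** (M ** N)"
          using hom_on_matrix_mult[OF hom2 Zi(4) MR(2)] Z2 by (simp add: matrix_mul_assoc)
        then show ?thesis using N(2) by simp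
      qed
      then have "\<phi>2 ((Z ** N) $ i $ j) = Z $ i $ j" for i j by (metis map_matrix_nth)
      moreover have "(Z ** N) $ i $ j \<in> R" for i j using mats_mult[OF R_ring(2) Zi(4) MR(2)] by (simp add: mats_def)
      ultimately show "Z $ i $ j \<in> \<phi>2 ` R" for i j by (metis imageI)
      fix v assume v: "v * det Z = 1"
      have vR: "v \<in> R" by (rule R_generators(2)[OF v])
      have dk: "det M \<in> k" "det M \<in> R" using detC(1) C_le CR by auto
      have "\<phi>2 (v * det M) = v * (det M * det N)" using h2(4)[OF vR dk(2)] w2[OF v] k2[OF dk(1)] by (simp add: mult_ac)
      then have "\<phi>2 (v * det M) = v" using MN by simp
      then show "v \<in> \<phi>2 ` R" using R'(4)[OF vR dk(2)] by (metis imageI)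
    qed
    then show ?thesis using that by blast
  qed
  \<comment> \<open>The kernel is stable under all operators, so simplicity of \<open>R\<close>
    gives injectivity.\<close>
  have inj2: "x = 0" if "x \<in> R" "\<phi>2 x = 0" for x
  proof -
    let ?I = "{x \<in> R. \<phi>2 x = 0}"
    have "sdp_ideal \<Sigma> \<Delta> ds R ?I"
    proof (rule sdp_idealI)
      show "ideal_in R ?I" unfolding ideal_in_def using R' h2 by (simp add: hom_on_0[OF hom2])
      show "f x \<in> ?I" if f: "f \<in> ops" and x: "x \<in> ?I" for f x
        using x opR[OF f] op_homD(4)[OF op2 f] op_add(3)[OF f] by simp
    qed
    moreover have "1 \<notin> ?I" using h2(2) by simp
    ultimately have "?I = {0}" by (rule simple)
    then show ?thesis using that by blast
  qed
  \<comment> \<open>Being bijective on \<open>R\<close>, \<open>\<phi>2\<close> preserves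
    nonzerodivisors, so denominators remain invertible in \<open>K\<close> and the second
    localisation step applies.\<close>
  have nzd: "\<phi>2 s \<in> nonzerodivisors R" if s: "s \<in> nonzerodivisors R" for s
    unfolding nonzerodivisors_def
  proof (intro CollectI conjI ballI impI)
    have sR: "s \<in> R" using s by (simp add: nonzerodivisors_def)
    then show "\<phi>2 s \<in> R" by (rule into)
    fix t assume t: "t \<in> R" "\<phi>2 s * t = 0"
    obtain t' where t': "t' \<in> R" "\<phi>2 t' = t" using onto[OF t(1)] by blast
    have "\<phi>2 (s * t') = 0" using h2(4)[OF sR t'(1)] t t' by simp
    then have "s * t' = 0" using inj2 R'(4)[OF sR t'(1)] by blast
    then have "t' = 0" using s t'(1) by (simp add: nonzerodivisors_def)
    then show "t = 0" using t'(2) hom_on_0[OF hom2] by simp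
  qed
  have unit: "s dvd 1" if "s \<in> nonzerodivisors R" for s
    using K_quot that unfolding total_quotient_ring_of_def by blast
  have U: "is_subring (UNIV :: 'a set)" by (simp add: is_subring_def)
  have den2: "\<exists>t\<in>R. y * t \<in> R \<and> t dvd 1 \<and> \<phi>2 t dvd 1" for y
  proof -
    obtain r s t where *: "r \<in> R" "s \<in> nonzerodivisors R" "y * s = r" "s * t = 1" by (rule quotient_form)
    have "s \<in> R" using *(2) by (simp add: nonzerodivisors_def)
    then show ?thesis using * unit[OF *(2)] unit[OF nzd[OF *(2)]] by blast
  qed
  have "\<exists>\<psi>. op_hom UNIV \<psi> \<and> (\<forall>x\<in>R \<inter> UNIV. \<psi> x = \<phi>2 x)"
    by (rule extend_to_localization) (rule UNIV_I den2 | fact R_ring(2) opR op2 U)+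
  then obtain \<phi>3 where op3: "op_hom UNIV \<phi>3" and ext3: "\<forall>x\<in>R \<inter> UNIV. \<phi>3 x = \<phi>2 x" by blast
  have eq3: "\<phi>3 x = \<phi>2 x" if "x \<in> R" for x using ext3 that by blast
  note h3 = hom_on_simps[OF op_hom_on[OF op3 U], simplified]
  have "inj \<phi>3"
  proof (rule injI)
    fix x y assume e: "\<phi>3 x = \<phi>3 y"
    obtain r s t where *: "r \<in> R" "s \<in> nonzerodivisors R" "(x - y) * s = r" "s * t = 1" by (rule quotient_form)
    have sR: "s \<in> R" using *(2) by (simp add: nonzerodivisors_def)
    have "\<phi>3 (x - y) = 0" using e hom_on_diff[OF op_hom_on[OF op3 U]] by simp
    then have "\<phi>2 r = 0" using h3(4)[of "x - y" s] *(3) eq3[OF *(1)] by simp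
    then have "r = 0" using inj2 *(1) by blast
    then have "(x - y) * s = 0 * s" using *(3) by simp
    then have "x - y = 0" by (rule unit_cancel[OF *(4)])
    then show "x = y" by simp
  qed
  moreover have "\<exists>x. \<phi>3 x = y" for y
  proof -
    obtain r s t where *: "r \<in> R" "s \<in> nonzerodivisors R" "y * s = r" "s * t = 1" by (rule quotient_form)
    have sR: "s \<in> R" using *(2) by (simp add: nonzerodivisors_def)
    obtain r' s' where rs: "r' \<in> R" "\<phi>2 r' = r" "s' \<in> R" "\<phi>2 s' = s" using onto *(1) sR by blast
    have "s' \<in> nonzerodivisors R" unfolding nonzerodivisors_def
    proof (intro CollectI conjI ballI impI rs(3))
      fix u assume u: "u \<in> R" "s' * u = 0"
      have "s * \<phi>2 u = 0" using h2(4)[OF rs(3) u(1)] u(2) rs(4) hom_on_0[OF hom2] by simp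
      then have "\<phi>2 u = 0" using *(2) into[OF u(1)] by (simp add: nonzerodivisors_def)
      then show "u = 0" using inj2 u(1) by blast
    qed
    then obtain v where v: "s' * v = 1" using unit by (metis dvd_def)
    have "\<phi>3 (r' * v) * s = \<phi>3 ((r' * v) * s')" using h3(4) eq3[OF rs(3)] rs(4) by simp
    also have "(r' * v) * s' = r' * (s' * v)" by (simp only: mult_ac)
    also have "\<phi>3 (r' * (s' * v)) = y * s" using v eq3[OF rs(1)] rs(2) *(3) by simp
    finally have "\<phi>3 (r' * v) = y" by (rule unit_cancel[OF *(4)])
    then show ?thesis by blast
  qed
  then have "surj \<phi>3" by (auto simp: surj_def intro: sym)
  ultimately have "bij \<phi>3" by (simp add: bij_def)
  then have \<phi>3: "\<phi>3 \<in> Aut" using op3 eq3 k2 R_ring(3) by (intro AutI) auto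
  have "map_matrix \<phi>3 Z = map_matrix \<phi>2 Z" using eq3 Zi(4) by (simp add: vec_eq_iff mats_def)
  then have "\<mu> \<phi>3 = M" using Z2 Zi(3) by (simp add: \<mu>_def matrix_mul_assoc)
  then show ?thesis using \<phi>3 by blast
qed

text \<open>The matrices of automorphisms are zeros of \<open>vanishing\<close> by its definition,
  and \<open>matrix_of_automorphism\<close> gives the converse, so the image of the group is defined
  by differential equations over \<open>C\<close>. Injectivity of \<open>\<mu>\<close> turns the
  homomorphism into an isomorphism onto this image.\<close>

theorem galois_group:
  "\<exists>G. linear_diff_alg_group ds C G \<and>
    (\<exists>\<mu> \<in> iso (aut_group \<Sigma> \<Delta> ds k) ((GL C)\<lparr>carrier := G\<rparr>).
       \<forall>\<phi> \<in> carrier (aut_group \<Sigma> \<Delta> ds k). map_matrix \<phi> Z = Z ** \<mu> \<phi>)"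
proof -
  let ?G = "\<mu> ` Aut"
  interpret group_hom "aut_group \<Sigma> \<Delta> ds k" "GL C :: ('a ^ 'n ^ 'n) monoid" \<mu>
    using group_Aut group_GL[OF C_subring] mu_hom by (simp add: group_hom_def group_hom_axioms_def)
  have "subgroup ?G (GL C)" by (rule img_is_subgroup)
  moreover have "?G = {M \<in> carrier (GL C). \<forall>p\<in>vanishing. evm M p = 0}"
  proof
    show "?G \<subseteq> {M \<in> carrier (GL C). \<forall>p\<in>vanishing. evm M p = 0}"
      using mu_GL by (auto simp: vanishing_def)
    show "{M \<in> carrier (GL C). \<forall>p\<in>vanishing. evm M p = 0} \<subseteq> ?G"
      using matrix_of_automorphism by blast
  qed
  moreover have "vanishing \<subseteq> polyM C" by (auto simp: vanishing_def)
  ultimately have "linear_diff_alg_group ds C ?G" unfolding linear_diff_alg_group_def by blast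
  moreover have "\<mu> \<in> iso (aut_group \<Sigma> \<Delta> ds k) ((GL C)\<lparr>carrier := ?G\<rparr>)"
  proof -
    have "\<mu> \<in> hom (aut_group \<Sigma> \<Delta> ds k) ((GL C)\<lparr>carrier := ?G\<rparr>)" using mu_hom by (auto simp: hom_def)
    moreover have "inj_on \<mu> Aut" using mu_inj by (auto intro: inj_onI)
    ultimately show ?thesis by (simp add: iso_def bij_betw_def)
  qed
  ultimately show ?thesis using Z_mu by blast
qed

end

theorem proposition6p18:
  fixes \<Sigma> \<Delta> :: "('a::{comm_ring_1,ring_char_0} \<Rightarrow> 'a) set"
    and ds :: "('a \<Rightarrow> 'a) list"
    and k R C :: "'a set"
    and A B :: "('a \<Rightarrow> 'a) \<Rightarrow> 'a ^ 'n::finite ^ 'n"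
    and Z :: "'a ^ 'n ^ 'n"
  assumes K: "sdp_ring \<Sigma> \<Delta> ds (UNIV :: 'a set)"
    and k: "sdp_field \<Sigma> \<Delta> ds k"
    and C_def: "C = sd_constants \<Sigma> \<Delta> k"
    and C_closed: "differentially_closed ds C"
    and system: "sd_linear_system \<Sigma> \<Delta> k A B"
    and R: "pv_ring \<Sigma> \<Delta> ds k A B Z R"
    and K_quot: "total_quotient_ring_of R"
  shows "\<exists>G. linear_diff_alg_group ds C G \<and>
    (\<exists>\<mu> \<in> iso (aut_group \<Sigma> \<Delta> ds k) ((GL C)\<lparr>carrier := G\<rparr>).
       \<forall>\<phi> \<in> carrier (aut_group \<Sigma> \<Delta> ds k). map_matrix \<phi> Z = Z ** \<mu> \<phi>)"
proof -
  interpret pv_extension \<Sigma> \<Delta> ds k R C A B Z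
    by unfold_locales fact+
  show ?thesis by (rule galois_group)
qed

end
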